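(* Let $K$ be a finite simplicial complex, $N\in\mathbb N$, $\epsilon>0$ and $p\in\mathbb N$, and let $FF_N(K)$, $S$, $\mathrm{PH}_p$, the bottleneck distance $d_B$ and the set $\mathcal N_p\subseteq FF_N(K)$ be as defined in the context. Then the map $$\mathrm{PH}_p\circ S:(FF_N(K),\|\cdot\|_\infty)\to(\mathcal D,d_B)$$ is locally Lipschitz on $FF_N(K)\setminus\mathcal N_p$.
   Context: Conventions: $\mathbb N=\{0,1,2,\dots\}$. A finite simplicial complex $K$ is a finite collection of non-empty finite sets (simplices) closed under taking non-empty subsets; $\dim\sigma=|\sigma|-1$. A field $\mathbb F$ is fixed and $H_p$ is (unreduced) simplicial homology over $\mathbb F$. Sequences. $\mathrm{Seq}(K)$ is the set of finite sequences $\{K_{T_i}\}_{i=0}^{m}$ of subcomplexes of $K$ indexed by real times $T_0=0<T_1<\dots<T_m$, with first and last complexes empty and $K_{T_{i-1}}\ne K_{T_i}$ for all $i\ge1$; the trivial sequence consisting of the empty complex alone is included. Let $E=\{+\sigma,-\sigma:\sigma\in K\}$ be the set of events (insertions and deletions), partially ordered by $+\tau\le+\sigma$ and $-\sigma\le-\tau$ whenever $\tau\subseteq\sigma$; a total order $<$ on $E$ extending $\le$ is fixed. A sequence in $\mathrm{Seq}(K)$ is encoded as a triple $f=(n,\mathbf t,\mathbf e)$: for each $i\ge 1$ record at time $T_i$ the event $+\sigma$ for each $\sigma\in K_{T_i}\setminus K_{T_{i-1}}$ and $-\sigma$ for each $\sigma\in K_{T_{i-1}}\setminus K_{T_i}$;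 list all $n$ events by increasing time, ties broken by $<$, giving $\mathbf e=(e_1,\dots,e_n)\in E^n$ and the times $\mathbf t=(t_1\le\dots\le t_n)$. $\mathrm{SR}(K;<)$ is the set of these triples and is identified with $\mathrm{Seq}(K)$. Persistence diagram. $\mathcal D$ is the set of finite multisets of points of $\mathbb R\times(\mathbb R\cup\{+\infty\})$. Applying the events of $f$ one at a time from $\widetilde K_0=\emptyset$ ($\widetilde K_i=\widetilde K_{i-1}\cup\{\sigma\}$ if $e_i=+\sigma$, $\widetilde K_i=\widetilde K_{i-1}\setminus\{\sigma\}$ if $e_i=-\sigma$) gives a simplex-wise zigzag filtration $\widetilde K_0\leftrightarrow\dots\leftrightarrow\widetilde K_n$ of simplicial complexes with $\widetilde K_0=\widetilde K_n=\emptyset$. The zigzag module $H_p(\widetilde K_0)\leftrightarrow\dots\leftrightarrow H_p(\widetilde K_n)$ decomposes uniquely into interval modules $\mathbb I_{[b,d]}$ ($1\le b\le d\le n-1$); $P^f_p$ is the set of pairs $(b,d+1)$, and $\mathrm{PH}_p(f):=\{(t_i,t_j)\}_{(i,j)\in P^f_p}\in\mathcal D$ (a multiset). Filtering functions. $FF_N(K)$ is the set of $v:K\to\{0\}\times\mathbb R^N\times\{0\}$, $v(\sigma)=(v(\sigma)_0,\dots,v(\sigma)_{N+1})$ with $v(\sigma)_0=v(\sigma)_{N+1}=0$, such that $v(\sigma)_i\ge v(\tau)_i$ for all $1\le i\le N$ and all $\sigma\subsetneq\tau$ in $K$. $\|\cdot\|_\infty$ is the sup norm over all coordinates $v(\sigma)_i$.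 The map $S:FF_N(K)\to\mathrm{Seq}(K)$. Let $\hat v(\sigma):[0,\infty)\to\mathbb R$ be the piecewise-linear interpolation of $(v(\sigma)_0,\dots,v(\sigma)_{N+1})$ at the integers $0,\dots,N+1$, extended by $0$ after $N+1$. For $t\in[0,N+1]$ let $K_t(v):=\{\sigma\in K:\hat v(\sigma)>\epsilon\text{ on }(t,t+\eta)\text{ for some }\eta>0\}$, a subcomplex of $K$. The map $t\mapsto K_t(v)$ is right-continuous and piecewise constant with finitely many jump times $0<T_1<\dots<T_m<N+1$; with $T_0:=0$, $S(v):=\{K_{T_i}(v)\}_{i=0}^m\in\mathrm{Seq}(K)\cong\mathrm{SR}(K;<)$. Bottleneck distance. Let $\Delta=\{(x,x):x\in\mathbb R\}$ with each point of countably infinite multiplicity, and $D^+:=D\cup\Delta$. For $D_1,D_2\in\mathcal D$, $d_B(D_1,D_2):=\inf_\gamma\sup_{x\in D_1^+}\|x-\gamma(x)\|_\infty$ over bijections $\gamma:D_1^+\to D_2^+$ restricting to a bijection between the points with second coordinate $+\infty$ (convention $\infty-\infty=0$), and $d_B:=+\infty$ if no such $\gamma$ exists. (Diagrams in the image of $\mathrm{PH}_p$ have only finite points with birth $\le$ death; $d_B$ is a pseudo-metric, vanishing on diagrams differing only by diagonal points.) The set $\mathcal N_p:=\mathcal N^{\epsilon+}_p\cup\mathcal N^{\epsilon-}_{p+1}\cup\mathcal N^{\epsilon,\epsilon}_{p,p+1}$, where - $\mathcal N^{\epsilon+}_p$ is the set of $w\in FF_N(K)$ for which there are $\sigma\in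 K$ with $\dim\sigma=p$ and $i\in\{2,\dots,N-1\}$ with $w(\sigma)_i=\epsilon$ and $w(\sigma)_{i-1},w(\sigma)_{i+1}>\epsilon$; - $\mathcal N^{\epsilon-}_{p+1}$ is the set of $w\in FF_N(K)$ for which there are $\sigma\in K$ with $\dim\sigma=p+1$ and $i\in\{1,\dots,N\}$ with $w(\sigma)_i=\epsilon$ and $w(\sigma)_{i-1},w(\sigma)_{i+1}<\epsilon$; - $\mathcal N^{\epsilon,\epsilon}_{p,p+1}$ is the set of $w\in FF_N(K)$ for which there are $\sigma\in K$ with $\dim\sigma\in\{p,p+1\}$ and $i\in\{1,\dots,N-1\}$ with $w(\sigma)_i=w(\sigma)_{i+1}=\epsilon$. A map $F$ is locally Lipschitz on a set $A$ if every $v\in A$ has a neighbourhood $U$ in $A$ and a constant $C$ with $d_B(F(w),F(w'))\le C\|w-w'\|_\infty$ for all $w,w'\in U$. *)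

theory Defs
  imports
    Complex_Main
    "HOL-Library.Multiset"
    "HOL-Library.Extended_Real"
    "HOL-Library.Function_Algebras"
    "HOL-Library.Set_Algebras"
begin

section \<open>Simplicial complexes and their homology\<close>

definition simplicial_complex :: "'v set set \<Rightarrow> bool" where
  "simplicial_complex K \<longleftrightarrow> finite K \<and>
     (\<forall>\<sigma>\<in>K. finite \<sigma> \<and> \<sigma> \<noteq> {} \<and> (\<forall>\<tau>\<subseteq>\<sigma>. \<tau> \<noteq> {} \<longrightarrow> \<tau> \<in> K))"

text \<open>Only used for non-empty finite sets, so the subtraction does not truncate.\<close>

definition sdim :: "'v set \<Rightarrow> nat" where
  "sdim \<sigma> = card \<sigma> - 1"

text \<open>
  Simplices are oriented by one total order of the vertex type, chosen once and for all.
  (Such an order exists, see below; up to isomorphism homology does not depend on it.)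
\<close>

definition vertex_order :: "'v rel" where
  "vertex_order = (SOME r. linear_order r)"

lemma linear_order_vertex_order: "linear_order (vertex_order :: 'v rel)"
proof -
  obtain r :: "'v rel" where "well_order_on UNIV r"
    using well_order_on by blast
  then have "linear_order r"
    by (simp add: well_order_on_def)
  then show ?thesis
    unfolding vertex_order_def by (rule someI)
qed

text \<open>A chain is given by its coefficients with respect to the oriented simplices.\<close>

type_synonym ('v, 'f) chain = "'v set \<Rightarrow> 'f"

definition chains :: "nat \<Rightarrow> 'v set set \<Rightarrow> ('v, 'f::field) chain set" where
  "chains p K = {c. \<forall>\<sigma>. c \<sigma> \<noteq> 0 \<longrightarrow> \<sigma> \<in> K \<and> sdim \<sigma> = p}"

text \<open>
  The linear extension of \<open>[v\<^sub>0, \<dots>, v\<^sub>p] \<mapsto> (\<Sum>i. (-1)^i [v\<^sub>0, \<dots>, omit v\<^sub>i, \<dots>, v\<^sub>p])\<close>: a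
  simplex \<open>\<tau>\<close> arises from \<open>insert v \<tau>\<close> by omitting \<open>v\<close>, and the position of \<open>v\<close>
  is the number of elements of \<open>\<tau>\<close> below \<open>v\<close>. The coefficient at \<open>{}\<close> is zero because
  homology is unreduced.
\<close>

definition boundary :: "('v, 'f::field) chain \<Rightarrow> ('v, 'f) chain" where
  "boundary c = (\<lambda>\<tau>. if \<tau> = {} then 0 else
     (\<Sum>v | v \<notin> \<tau> \<and> c (insert v \<tau>) \<noteq> 0.
        (-1) ^ card {u \<in> \<tau>. (u, v) \<in> vertex_order} * c (insert v \<tau>)))"

definition cycles :: "nat \<Rightarrow> 'v set set \<Rightarrow> ('v, 'f::field) chain set" where
  "cycles p K = {c \<in> chains p K. boundary c = 0}"

definition boundaries :: "nat \<Rightarrow> 'v set set \<Rightarrow> ('v, 'f::field) chain set" where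
  "boundaries p K = boundary ` chains (Suc p) K"

text \<open>Homology spaces are quotients depending on a complex, hence the explicit carriers.\<close>

record ('f, 'm) vspace =
  vcarrier :: "'m set"
  vadd :: "'m \<Rightarrow> 'm \<Rightarrow> 'm"
  vscale :: "'f \<Rightarrow> 'm \<Rightarrow> 'm"

text \<open>
  The quotient of cycles by boundaries. Sums of sets are elementwise (Minkowski sums); adding
  the boundaries in the scalar multiplication matters only for the scalar 0.
\<close>

definition homology :: "nat \<Rightarrow> 'v set set \<Rightarrow> ('f::field, ('v, 'f) chain set) vspace" where
  "homology p K =
     \<lparr>vcarrier = (\<lambda>z. z +o boundaries p K) ` cycles p K,
      vadd = (\<lambda>X Y. X + Y),
      vscale = (\<lambda>a X. (\<lambda>c \<sigma>. a * c \<sigma>) ` X + boundaries p K)\<rparr>"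

text \<open>
  The map to the homology of \<open>L\<close> induced by an inclusion of a subcomplex into \<open>L\<close>: a class is sent
  to the class of its representatives.
\<close>

definition inclusion_map ::
  "nat \<Rightarrow> 'v set set \<Rightarrow> ('v, 'f::field) chain set \<Rightarrow> ('v, 'f) chain set" where
  "inclusion_map p L X = X + boundaries p L"


section \<open>Zigzag modules and interval decompositions\<close>

text \<open>
  The spaces are indexed by \<open>0, \<dots>, zlen\<close>. For \<open>i < zlen\<close> the map \<open>zmap i\<close> goes from space \<open>i\<close> to
  space \<open>Suc i\<close> if \<open>zfwd i\<close>, and from space \<open>Suc i\<close> to space \<open>i\<close> otherwise.
\<close>

record ('f, 'm) zigzag =
  zlen :: nat
  zfwd :: "nat \<Rightarrow> bool"
  zspace :: "nat \<Rightarrow> ('f, 'm) vspace"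
  zmap :: "nat \<Rightarrow> 'm \<Rightarrow> 'm"

definition linear_iso :: "('f, 'm) vspace \<Rightarrow> ('f, 'k) vspace \<Rightarrow> ('m \<Rightarrow> 'k) \<Rightarrow> bool" where
  "linear_iso V W \<phi> \<longleftrightarrow> bij_betw \<phi> (vcarrier V) (vcarrier W) \<and>
     (\<forall>x\<in>vcarrier V. \<forall>y\<in>vcarrier V. \<phi> (vadd V x y) = vadd W (\<phi> x) (\<phi> y)) \<and>
     (\<forall>a. \<forall>x\<in>vcarrier V. \<phi> (vscale V a x) = vscale W a (\<phi> x))"

definition zigzag_iso :: "('f, 'm) zigzag \<Rightarrow> ('f, 'k) zigzag \<Rightarrow> bool" where
  "zigzag_iso M N \<longleftrightarrow> zlen M = zlen N \<and> (\<forall>i<zlen M. zfwd M i = zfwd N i) \<and>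
     (\<exists>\<phi>. (\<forall>i\<le>zlen M. linear_iso (zspace M i) (zspace N i) (\<phi> i)) \<and>
          (\<forall>i<zlen M.
             if zfwd M i
             then \<forall>x\<in>vcarrier (zspace M i). \<phi> (Suc i) (zmap M i x) = zmap N i (\<phi> i x)
             else \<forall>x\<in>vcarrier (zspace M (Suc i)). \<phi> i (zmap M i x) = zmap N i (\<phi> (Suc i) x)))"

definition interval_module ::
  "nat \<Rightarrow> (nat \<Rightarrow> bool) \<Rightarrow> nat \<times> nat \<Rightarrow> ('f::field, 'f) zigzag" where
  "interval_module n dir = (\<lambda>(b, d).
     \<lparr>zlen = n, zfwd = dir,
      zspace = (\<lambda>i. \<lparr>vcarrier = (if b \<le> i \<and> i \<le> d then UNIV else {0}),
                     vadd = (+), vscale = (*)\<rparr>),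
      zmap = (\<lambda>i x. if b \<le> i \<and> Suc i \<le> d then x else 0)\<rparr>)"

text \<open>The external direct sum; tuples are extended by zero beyond the length of the list.\<close>

definition direct_sum ::
  "nat \<Rightarrow> (nat \<Rightarrow> bool) \<Rightarrow> ('f, 'm::zero) zigzag list \<Rightarrow> ('f, nat \<Rightarrow> 'm) zigzag" where
  "direct_sum n dir Ms =
     \<lparr>zlen = n, zfwd = dir,
      zspace = (\<lambda>i.
        \<lparr>vcarrier = {x. (\<forall>j<length Ms. x j \<in> vcarrier (zspace (Ms ! j) i)) \<and>
                        (\<forall>j\<ge>length Ms. x j = 0)},
         vadd = (\<lambda>x y j. if j < length Ms then vadd (zspace (Ms ! j) i) (x j) (y j) else 0),
         vscale = (\<lambda>a x j. if j < length Ms then vscale (zspace (Ms ! j) i) a (x j) else 0)\<rparr>),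
      zmap = (\<lambda>i x j. if j < length Ms then zmap (Ms ! j) i (x j) else 0)\<rparr>"

definition interval_decomposition ::
  "('f::field, 'm) zigzag \<Rightarrow> (nat \<times> nat) multiset \<Rightarrow> bool" where
  "interval_decomposition M B \<longleftrightarrow>
     (\<forall>(b, d)\<in>#B. 1 \<le> b \<and> b \<le> d \<and> d < zlen M) \<and>
     (\<exists>bs. mset bs = B \<and>
        zigzag_iso M (direct_sum (zlen M) (zfwd M) (map (interval_module (zlen M) (zfwd M)) bs)))"


section \<open>Sequences of complexes and their events\<close>

datatype 'v event = Ins "'v set" | Del "'v set"

definition event_order :: "'v set set \<Rightarrow> 'v event rel \<Rightarrow> bool" where
  "event_order K r \<longleftrightarrow> linear_order_on (Ins ` K \<union> Del ` K) r \<and>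
     (\<forall>\<sigma>\<in>K. \<forall>\<tau>\<in>K. \<tau> \<subseteq> \<sigma> \<longrightarrow> (Ins \<tau>, Ins \<sigma>) \<in> r \<and> (Del \<sigma>, Del \<tau>) \<in> r)"

text \<open>
  A sequence is given by its list of pairs (time, complex).
\<close>

type_synonym 'v complex_seq = "(real \<times> 'v set set) list"

definition Seq :: "'v set set \<Rightarrow> 'v complex_seq set" where
  "Seq K = {s. s \<noteq> [] \<and> hd s = (0, {}) \<and> snd (last s) = {} \<and> sorted_wrt (<) (map fst s) \<and>
     (\<forall>(T, L)\<in>set s. L \<subseteq> K \<and> simplicial_complex L) \<and>
     (\<forall>i. Suc i < length s \<longrightarrow> snd (s ! i) \<noteq> snd (s ! Suc i))}"

definition sort_events :: "'v event rel \<Rightarrow> 'v event set \<Rightarrow> 'v event list" where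
  "sort_events r A = (THE es. set es = A \<and> distinct es \<and> sorted_wrt (\<lambda>a b. (a, b) \<in> r) es)"

text \<open>
  The triple \<open>(n, t, e)\<close> encoding a sequence is represented by the list \<open>[(t\<^sub>1, e\<^sub>1), \<dots>, (t\<^sub>n, e\<^sub>n)]\<close>.
\<close>

fun encode :: "'v event rel \<Rightarrow> 'v complex_seq \<Rightarrow> (real \<times> 'v event) list" where
  "encode r ((T, L) # (T', L') # s) =
     map (\<lambda>e. (T', e)) (sort_events r (Ins ` (L' - L) \<union> Del ` (L - L'))) @ encode r ((T', L') # s)"
| "encode r s = []"

fun apply_event :: "'v event \<Rightarrow> 'v set set \<Rightarrow> 'v set set" where
  "apply_event (Ins \<sigma>) L = L \<union> {\<sigma>}"
| "apply_event (Del \<sigma>) L = L - {\<sigma>}"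

definition complex_after :: "'v event list \<Rightarrow> nat \<Rightarrow> 'v set set" where
  "complex_after es i = fold apply_event (take i es) {}"


section \<open>Zigzag persistence\<close>

definition homology_zigzag ::
  "nat \<Rightarrow> 'v event list \<Rightarrow> ('f::field, ('v, 'f) chain set) zigzag" where
  "homology_zigzag p es =
     \<lparr>zlen = length es,
      zfwd = (\<lambda>i. \<exists>\<sigma>. es ! i = Ins \<sigma>),
      zspace = (\<lambda>i. homology p (complex_after es i)),
      zmap = (\<lambda>i. inclusion_map p
                (complex_after es (if \<exists>\<sigma>. es ! i = Ins \<sigma> then Suc i else i)))\<rparr>"

text \<open>
  The coefficient field is passed as a type argument. The description is by the multiset of the
  intervals of a decomposition, which is unique by Krull--Remak--Schmidt.
\<close>

definition persistence_intervals ::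
  "'f::field itself \<Rightarrow> nat \<Rightarrow> 'v event list \<Rightarrow> (nat \<times> nat) multiset" where
  "persistence_intervals F p es = image_mset (\<lambda>(b, d). (b, d + 1))
     (THE B. interval_decomposition
        (homology_zigzag p es :: ('f, ('v, 'f) chain set) zigzag) B)"

text \<open>The value \<open>-\<infinity>\<close> does not occur as a second coordinate of the diagrams considered.\<close>

type_synonym diagram = "(real \<times> ereal) multiset"

text \<open>Times are numbered from 1, list positions from 0.\<close>

definition PH ::
  "'f::field itself \<Rightarrow> nat \<Rightarrow> (real \<times> 'v event) list \<Rightarrow> diagram" where
  "PH F p f = image_mset (\<lambda>(i, j). (fst (f ! (i - 1)), ereal (fst (f ! (j - 1)))))
     (persistence_intervals F p (map snd f))"


section \<open>Bottleneck distance\<close>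

text \<open>
  The multiset \<open>D \<union> \<Delta>\<close> as a set of labelled copies of points: the copies of \<open>x\<close> are the pairs
  \<open>(x, k)\<close>, countably infinitely many for each point \<open>x\<close> of the diagonal.
\<close>

definition dplus :: "diagram \<Rightarrow> ((real \<times> ereal) \<times> nat) set" where
  "dplus D = {(x, k). k < count D x \<or> ereal (fst x) = snd x}"

definition point_dist :: "real \<times> ereal \<Rightarrow> real \<times> ereal \<Rightarrow> ereal" where
  "point_dist x y = max (ereal \<bar>fst x - fst y\<bar>)
     (if snd x = snd y then 0 else \<bar>snd x - snd y\<bar>)"

definition bottleneck_matching ::
  "diagram \<Rightarrow> diagram \<Rightarrow> ((real \<times> ereal) \<times> nat \<Rightarrow> (real \<times> ereal) \<times> nat) \<Rightarrow> bool" where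
  "bottleneck_matching D1 D2 \<gamma> \<longleftrightarrow> bij_betw \<gamma> (dplus D1) (dplus D2) \<and>
     bij_betw \<gamma> {x \<in> dplus D1. snd (fst x) = \<infinity>} {x \<in> dplus D2. snd (fst x) = \<infinity>}"

definition d_B :: "diagram \<Rightarrow> diagram \<Rightarrow> ereal" where
  "d_B D1 D2 = (INF \<gamma> \<in> {\<gamma>. bottleneck_matching D1 D2 \<gamma>}.
     SUP x \<in> dplus D1. point_dist (fst x) (fst (\<gamma> x)))"


section \<open>Filtering functions\<close>

text \<open>
  A filtering function is represented by its extension by zero to all simplices and all indices;
  this makes the representation unique and subsumes \<open>v \<sigma> 0 = 0\<close> and \<open>v \<sigma> (N + 1) = 0\<close>.
\<close>

type_synonym 'v filt = "'v set \<Rightarrow> nat \<Rightarrow> real"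

definition FF :: "nat \<Rightarrow> 'v set set \<Rightarrow> 'v filt set" where
  "FF N K = {v. (\<forall>\<sigma> i. v \<sigma> i \<noteq> 0 \<longrightarrow> \<sigma> \<in> K \<and> i \<in> {1..N}) \<and>
     (\<forall>i\<in>{1..N}. \<forall>\<sigma>\<in>K. \<forall>\<tau>\<in>K. \<sigma> \<subset> \<tau> \<longrightarrow> v \<sigma> i \<ge> v \<tau> i)}"

text \<open>The 0 accounts for the empty complex.\<close>

definition sup_norm :: "nat \<Rightarrow> 'v set set \<Rightarrow> 'v filt \<Rightarrow> real" where
  "sup_norm N K v = Max (insert 0 {\<bar>v \<sigma> i\<bar> | \<sigma> i. \<sigma> \<in> K \<and> i \<le> N + 1})"

text \<open>Piecewise-linear interpolation at the natural numbers, for \<open>t \<ge> 0\<close>.\<close>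

definition interpolate :: "(nat \<Rightarrow> real) \<Rightarrow> real \<Rightarrow> real" where
  "interpolate a t = (let i = nat \<lfloor>t\<rfloor>; s = t - real i in (1 - s) * a i + s * a (Suc i))"

definition complex_at :: "'v set set \<Rightarrow> real \<Rightarrow> 'v filt \<Rightarrow> real \<Rightarrow> 'v set set" where
  "complex_at K \<epsilon> v t =
     {\<sigma> \<in> K. \<exists>\<eta>>0. \<forall>s\<in>{t<..<t + \<eta>}. interpolate (v \<sigma>) s > \<epsilon>}"

definition jump_times :: "nat \<Rightarrow> 'v set set \<Rightarrow> real \<Rightarrow> 'v filt \<Rightarrow> real set" where
  "jump_times N K \<epsilon> v = {t \<in> {0..real (N + 1)}.
     \<not> (\<forall>\<^sub>F s in at t within {0..real (N + 1)}. complex_at K \<epsilon> v s = complex_at K \<epsilon> v t)}"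

definition S :: "nat \<Rightarrow> 'v set set \<Rightarrow> real \<Rightarrow> 'v filt \<Rightarrow> 'v complex_seq" where
  "S N K \<epsilon> v = map (\<lambda>t. (t, complex_at K \<epsilon> v t)) (0 # sorted_list_of_set (jump_times N K \<epsilon> v))"

definition N_plus :: "nat \<Rightarrow> 'v set set \<Rightarrow> real \<Rightarrow> nat \<Rightarrow> 'v filt set" where
  "N_plus N K \<epsilon> q = {w \<in> FF N K. \<exists>\<sigma>\<in>K. sdim \<sigma> = q \<and>
     (\<exists>i\<in>{2..N - 1}. w \<sigma> i = \<epsilon> \<and> w \<sigma> (i - 1) > \<epsilon> \<and> w \<sigma> (i + 1) > \<epsilon>)}"

definition N_minus :: "nat \<Rightarrow> 'v set set \<Rightarrow> real \<Rightarrow> nat \<Rightarrow> 'v filt set" where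
  "N_minus N K \<epsilon> q = {w \<in> FF N K. \<exists>\<sigma>\<in>K. sdim \<sigma> = q \<and>
     (\<exists>i\<in>{1..N}. w \<sigma> i = \<epsilon> \<and> w \<sigma> (i - 1) < \<epsilon> \<and> w \<sigma> (i + 1) < \<epsilon>)}"

definition N_flat :: "nat \<Rightarrow> 'v set set \<Rightarrow> real \<Rightarrow> nat \<Rightarrow> 'v filt set" where
  "N_flat N K \<epsilon> q = {w \<in> FF N K. \<exists>\<sigma>\<in>K. sdim \<sigma> \<in> {q, q + 1} \<and>
     (\<exists>i\<in>{1..N - 1}. w \<sigma> i = \<epsilon> \<and> w \<sigma> (i + 1) = \<epsilon>)}"

definition N_exceptional :: "nat \<Rightarrow> 'v set set \<Rightarrow> real \<Rightarrow> nat \<Rightarrow> 'v filt set" where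
  "N_exceptional N K \<epsilon> p = N_plus N K \<epsilon> p \<union> N_minus N K \<epsilon> (p + 1) \<union> N_flat N K \<epsilon> p"

text \<open>Neighbourhoods in \<open>A\<close> are taken with respect to the sup norm.\<close>

definition locally_lipschitz_on ::
  "nat \<Rightarrow> 'v set set \<Rightarrow> ('v filt \<Rightarrow> diagram) \<Rightarrow> 'v filt set \<Rightarrow> bool" where
  "locally_lipschitz_on N K F A \<longleftrightarrow> (\<forall>v\<in>A. \<exists>U C::real. U \<subseteq> A \<and>
     (\<exists>\<delta>>0. {w \<in> A. sup_norm N K (w - v) < \<delta>} \<subseteq> U) \<and>
     (\<forall>w\<in>U. \<forall>w'\<in>U. d_B (F w) (F w') \<le> ereal (C * sup_norm N K (w - w'))))"


section \<open>The map to sequences is well defined\<close>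

lemma affine_right:
  fixes \<alpha> \<beta> \<epsilon> t :: real
  shows "\<exists>\<delta>>0. (\<forall>s\<in>{t<..<t+\<delta>}. \<alpha> + \<beta> * s > \<epsilon>) \<or> (\<forall>s\<in>{t<..<t+\<delta>}. \<alpha> + \<beta> * s \<le> \<epsilon>)"
proof -
  have c: "continuous (at_right t) (\<lambda>s. \<alpha> + \<beta> * s)" by (intro continuous_intros)
  consider "\<alpha> + \<beta> * t > \<epsilon>" | "\<alpha> + \<beta> * t < \<epsilon>" | "\<alpha> + \<beta> * t = \<epsilon>" by linarith
  then show ?thesis
  proof cases
    case 1
    have "\<forall>\<^sub>F s in at_right t. \<alpha> + \<beta> * s > \<epsilon>"
      using c 1 by (simp add: continuous_within order_tendstoD)
    then obtain b where "b > t" "\<forall>s>t. s < b \<longrightarrow> \<alpha> + \<beta> * s > \<epsilon>"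
      unfolding eventually_at_right_field by auto
    then show ?thesis by (intro exI[of _ "b - t"]) auto
  next
    case 2
    have "\<forall>\<^sub>F s in at_right t. \<alpha> + \<beta> * s < \<epsilon>"
      using c 2 by (simp add: continuous_within order_tendstoD)
    then obtain b where "b > t" "\<forall>s>t. s < b \<longrightarrow> \<alpha> + \<beta> * s < \<epsilon>"
      unfolding eventually_at_right_field by auto
    then show ?thesis by (intro exI[of _ "b - t"]) (auto intro: less_imp_le)
  next
    case 3
    show ?thesis
    proof (cases "\<beta> > 0")
      case True
      then have "\<forall>s\<in>{t<..<t+1}. \<alpha> + \<beta> * s > \<epsilon>" using 3 by auto
      then show ?thesis by (intro exI[of _ 1]) auto
    next
      case False
      then have "\<forall>s\<in>{t<..<t+1}. \<alpha> + \<beta> * s \<le> \<epsilon>"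
        using 3 by (auto simp: mult_left_mono_neg)
      then show ?thesis by (intro exI[of _ 1]) auto
    qed
  qed
qed

lemma interpolate_affine:
  assumes "real i \<le> s" "s \<le> real i + 1"
  shows "interpolate a s = (a i - real i * (a (Suc i) - a i)) + (a (Suc i) - a i) * s"
proof (cases "s = real i + 1")
  case True
  then have "nat \<lfloor>s\<rfloor> = Suc i" by (simp add: nat_add_distrib)
  then show ?thesis using True by (simp add: interpolate_def algebra_simps)
next
  case False
  then have "\<lfloor>s\<rfloor> = int i" using assms by (intro floor_unique) auto
  then show ?thesis by (simp add: interpolate_def algebra_simps Let_def)
qed

lemma interpolate_right:
  assumes "t \<ge> 0"
  shows "\<exists>\<delta>>0. (\<forall>s\<in>{t<..<t+\<delta>}. interpolate a s > \<epsilon>) \<or> (\<forall>s\<in>{t<..<t+\<delta>}. interpolate a s \<le> \<epsilon>)"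
proof -
  define i where "i = nat \<lfloor>t\<rfloor>"
  have i: "real i \<le> t" "t < real i + 1" using assms by (auto simp: i_def)
  obtain \<delta> where d: "\<delta> > 0"
    "(\<forall>s\<in>{t<..<t+\<delta>}. (a i - real i * (a (Suc i) - a i)) + (a (Suc i) - a i) * s > \<epsilon>) \<or>
     (\<forall>s\<in>{t<..<t+\<delta>}. (a i - real i * (a (Suc i) - a i)) + (a (Suc i) - a i) * s \<le> \<epsilon>)"
    using affine_right by blast
  have "min \<delta> (real i + 1 - t) > 0" using d i by auto
  moreover have "\<forall>s\<in>{t<..<t+min \<delta> (real i + 1 - t)}. s \<in> {t<..<t+\<delta>} \<and> interpolate a s =
       (a i - real i * (a (Suc i) - a i)) + (a (Suc i) - a i) * s"
    using i by (auto intro!: interpolate_affine)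
  ultimately show ?thesis using d(2) by (metis (no_types, lifting))
qed

lemma interpolate_left:
  assumes "t > 0"
  shows "\<exists>\<delta>>0. (\<forall>s\<in>{t-\<delta><..<t}. interpolate a s > \<epsilon>) \<or> (\<forall>s\<in>{t-\<delta><..<t}. interpolate a s \<le> \<epsilon>)"
proof -
  define i where "i = nat (\<lceil>t\<rceil> - 1)"
  have c: "\<lceil>t\<rceil> \<ge> 1" using assms by (simp add: one_le_ceiling)
  then have ri: "real i = of_int \<lceil>t\<rceil> - 1" by (simp add: i_def)
  have i: "real i < t" "t \<le> real i + 1" unfolding ri by linarith+
  obtain \<delta> where d: "\<delta> > 0"
    "(\<forall>s\<in>{-t<..<-t+\<delta>}. (a i - real i * (a (Suc i) - a i)) + (-(a (Suc i) - a i)) * s > \<epsilon>) \<or>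
     (\<forall>s\<in>{-t<..<-t+\<delta>}. (a i - real i * (a (Suc i) - a i)) + (-(a (Suc i) - a i)) * s \<le> \<epsilon>)"
    using affine_right by blast
  have "min \<delta> (t - real i) > 0" using d i by auto
  moreover have "\<forall>s\<in>{t-min \<delta> (t - real i)<..<t}. -s \<in> {-t<..<-t+\<delta>} \<and> interpolate a s =
       (a i - real i * (a (Suc i) - a i)) + (-(a (Suc i) - a i)) * (-s)"
    using i by (auto simp: interpolate_affine[of i] algebra_simps)
  ultimately show ?thesis using d(2) by (metis (no_types, lifting))
qed

lemma active_right:
  assumes "t \<ge> 0"
  shows "\<exists>\<delta>>0. \<forall>s\<in>{t..<t+\<delta>}. (\<exists>\<eta>>0. \<forall>u\<in>{s<..<s+\<eta>}. interpolate a u > \<epsilon>) \<longleftrightarrow>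
                (\<exists>\<eta>>0. \<forall>u\<in>{t<..<t+\<eta>}. interpolate a u > \<epsilon>)"
proof -
  obtain \<delta> where d: "\<delta> > 0" "(\<forall>s\<in>{t<..<t+\<delta>}. interpolate a s > \<epsilon>) \<or> (\<forall>s\<in>{t<..<t+\<delta>}. interpolate a s \<le> \<epsilon>)"
    using interpolate_right[OF assms] by blast
  have A: "(\<exists>\<eta>>0. \<forall>u\<in>{s<..<s+\<eta>}. interpolate a u > \<epsilon>) \<longleftrightarrow> (\<forall>s\<in>{t<..<t+\<delta>}. interpolate a s > \<epsilon>)"
    if s: "s \<in> {t..<t+\<delta>}" for s
  proof
    assume "\<forall>s\<in>{t<..<t+\<delta>}. interpolate a s > \<epsilon>"
    then show "\<exists>\<eta>>0. \<forall>u\<in>{s<..<s+\<eta>}. interpolate a u > \<epsilon>"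
      using s by (intro exI[of _ "t + \<delta> - s"]) auto
  next
    assume "\<exists>\<eta>>0. \<forall>u\<in>{s<..<s+\<eta>}. interpolate a u > \<epsilon>"
    then obtain \<eta> where e: "\<eta> > 0" "\<forall>u\<in>{s<..<s+\<eta>}. interpolate a u > \<epsilon>" by blast
    define u where "u = (s + min (s + \<eta>) (t + \<delta>)) / 2"
    have "u \<in> {s<..<s+\<eta>}" "u \<in> {t<..<t+\<delta>}"
      using e(1) s by (simp_all add: u_def min_def field_simps split: if_splits)
    then show "\<forall>s\<in>{t<..<t+\<delta>}. interpolate a s > \<epsilon>" using d(2) e(2) by (meson not_le)
  qed
  show ?thesis using d(1) A A[of t] by (intro exI[of _ \<delta>]) auto
qed

lemma active_left:
  assumes "t > 0"
  shows "\<exists>\<delta>>0. \<exists>b. \<forall>s\<in>{t-\<delta><..<t}. (\<exists>\<eta>>0. \<forall>u\<in>{s<..<s+\<eta>}. interpolate a u > \<epsilon>) \<longleftrightarrow> b"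
proof -
  obtain \<delta> where d: "\<delta> > 0" "(\<forall>s\<in>{t-\<delta><..<t}. interpolate a s > \<epsilon>) \<or> (\<forall>s\<in>{t-\<delta><..<t}. interpolate a s \<le> \<epsilon>)"
    using interpolate_left[OF assms] by blast
  have A: "(\<exists>\<eta>>0. \<forall>u\<in>{s<..<s+\<eta>}. interpolate a u > \<epsilon>) \<longleftrightarrow> (\<forall>s\<in>{t-\<delta><..<t}. interpolate a s > \<epsilon>)"
    if s: "s \<in> {t-\<delta><..<t}" for s
  proof
    assume "\<forall>s\<in>{t-\<delta><..<t}. interpolate a s > \<epsilon>"
    then show "\<exists>\<eta>>0. \<forall>u\<in>{s<..<s+\<eta>}. interpolate a u > \<epsilon>"
      using s by (intro exI[of _ "t - s"]) auto
  next
    assume "\<exists>\<eta>>0. \<forall>u\<in>{s<..<s+\<eta>}. interpolate a u > \<epsilon>"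
    then obtain \<eta> where e: "\<eta> > 0" "\<forall>u\<in>{s<..<s+\<eta>}. interpolate a u > \<epsilon>" by blast
    define u where "u = (s + min (s + \<eta>) t) / 2"
    have "u \<in> {s<..<s+\<eta>}" "u \<in> {t-\<delta><..<t}"
      using e(1) s by (simp_all add: u_def min_def field_simps split: if_splits)
    then show "\<forall>s\<in>{t-\<delta><..<t}. interpolate a s > \<epsilon>" using d(2) e(2) by (meson not_le)
  qed
  show ?thesis using d(1) A by blast
qed

lemma finite_common:
  fixes P :: "'a \<Rightarrow> real \<Rightarrow> bool"
  assumes "finite A" "\<And>x. x \<in> A \<Longrightarrow> \<exists>d>0. P x d" "\<And>x d d'. P x d \<Longrightarrow> 0 < d' \<Longrightarrow> d' \<le> d \<Longrightarrow> P x d'"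
  shows "\<exists>d>0. \<forall>x\<in>A. P x d"
  using assms(1,2)
proof (induction A)
  case empty then show ?case by (intro exI[of _ 1]) auto
next
  case (insert x A)
  obtain d where d: "d > 0" "\<forall>x\<in>A. P x d" using insert by auto
  obtain e where e: "e > 0" "P x e" using insert.prems by auto
  show ?case using d e assms(3) by (intro exI[of _ "min d e"]) auto
qed

lemma complex_at_right:
  assumes "finite K" "t \<ge> 0"
  shows "\<exists>\<delta>>0. \<forall>s\<in>{t..<t+\<delta>}. complex_at K \<epsilon> v s = complex_at K \<epsilon> v t"
proof -
  let ?A = "\<lambda>\<sigma> s. \<exists>\<eta>>0. \<forall>u\<in>{s<..<s+\<eta>}. interpolate (v \<sigma>) u > \<epsilon>"
  have "\<exists>\<delta>>0. \<forall>\<sigma>\<in>K. \<forall>s\<in>{t..<t+\<delta>}. ?A \<sigma> s \<longleftrightarrow> ?A \<sigma> t"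
  proof (rule finite_common[OF assms(1), where P = "\<lambda>\<sigma> \<delta>. \<forall>s\<in>{t..<t+\<delta>}. ?A \<sigma> s \<longleftrightarrow> ?A \<sigma> t"])
    show "\<exists>\<delta>>0. \<forall>s\<in>{t..<t+\<delta>}. ?A \<sigma> s \<longleftrightarrow> ?A \<sigma> t" for \<sigma>
      by (rule active_right[OF assms(2)])
  next
    fix \<sigma> and d d' :: real
    assume *: "\<forall>s\<in>{t..<t+d}. ?A \<sigma> s \<longleftrightarrow> ?A \<sigma> t" "d' \<le> d"
    then have "s \<in> {t..<t+d}" if "s \<in> {t..<t+d'}" for s
      using that by simp
    then show "\<forall>s\<in>{t..<t+d'}. ?A \<sigma> s \<longleftrightarrow> ?A \<sigma> t"
      using *(1) by blast
  qed
  then obtain \<delta> where "\<delta> > 0" and \<delta>: "\<And>\<sigma> s. \<sigma> \<in> K \<Longrightarrow> s \<in> {t..<t+\<delta>} \<Longrightarrow> ?A \<sigma> s \<longleftrightarrow> ?A \<sigma> t"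
    by blast
  have "complex_at K \<epsilon> v s = complex_at K \<epsilon> v t" if "s \<in> {t..<t+\<delta>}" for s
    unfolding complex_at_def using \<delta>[OF _ that] by (rule Collect_cong[OF conj_cong[OF refl]])
  with \<open>\<delta> > 0\<close> show ?thesis by blast
qed

lemma complex_at_left:
  assumes "finite K" "t > 0"
  shows "\<exists>\<delta>>0. \<exists>L. \<forall>s\<in>{t-\<delta><..<t}. complex_at K \<epsilon> v s = L"
proof -
  have "\<exists>\<delta>>0. \<forall>\<sigma>\<in>K. \<exists>b. \<forall>s\<in>{t-\<delta><..<t}. (\<exists>\<eta>>0. \<forall>u\<in>{s<..<s+\<eta>}. interpolate (v \<sigma>) u > \<epsilon>) \<longleftrightarrow> b"
    by (rule finite_common[OF assms(1) active_left[OF assms(2)]]) force+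
  then obtain \<delta> b where "\<delta> > 0" "\<forall>\<sigma>\<in>K. \<forall>s\<in>{t-\<delta><..<t}. (\<exists>\<eta>>0. \<forall>u\<in>{s<..<s+\<eta>}. interpolate (v \<sigma>) u > \<epsilon>) \<longleftrightarrow> b \<sigma>"
    by metis
  then show ?thesis unfolding complex_at_def
    by (intro exI[of _ \<delta>] conjI exI[of _ "{\<sigma>\<in>K. b \<sigma>}"]) auto
qed

lemma finite_jump_times:
  assumes "finite K"
  shows "finite (jump_times N K \<epsilon> v)"
proof -
  let ?I = "{0..real (N + 1)}"
  have loc: "\<exists>\<delta>>0. \<forall>s\<in>{t-\<delta><..<t+\<delta>} \<inter> ?I - {t}. s \<notin> jump_times N K \<epsilon> v" if t: "t \<in> ?I" for t
  proof -
    obtain d where d: "d > 0" "\<And>s. s\<in>{t..<t+d} \<Longrightarrow> complex_at K \<epsilon> v s = complex_at K \<epsilon> v t"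
      using complex_at_right[OF assms] t by (meson atLeastAtMost_iff)
    obtain e L where e: "e > 0" "\<And>s. t > 0 \<Longrightarrow> s\<in>{t-e<..<t} \<Longrightarrow> complex_at K \<epsilon> v s = L"
    proof (cases "t > 0")
      case True
      then show ?thesis using that complex_at_left[OF assms, of t \<epsilon> v] by blast
    next
      case False
      then show ?thesis using that[of 1] by simp
    qed
    have "s \<notin> jump_times N K \<epsilon> v" if s: "s\<in>{t-min d e<..<t+min d e} \<inter> ?I - {t}" for s
    proof (cases "s > t")
      case True
      have "\<forall>\<^sub>F u in at s within ?I. u \<in> {t<..<t+d}"
        unfolding eventually_at_filter using True s by (intro eventually_mono[OF eventually_nhds_in_open[of "{t<..<t+d}"]]) auto
      then have "\<forall>\<^sub>F u in at s within ?I. complex_at K \<epsilon> v u = complex_at K \<epsilon> v s"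
      proof (rule eventually_mono)
        fix u assume "u \<in> {t<..<t+d}"
        then show "complex_at K \<epsilon> v u = complex_at K \<epsilon> v s"
          using d(2)[of u] d(2)[of s] True s by force
      qed
      then show ?thesis by (simp add: jump_times_def)
    next
      case False
      then have st: "s < t" "t > 0" using s by auto
      have "\<forall>\<^sub>F u in at s within ?I. u \<in> {t-e<..<t}"
        unfolding eventually_at_filter using st s by (intro eventually_mono[OF eventually_nhds_in_open[of "{t-e<..<t}"]]) auto
      then have "\<forall>\<^sub>F u in at s within ?I. complex_at K \<epsilon> v u = complex_at K \<epsilon> v s"
      proof (rule eventually_mono)
        fix u assume "u \<in> {t-e<..<t}"
        then show "complex_at K \<epsilon> v u = complex_at K \<epsilon> v s"
          using e(2)[of u] e(2)[of s] st s by force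
      qed
      then show ?thesis by (simp add: jump_times_def)
    qed
    then show ?thesis using d(1) e(1) by (intro exI[of _ "min d e"]) auto
  qed
  then obtain \<delta> where \<delta>: "\<And>t. t \<in> ?I \<Longrightarrow> \<delta> t > 0"
    "\<And>t s. t \<in> ?I \<Longrightarrow> s\<in>{t-\<delta> t<..<t+\<delta> t} \<inter> ?I - {t} \<Longrightarrow> s \<notin> jump_times N K \<epsilon> v"
    by metis
  let ?D = "(\<lambda>t. {t-\<delta> t<..<t+\<delta> t}) ` ?I"
  have "?I \<subseteq> \<Union>?D" using \<delta>(1) by force
  moreover have "\<forall>B\<in>?D. open B" by auto
  ultimately obtain D' where "D' \<subseteq> ?D" "finite D'" "?I \<subseteq> \<Union>D'"
    using compact_Icc[of 0 "real (N + 1)"] unfolding compact_eq_Heine_Borel by meson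
  then obtain C' where C': "C' \<subseteq> ?I" "finite C'" "?I \<subseteq> (\<Union>t\<in>C'. {t-\<delta> t<..<t+\<delta> t})"
    using finite_subset_image[of D' _ ?I] by metis
  have "jump_times N K \<epsilon> v \<subseteq> C'"
  proof
    fix s assume s: "s \<in> jump_times N K \<epsilon> v"
    then have "s \<in> ?I" by (auto simp: jump_times_def)
    then show "s \<in> C'" using C' \<delta>(2) s by blast
  qed
  then show ?thesis using C'(2) finite_subset by blast
qed

lemma jump_times_bounds:
  assumes "finite K" "\<epsilon> > 0" "v \<in> FF N K"
  shows "0 \<notin> jump_times N K \<epsilon> v"
proof -
  obtain d where d: "d > 0" "\<And>s. s\<in>{0..<0+d} \<Longrightarrow> complex_at K \<epsilon> v s = complex_at K \<epsilon> v 0"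
    using complex_at_right[OF assms(1)] by (metis order_refl)
  have "\<forall>\<^sub>F u in at 0 within {0..real (N+1)}. u \<in> {0..<0+d}"
    unfolding eventually_at_filter using d(1) by (intro eventually_mono[OF eventually_nhds_in_open[of "{-d<..<d}"]]) auto
  then have "\<forall>\<^sub>F u in at 0 within {0..real (N+1)}. complex_at K \<epsilon> v u = complex_at K \<epsilon> v 0"
    by (rule eventually_mono) (erule d(2))
  then show ?thesis by (simp add: jump_times_def)
qed

lemma complex_at_const:
  assumes "finite K" "0 \<le> a" "b \<le> real (N+1)" "{a<..<b} \<inter> jump_times N K \<epsilon> v = {}" "s \<in> {a..<b}"
  shows "complex_at K \<epsilon> v s = complex_at K \<epsilon> v a"
proof (rule connected_local_const[of "{a..<b}", symmetric])
  show "\<forall>x\<in>{a..<b}. \<forall>\<^sub>F y in at x within {a..<b}. complex_at K \<epsilon> v x = complex_at K \<epsilon> v y"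
  proof
    fix x assume x: "x \<in> {a..<b}"
    show "\<forall>\<^sub>F y in at x within {a..<b}. complex_at K \<epsilon> v x = complex_at K \<epsilon> v y"
    proof (cases "x = a")
      case True
      obtain d where d: "d > 0" "\<And>s. s\<in>{a..<a+d} \<Longrightarrow> complex_at K \<epsilon> v s = complex_at K \<epsilon> v a"
        using complex_at_right[OF assms(1,2)] by metis
      show ?thesis unfolding eventually_at_filter True
        using d(1) by (intro eventually_mono[OF eventually_nhds_in_open[of "{a-d<..<a+d}"]]) (auto intro!: d(2)[symmetric])
    next
      case False
      then have "x \<in> {a<..<b}" using x by auto
      then have "x \<notin> jump_times N K \<epsilon> v" using assms(4) by blast
      then have "\<forall>\<^sub>F y in at x within {0..real (N+1)}. complex_at K \<epsilon> v y = complex_at K \<epsilon> v x"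
        using x assms(2,3) by (auto simp: jump_times_def)
      then show ?thesis using assms(2,3) unfolding eventually_at_filter
        by (elim eventually_mono) auto
    qed
  qed
qed (use assms in auto)

lemma complex_at_trivial:
  assumes "\<epsilon> > 0" "t \<ge> 0" "\<And>\<sigma>. v \<sigma> (nat \<lfloor>t\<rfloor>) = 0" "t = of_int \<lfloor>t\<rfloor>"
  shows "complex_at K \<epsilon> v t = {}"
proof -
  define i where "i = nat \<lfloor>t\<rfloor>"
  have i: "t = real i" using assms(2,4) by (simp add: i_def)
  have False if e: "\<eta> > 0" "\<forall>s\<in>{t<..<t + \<eta>}. interpolate (v \<sigma>) s > \<epsilon>" for \<sigma> \<eta>
  proof -
    let ?b = "v \<sigma> (Suc i)"
    define h where "h = min (\<eta>/2) (min 1 (\<epsilon> / (1 + \<bar>?b\<bar>)))"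
    have h: "h > 0" "h < \<eta>" "h \<le> 1" "h \<le> \<epsilon> / (1 + \<bar>?b\<bar>)"
    proof -
      have "\<epsilon> / (1 + \<bar>?b\<bar>) > 0" using assms(1) by simp
      then show "h > 0" "h < \<eta>" "h \<le> 1" "h \<le> \<epsilon> / (1 + \<bar>?b\<bar>)"
        unfolding h_def using e(1) by linarith+
    qed
    have "h * ?b \<le> h * (1 + \<bar>?b\<bar>)" using h by (intro mult_left_mono) auto
    also have "\<dots> \<le> \<epsilon>" using h(4) by (simp add: pos_le_divide_eq add_pos_nonneg)
    finally have "h * ?b \<le> \<epsilon>" .
    moreover have "interpolate (v \<sigma>) (t + h) = h * ?b"
      using h assms(3) by (subst interpolate_affine[of i]) (auto simp: i i_def[symmetric] algebra_simps)
    moreover have "t + h \<in> {t<..<t+\<eta>}" using h by simp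
    ultimately show False using e(2) by (metis not_le)
  qed
  then show ?thesis unfolding complex_at_def by blast
qed

lemma complex_at_simplicial:
  assumes "simplicial_complex K" "v \<in> FF N K" "t \<ge> 0"
  shows "simplicial_complex (complex_at K \<epsilon> v t)"
proof -
  have mono: "interpolate (v \<sigma>) s \<le> interpolate (v \<tau>) s"
    if "\<tau> \<subseteq> \<sigma>" "\<sigma> \<in> K" "\<tau> \<in> K" "s \<ge> 0" for \<sigma> \<tau> s
  proof -
    have le: "v \<sigma> i \<le> v \<tau> i" for i
    proof (cases "\<tau> = \<sigma> \<or> i \<notin> {1..N}")
      case True
      have "v \<rho> i = 0" if "i \<notin> {1..N}" for \<rho>
        using assms(2) that unfolding FF_def by blast
      then show ?thesis using True by (metis order_refl)
    next
      case False
      then have "\<tau> \<subset> \<sigma>" "i \<in> {1..N}" using that by auto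
      then show ?thesis using assms(2) that unfolding FF_def by blast
    qed
    have "0 \<le> s - real (nat \<lfloor>s\<rfloor>)" "s - real (nat \<lfloor>s\<rfloor>) \<le> 1" using that(4) by linarith+
    then show ?thesis unfolding interpolate_def Let_def by (intro add_mono mult_left_mono le) auto
  qed
  show ?thesis unfolding simplicial_complex_def
  proof (intro conjI ballI allI impI)
    show "finite (complex_at K \<epsilon> v t)" using assms(1) by (auto simp: simplicial_complex_def complex_at_def)
  next
    fix \<sigma> assume s: "\<sigma> \<in> complex_at K \<epsilon> v t"
    then show "finite \<sigma>" "\<sigma> \<noteq> {}" using assms(1) by (auto simp: simplicial_complex_def complex_at_def)
    fix \<tau> assume t: "\<tau> \<subseteq> \<sigma>" "\<tau> \<noteq> {}"
    have K: "\<sigma> \<in> K" "\<tau> \<in> K" using s t assms(1) by (auto simp: simplicial_complex_def complex_at_def)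
    obtain \<eta> where "\<eta> > 0" "\<forall>u\<in>{t<..<t+\<eta>}. interpolate (v \<sigma>) u > \<epsilon>" using s by (auto simp: complex_at_def)
    then have "\<forall>u\<in>{t<..<t+\<eta>}. interpolate (v \<tau>) u > \<epsilon>"
      using mono[OF t(1) K] assms(3) by (force intro: less_le_trans)
    then show "\<tau> \<in> complex_at K \<epsilon> v t" using K \<open>\<eta> > 0\<close> by (auto simp: complex_at_def)
  qed
qed

lemma S_in_Seq:
  assumes K: "simplicial_complex K" and "\<epsilon> > 0" "v \<in> FF N K"
  shows "S N K \<epsilon> v \<in> Seq K"
proof -
  let ?J = "jump_times N K \<epsilon> v" and ?K = "complex_at K \<epsilon> v"
  define ts where "ts = 0 # sorted_list_of_set ?J"
  have fin: "finite K" using K by (simp add: simplicial_complex_def)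
  have finJ: "finite ?J" by (rule finite_jump_times[OF fin])
  have J: "?J \<subseteq> {0..real (N+1)}" by (auto simp: jump_times_def)
  have J0: "0 \<notin> ?J" by (rule jump_times_bounds[OF fin assms(2,3)])
  have v0: "v \<sigma> i = 0" if "i \<notin> {1..N}" for \<sigma> i using assms(3) that by (auto simp: FF_def)
  have K0: "?K 0 = {}" using v0 assms(2) by (intro complex_at_trivial) auto
  have KN: "?K (real (N+1)) = {}" using v0 assms(2) by (intro complex_at_trivial) (auto simp del: of_nat_add of_nat_Suc)
  have ts: "sorted_wrt (<) ts" "set ts = insert 0 ?J"
    using finJ J J0 by (auto simp: ts_def less_le strict_sorted_list_of_set)
  have S: "S N K \<epsilon> v = map (\<lambda>t. (t, ?K t)) ts" by (simp add: S_def ts_def)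
  have gap: "{ts ! i<..<ts ! Suc i} \<inter> ?J = {}" if "Suc i < length ts" for i
  proof -
    have "ts ! j \<le> ts ! i \<or> ts ! Suc i \<le> ts ! j" if j: "j < length ts" for j
    proof (cases "j \<le> i")
      case True
      then show ?thesis
        using sorted_wrt_nth_less[OF ts(1), of j i] that \<open>Suc i < length ts\<close> by (cases "j = i") auto
    next
      case False
      then show ?thesis
        using sorted_wrt_nth_less[OF ts(1), of "Suc i" j] that by (cases "j = Suc i") auto
    qed
    then have "x \<le> ts ! i \<or> ts ! Suc i \<le> x" if "x \<in> set ts" for x
      using that by (metis in_set_conv_nth)
    then show ?thesis using ts(2) by force
  qed
  have mem: "ts ! i \<in> {0..real (N+1)}" if "i < length ts" for i
    using that ts(2) J nth_mem[OF that] by auto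
  have last: "?K (last ts) = {}"
  proof (cases "last ts = real (N+1)")
    case False
    have l: "last ts \<in> set ts" by (simp add: ts_def)
    have mx: "x \<le> last ts" if "x \<in> set ts" for x
    proof -
      obtain j where j: "j < length ts" "x = ts ! j" using \<open>x \<in> set ts\<close> by (metis in_set_conv_nth)
      then have "ts \<noteq> []" by auto
      then show ?thesis using sorted_wrt_nth_less[OF ts(1), of j "length ts - 1"] j
        by (cases "j = length ts - 1") (auto simp: last_conv_nth intro!: less_imp_le)
    qed
    have "last ts \<in> {0..real (N+1)}" using l ts(2) J by auto
    then have la: "last ts < real (N+1)" "0 \<le> last ts" using False by auto
    have "real (N+1) \<notin> ?J" using mx ts(2) la by force
    then have "\<forall>\<^sub>F s in at (real (N+1)) within {0..real (N+1)}. ?K s = ?K (real (N+1))"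
      by (auto simp: jump_times_def)
    moreover have "\<forall>\<^sub>F s in at (real (N+1)) within {0..real (N+1)}. s \<in> {last ts..<real (N+1)}"
      unfolding eventually_at_filter using la
      by (intro eventually_mono[OF eventually_nhds_in_open[of "{last ts<..}"]]) auto
    ultimately have "\<forall>\<^sub>F s in at (real (N+1)) within {0..real (N+1)}. ?K s = ?K (real (N+1)) \<and> s \<in> {last ts..<real (N+1)}"
      by eventually_elim auto
    moreover have "at (real (N+1)) within {0..real (N+1)} \<noteq> bot"
      by (simp add: at_within_Icc_at_left trivial_limit_at_left_real)
    ultimately obtain s where "?K s = ?K (real (N+1))" "s \<in> {last ts..<real (N+1)}"
      using eventually_happens by blast
    moreover have "{last ts<..<real (N+1)} \<inter> ?J = {}" using mx ts(2) by force
    ultimately show ?thesis using complex_at_const[OF fin la(2) order_refl] KN by metis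
  next
    case True
    then show ?thesis by (metis KN)
  qed
  have neq: "?K (ts ! i) \<noteq> ?K (ts ! Suc i)" if i: "Suc i < length ts" for i
  proof
    assume eq: "?K (ts ! i) = ?K (ts ! Suc i)"
    let ?a = "ts ! i" and ?b = "ts ! Suc i"
    have ab: "0 \<le> ?a" "?a < ?b" "?b \<le> real (N+1)"
      using mem[of i] mem[of "Suc i"] i ts(1) by (auto simp: sorted_wrt_iff_nth_less)
    have bJ: "?b \<in> ?J" using i ts(2) nth_mem[OF i] ab by auto
    have c: "?K s = ?K ?b" if "s \<in> {?a..<?b}" for s
      using complex_at_const[OF fin ab(1,3) gap[OF i] that] eq by simp
    obtain d where d: "d > 0" "\<And>s. s\<in>{?b..<?b+d} \<Longrightarrow> ?K s = ?K ?b"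
      using complex_at_right[OF fin, of ?b] ab by (metis less_imp_le order_trans)
    have c': "?K s = ?K ?b" if "s \<in> {?a<..<?b+d}" for s
      using c[of s] d(2)[of s] that by (cases "s < ?b") auto
    have "\<forall>\<^sub>F s in at ?b within {0..real (N+1)}. ?K s = ?K ?b"
      unfolding eventually_at_filter
    proof (rule eventually_mono)
      show "\<forall>\<^sub>F s in nhds ?b. s \<in> {?a<..<?b+d}"
        using d(1) ab by (intro eventually_nhds_in_open) auto
    qed (use c' in blast)
    then show False using bJ by (simp add: jump_times_def)
  qed
  have ne: "ts \<noteq> []" and hd: "hd ts = 0"
    by (simp_all add: ts_def)
  have fst: "map fst (map (\<lambda>t. (t, ?K t)) ts) = ts"
    by (simp add: o_def)
  have simp: "?K t \<subseteq> K \<and> simplicial_complex (?K t)" if "t \<in> set ts" for t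
    using that complex_at_simplicial[OF K assms(3), of t] ts(2) J by (auto simp: complex_at_def)
  show ?thesis unfolding Seq_def S mem_Collect_eq
  proof (intro conjI allI impI)
    show "hd (map (\<lambda>t. (t, ?K t)) ts) = (0, {})"
      using ne hd K0 by (metis list.map_sel(1))
    show "snd (last (map (\<lambda>t. (t, ?K t)) ts)) = {}"
      using ne last by (metis last_map snd_conv)
    show "sorted_wrt (<) (map fst (map (\<lambda>t. (t, ?K t)) ts))"
      unfolding fst by (rule ts(1))
    show "\<forall>(T, L)\<in>set (map (\<lambda>t. (t, ?K t)) ts). L \<subseteq> K \<and> simplicial_complex L"
      using simp by auto
    show "snd (map (\<lambda>t. (t, ?K t)) ts ! i) \<noteq> snd (map (\<lambda>t. (t, ?K t)) ts ! Suc i)"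
      if "Suc i < length (map (\<lambda>t. (t, ?K t)) ts)" for i
      using that neq[of i] by simp
  qed (use ne in simp)
qed

end

theory Submission
  imports Defs
begin

text \<open>The number of bars of a zigzag that are alive between two indices is the rank of the composite
  linear relation between the two spaces. For homology, if two complexes \<open>L\<close> and \<open>L'\<close> are
  joined by a path of complexes whose \<open>p\<close>-simplices contain those of \<open>L \<inter> L'\<close> and whose
  \<open>(p + 1)\<close>-simplices lie in \<open>L \<union> L'\<close>, then this relation identifies the cycles \<open>x\<close> of \<open>L\<close> and \<open>y\<close> of
  \<open>L'\<close> exactly if \<open>x - y\<close> bounds in \<open>L \<union> L'\<close>; the path itself does not matter. Outside the
  exceptional set, a small perturbation \<open>w\<close> of \<open>v\<close> moves the events of dimension \<open>p\<close> and \<open>p + 1\<close> by at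
  most a constant times the perturbation, and it changes the sequence of complexes near each
  crossing time of \<open>v\<close> only to another path of this kind. Hence after snapping the event times of
  \<open>w\<close> to the crossing times of \<open>v\<close> the two diagrams agree off the diagonal. Applying this at every point
  of the segment between two functions near \<open>v\<close>, with a uniform constant, gives the estimate.\<close>

section \<open>Linear algebra of function spaces\<close>

text \<open>Cycles see only the \<open>p\<close>-simplices of a complex and boundaries only its
  (\<open>p\<close> + 1)-simplices, so events in other dimensions may move without control. Two
  kinds of contact with the level \<epsilon> are dangerous: a \<open>p\<close>-simplex that
  disappears for a moment can break a long bar, and so can a (\<open>p\<close> + 1)-simplex that
  appears for a moment. These are \<open>N_plus\<close> and \<open>N_minus\<close>; on
  \<open>N_flat\<close> an edge lies in the level and crossing times do not depend on the values in
  a Lipschitz way. The opposite contacts only create or remove bars whose ends snap to the same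
  time, that is, diagonal points. The constant is the inverse of a lower bound for the slopes at
  crossings. The radius in which a centre can be compared with its neighbours shrinks with the
  distances of its crossing times, which can be arbitrarily small near a given function, whereas the
  slopes stay bounded below; this forces the passage along a segment. Barcodes are built by hand
  because a definite description says nothing about the diagram before existence and uniqueness of
  the decomposition are known.\<close>

definition fscale :: "'f::field \<Rightarrow> ('x \<Rightarrow> 'f) \<Rightarrow> 'x \<Rightarrow> 'f" where
  "fscale a c = (\<lambda>x. a * c x)"

lemma fscale_apply: "fscale a c x = a * c x"
  by (simp add: fscale_def)

text \<open>As simplification rules these would unfold the operations even when they are not applied.\<close>

declare plus_fun_apply [simp del] zero_fun_apply [simp del] minus_apply [simp del] uminus_apply [simp del]

lemmas fun_simps = fun_eq_iff plus_fun_apply zero_fun_apply minus_apply uminus_apply fscale_apply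

interpretation fs: vector_space fscale
  by unfold_locales (auto simp: fun_simps algebra_simps)

lemma sum_fun_apply: "(\<Sum>i\<in>A. f i) x = (\<Sum>i\<in>A. f i x :: 'f::comm_monoid_add)"
  by (induction A rule: infinite_finite_induct) (auto simp: fun_simps)

definition lin_on :: "('x \<Rightarrow> 'f::field) set \<Rightarrow> (('x \<Rightarrow> 'f) \<Rightarrow> ('y \<Rightarrow> 'f)) \<Rightarrow> bool" where
  "lin_on Z f \<longleftrightarrow> (\<forall>x\<in>Z. \<forall>y\<in>Z. f (x + y) = f x + f y) \<and> (\<forall>a. \<forall>x\<in>Z. f (fscale a x) = fscale a (f x))"

definition functional_on :: "('x \<Rightarrow> 'f::field) set \<Rightarrow> (('x \<Rightarrow> 'f) \<Rightarrow> 'f) \<Rightarrow> bool" where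
  "functional_on Z f \<longleftrightarrow> (\<forall>x\<in>Z. \<forall>y\<in>Z. f (x + y) = f x + f y) \<and> (\<forall>a. \<forall>x\<in>Z. f (fscale a x) = a * f x)"

lemma lin_on_functional: "lin_on Z f \<longleftrightarrow> (\<forall>j. functional_on Z (\<lambda>z. f z j))"
  by (auto simp: lin_on_def functional_on_def fun_simps)

lemma functional_on_0:
  assumes "functional_on Z f" "fs.subspace Z"
  shows "f 0 = 0"
proof -
  have "f (fscale 0 0) = 0 * f 0"
    using assms fs.subspace_0 unfolding functional_on_def by blast
  then show ?thesis by simp
qed

lemma functional_on_sum:
  assumes "functional_on Z f" "fs.subspace Z" "finite A" "\<And>i. i \<in> A \<Longrightarrow> x i \<in> Z"
  shows "f (\<Sum>i\<in>A. fscale (a i) (x i)) = (\<Sum>i\<in>A. a i * f (x i))"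
  using assms(3,4)
proof (induction A)
  case empty
  then show ?case using functional_on_0[OF assms(1,2)] by simp
next
  case (insert i A)
  have "(\<Sum>i\<in>A. fscale (a i) (x i)) \<in> Z"
    using insert.prems by (intro fs.subspace_sum[OF assms(2)] fs.subspace_scale[OF assms(2)]) auto
  moreover have "fscale (a i) (x i) \<in> Z" "x i \<in> Z"
    using insert.prems by (auto intro: fs.subspace_scale[OF assms(2)])
  ultimately show ?case
    using insert assms(1) by (simp add: functional_on_def)
qed

lemma functional_on_diff:
  assumes "functional_on Z f" "fs.subspace Z" "x \<in> Z" "y \<in> Z"
  shows "f (x - y) = f x - f y"
proof -
  have "fscale (-1) y \<in> Z" using assms fs.subspace_scale by blast
  then have "f (x + fscale (-1) y) = f x + (-1) * f y"
    using assms unfolding functional_on_def by metis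
  moreover have "x + fscale (-1) y = x - y" by (simp add: fun_simps)
  ultimately show ?thesis by simp
qed

lemma lin_on_diff:
  assumes "lin_on Z f" "fs.subspace Z" "x \<in> Z" "y \<in> Z"
  shows "f (x - y) = f x - f y"
proof
  fix j
  have "functional_on Z (\<lambda>z. f z j)" using assms(1) by (simp add: lin_on_functional)
  from functional_on_diff[OF this assms(2-4)] show "f (x - y) j = (f x - f y) j" by (simp add: minus_apply)
qed

lemma lin_on_0: "lin_on Z f \<Longrightarrow> fs.subspace Z \<Longrightarrow> f 0 = 0"
  using functional_on_0[of Z "\<lambda>z. f z _"] unfolding lin_on_functional fun_simps by blast

text \<open>The coefficient of \<open>u\<close> modulo \<open>W\<close> is well defined because two
  different values would put a non-zero multiple of \<open>u\<close> into \<open>W\<close>.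
  Depending on the step of the zigzag it gives rise to the coordinate of a newborn bar or is the
  functional whose kernel remains.\<close>

lemma coordinate_functional:
  fixes W :: "('x \<Rightarrow> 'f::field) set"
  assumes W: "fs.subspace W" and u: "u \<notin> W" and Z: "Z = {w + fscale a u | w a. w \<in> W}"
  obtains g where "functional_on Z g" "\<And>w a. w \<in> W \<Longrightarrow> g (w + fscale a u) = a"
proof
  define g where "g z = (THE a. z - fscale a u \<in> W)" for z
  show g: "g (w + fscale a u) = a" if "w \<in> W" for w a
    unfolding g_def
  proof (rule the_equality)
    show "w + fscale a u - fscale a u \<in> W" using that by simp
    fix a' assume "w + fscale a u - fscale a' u \<in> W"
    then have "(w + fscale a u - fscale a' u) - w \<in> W" using that W fs.subspace_diff by blast
    moreover have "(w + fscale a u - fscale a' u) - w = fscale (a - a') u"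
      by (simp add: fun_simps algebra_simps)
    ultimately have "fscale (a - a') u \<in> W" by simp
    then have "fscale (1 / (a - a')) (fscale (a - a') u) \<in> W" by (rule fs.subspace_scale[OF W])
    moreover have "fscale (1 / (a - a')) (fscale (a - a') u) = u" if "a' \<noteq> a"
      using that by (simp add: fun_simps)
    ultimately show "a' = a" using u by metis
  qed
  show "functional_on Z g"
    unfolding functional_on_def Z
  proof (intro conjI ballI allI)
    fix x y assume "x \<in> {w + fscale a u | w a. w \<in> W}" "y \<in> {w + fscale a u | w a. w \<in> W}"
    then obtain w a w' a' where x: "x = w + fscale a u" "w \<in> W" and y: "y = w' + fscale a' u" "w' \<in> W"
      by blast
    have "x + y = (w + w') + fscale (a + a') u" by (simp add: x y fun_simps algebra_simps)
    moreover have "w + w' \<in> W" using W x y fs.subspace_add by blast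
    ultimately show "g (x + y) = g x + g y" using g x y by metis
  next
    fix c x assume "x \<in> {w + fscale a u | w a. w \<in> W}"
    then obtain w a where x: "x = w + fscale a u" "w \<in> W" by blast
    have "fscale c x = fscale c w + fscale (c * a) u" by (simp add: x fun_simps algebra_simps)
    moreover have "fscale c w \<in> W" using W x fs.subspace_scale by blast
    ultimately show "g (fscale c x) = c * g x" using g x by metis
  qed
qed


section \<open>Barcodes of zigzags of subquotients\<close>

text \<open>
  A zigzag of subquotients \<open>Z i / B i\<close> is described by its numerators and denominators. A barcode
  comes with coordinates \<open>\<phi> i\<close>, which induce an isomorphism of \<open>Z i / B i\<close> with the space of
  functions on the bars that are alive at \<open>i\<close>.
\<close>

definition alive :: "(nat \<times> nat) list \<Rightarrow> nat \<Rightarrow> nat \<Rightarrow> bool" where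
  "alive bs j i \<longleftrightarrow> j < length bs \<and> fst (bs ! j) \<le> i \<and> i \<le> snd (bs ! j)"

definition coord :: "(nat \<times> nat) list \<Rightarrow> nat \<Rightarrow> (nat \<Rightarrow> 'f::field) set" where
  "coord bs i = {y. \<forall>j. y j \<noteq> 0 \<longrightarrow> alive bs j i}"

definition restr :: "(nat \<times> nat) list \<Rightarrow> nat \<Rightarrow> (nat \<Rightarrow> 'f::field) \<Rightarrow> nat \<Rightarrow> 'f" where
  "restr bs i y = (\<lambda>j. if alive bs j i \<and> alive bs j (Suc i) then y j else 0)"

definition coordinates ::
  "(nat \<times> nat) list \<Rightarrow> nat \<Rightarrow> ('x \<Rightarrow> 'f::field) set \<Rightarrow> ('x \<Rightarrow> 'f) set \<Rightarrow> (('x \<Rightarrow> 'f) \<Rightarrow> nat \<Rightarrow> 'f) \<Rightarrow> bool"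
  where
  "coordinates bs i Z B f \<longleftrightarrow> lin_on Z f \<and> f ` Z = coord bs i \<and> (\<forall>z\<in>Z. f z = 0 \<longleftrightarrow> z \<in> B)"

definition compatible where
  "compatible bs i fw Z Z' f f' \<longleftrightarrow>
     (if fw then \<forall>z\<in>Z. f' z = restr bs i (f z) else \<forall>z\<in>Z'. f z = restr bs i (f' z))"

text \<open>Bars may begin at 0 and reach \<open>n\<close>: the construction proceeds along prefixes
  of the zigzag, whose last space need not vanish, and the bars that reach the last index are the
  ones still open.\<close>

definition barcode where
  "barcode Z B fwd n bs \<phi> \<longleftrightarrow> (\<forall>(b, d)\<in>set bs. b \<le> d \<and> d \<le> n) \<and>
     (\<forall>i\<le>n. coordinates bs i (Z i) (B i) (\<phi> i)) \<and>
     (\<forall>i<n. compatible bs i (fwd i) (Z i) (Z (Suc i)) (\<phi> i) (\<phi> (Suc i)))"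

lemma coord_cong: "(\<And>j. alive bs j i \<longleftrightarrow> alive bs' j i) \<Longrightarrow> coord bs i = coord bs' i"
  by (simp add: coord_def)

text \<open>The gluing step of the construction: the new list may prolong open bars to
  \<open>Suc m\<close> and add bars born there, as long as the bars alive at each index up to
  \<open>m\<close> stay the same, so that all earlier coordinates remain valid.\<close>

lemma barcode_extend:
  assumes bar: "barcode Z B fwd m bs \<phi>"
    and alive: "\<And>j i. i \<le> m \<Longrightarrow> alive bs' j i \<longleftrightarrow> alive bs j i"
    and bd: "\<forall>(b, d)\<in>set bs'. b \<le> d \<and> d \<le> Suc m"
    and co: "coordinates bs' (Suc m) (Z (Suc m)) (B (Suc m)) \<psi>"
    and comp: "compatible bs' m (fwd m) (Z m) (Z (Suc m)) (\<phi> m) \<psi>"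
  shows "barcode Z B fwd (Suc m) bs' (\<phi>(Suc m := \<psi>))"
proof -
  let ?\<phi> = "\<phi>(Suc m := \<psi>)"
  have "coordinates bs' i (Z i) (B i) (?\<phi> i)" if "i \<le> Suc m" for i
  proof (cases "i = Suc m")
    case False
    then have "i \<le> m" using that by simp
    then have "coord bs' i = (coord bs i :: (nat \<Rightarrow> 'b) set)" using alive by (intro coord_cong) auto
    then show ?thesis using bar \<open>i \<le> m\<close> by (simp add: barcode_def coordinates_def)
  qed (use co in simp)
  moreover have "compatible bs' i (fwd i) (Z i) (Z (Suc i)) (?\<phi> i) (?\<phi> (Suc i))" if "i < Suc m" for i
  proof (cases "i = m")
    case False
    then have "i < m" using that by simp
    then have "restr bs' i = (restr bs i :: (nat \<Rightarrow> 'b) \<Rightarrow> _)" using alive by (simp add: restr_def fun_simps)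
    then show ?thesis using bar \<open>i < m\<close> by (simp add: barcode_def compatible_def)
  qed (use comp in simp)
  ultimately show ?thesis using bd unfolding barcode_def by blast
qed

text \<open>Preimages of the unit vectors under the coordinate map; modulo \<open>B i\<close> they
  form a basis dual to the coordinates. It serves to expand a functional in the coordinates and to
  project onto \<open>B i\<close>.\<close>

lemma barcode_dual_basis:
  assumes bar: "barcode Z B fwd n bs \<phi>" and i: "i \<le> n" and sub: "fs.subspace (Z i)"
  obtains x where "\<And>j. alive bs j i \<Longrightarrow> x j \<in> Z i"
    "\<And>j k. alive bs j i \<Longrightarrow> \<phi> i (x j) k = (if k = j then 1 else 0)"
    "\<And>z. z \<in> Z i \<Longrightarrow> z - (\<Sum>j | alive bs j i. fscale (\<phi> i z j) (x j)) \<in> B i"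
proof -
  have co: "coordinates bs i (Z i) (B i) (\<phi> i)" using bar i by (simp add: barcode_def)
  then have lin: "lin_on (Z i) (\<phi> i)" and im: "\<phi> i ` Z i = coord bs i"
    and ker: "\<And>z. z \<in> Z i \<Longrightarrow> \<phi> i z = 0 \<longleftrightarrow> z \<in> B i"
    by (auto simp: coordinates_def)
  have "\<exists>z\<in>Z i. \<phi> i z = (\<lambda>k. if k = j then 1 else 0)" if "alive bs j i" for j
  proof -
    have "(\<lambda>k. if k = j then 1 else 0) \<in> \<phi> i ` Z i" using that unfolding im by (auto simp: coord_def)
    then show ?thesis by (auto simp: image_iff)
  qed
  then obtain x where x: "\<And>j. alive bs j i \<Longrightarrow> x j \<in> Z i \<and> \<phi> i (x j) = (\<lambda>k. if k = j then 1 else 0)"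
    by metis
  have fin: "finite {j. alive bs j i}" by (rule finite_subset[of _ "{..<length bs}"]) (auto simp: alive_def)
  have "z - (\<Sum>j | alive bs j i. fscale (\<phi> i z j) (x j)) \<in> B i" if z: "z \<in> Z i" for z
  proof -
    let ?s = "\<Sum>j | alive bs j i. fscale (\<phi> i z j) (x j)"
    have s: "?s \<in> Z i" using x by (intro fs.subspace_sum[OF sub] fs.subspace_scale[OF sub]) auto
    have "\<phi> i (z - ?s) = \<phi> i z - \<phi> i ?s" using lin_on_diff[OF lin sub z s] .
    also have "\<phi> i ?s = \<phi> i z"
    proof
      fix k
      have "\<phi> i ?s k = (\<Sum>j | alive bs j i. \<phi> i z j * \<phi> i (x j) k)"
        using functional_on_sum[OF _ sub fin, of "\<lambda>z. \<phi> i z k"] lin x by (auto simp: lin_on_functional)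
      also have "\<dots> = (\<Sum>j | alive bs j i. if j = k then \<phi> i z j else 0)"
        by (rule sum.cong) (auto simp: x)
      also have "\<dots> = (if alive bs k i then \<phi> i z k else 0)" using fin by (simp add: sum.delta)
      also have "\<dots> = \<phi> i z k" using im z by (auto simp: coord_def)
      finally show "\<phi> i ?s k = \<phi> i z k" .
    qed
    finally have "\<phi> i (z - ?s) = 0" by simp
    then show ?thesis using ker fs.subspace_diff[OF sub z s] by blast
  qed
  with x show ?thesis by (intro that[of x]) auto
qed


subsection \<open>Change of coordinates\<close>

text \<open>
  Between the interval modules of two bars that are alive at the end there is a non-zero morphism
  exactly if their birth keys are ordered accordingly; only then may one coordinate be sheared by
  the other.
\<close>

definition birth_key :: "(nat \<Rightarrow> bool) \<Rightarrow> nat \<times> nat \<Rightarrow> int" where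
  "birth_key fwd bd = (if fst bd > 0 \<and> fwd (fst bd - 1) then int (fst bd) else - int (fst bd))"

text \<open>Both bars reach the last index, so compatibility can fail only at the birth of one of
  them: a birth of \<open>j\<close> by a forward map while \<open>i\<close> is already alive, or a
  birth of \<open>i\<close> by a backward map while \<open>j\<close> is already alive. The order of
  the keys excludes both.\<close>

lemma barcode_shear:
  fixes \<alpha> :: "'f::field" and Z :: "nat \<Rightarrow> ('x \<Rightarrow> 'f) set"
  assumes bar: "barcode Z B fwd n bs \<phi>"
    and j: "j < length bs" "snd (bs ! j) = n" and i: "i < length bs" "snd (bs ! i) = n"
    and ij: "i \<noteq> j" and key: "birth_key fwd (bs ! j) \<le> birth_key fwd (bs ! i)"
  defines "\<phi>' \<equiv> \<lambda>l z k. if k = j \<and> alive bs j l then \<phi> l z j - \<alpha> * \<phi> l z i else \<phi> l z k"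
  shows "barcode Z B fwd n bs \<phi>'"
proof -
  have zero: "\<phi> l z k = 0" if "l \<le> n" "z \<in> Z l" "\<not> alive bs k l" for l z k
  proof -
    have "\<phi> l z \<in> coord bs l" using bar that by (auto simp: barcode_def coordinates_def)
    then show ?thesis using that by (auto simp: coord_def)
  qed
  have "coordinates bs l (Z l) (B l) (\<phi>' l)" if l: "l \<le> n" for l
  proof -
    have co: "coordinates bs l (Z l) (B l) (\<phi> l)" using bar l by (simp add: barcode_def)
    then have lin: "lin_on (Z l) (\<phi> l)" and im: "\<phi> l ` Z l = coord bs l"
      and ker: "\<And>z. z \<in> Z l \<Longrightarrow> \<phi> l z = 0 \<longleftrightarrow> z \<in> B l"
      by (auto simp: coordinates_def)
    have "lin_on (Z l) (\<phi>' l)"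
      using lin unfolding lin_on_def \<phi>'_def by (auto simp: fun_simps algebra_simps)
    moreover have "\<phi>' l ` Z l = coord bs l"
    proof safe
      fix z assume "z \<in> Z l"
      then show "\<phi>' l z \<in> coord bs l" using zero[OF l] by (auto simp: coord_def \<phi>'_def)
    next
      fix y :: "nat \<Rightarrow> 'f" assume y: "y \<in> coord bs l"
      let ?y = "\<lambda>k. if k = j \<and> alive bs j l then y j + \<alpha> * y i else y k"
      have "?y \<in> coord bs l" using y by (auto simp: coord_def)
      then have "?y \<in> \<phi> l ` Z l" by (simp only: im)
      then obtain z where z: "z \<in> Z l" "?y = \<phi> l z" by blast
      have "\<phi>' l z = y" using ij by (simp add: \<phi>'_def z(2)[symmetric] fun_eq_iff)
      then show "y \<in> \<phi>' l ` Z l" using z(1) by blast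
    qed
    moreover have "\<phi>' l z = 0 \<longleftrightarrow> \<phi> l z = 0" for z
    proof
      assume *: "\<phi>' l z = 0"
      have i0: "\<phi> l z i = 0" using fun_cong[OF *, of i] ij by (simp add: \<phi>'_def zero_fun_apply)
      show "\<phi> l z = 0"
      proof
        fix k show "\<phi> l z k = 0 k"
          using fun_cong[OF *, of k] i0 by (auto simp: \<phi>'_def zero_fun_apply split: if_splits)
      qed
    qed (auto simp: \<phi>'_def fun_simps)
    ultimately show ?thesis using ker by (simp add: coordinates_def)
  qed
  moreover have "compatible bs l (fwd l) (Z l) (Z (Suc l)) (\<phi>' l) (\<phi>' (Suc l))" if l: "l < n" for l
  proof -
    have comp: "compatible bs l (fwd l) (Z l) (Z (Suc l)) (\<phi> l) (\<phi> (Suc l))"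
      using bar l by (simp add: barcode_def)
    have aj: "alive bs j l \<longleftrightarrow> fst (bs ! j) \<le> l" "alive bs j (Suc l) \<longleftrightarrow> fst (bs ! j) \<le> Suc l"
      "alive bs i l \<longleftrightarrow> fst (bs ! i) \<le> l" "alive bs i (Suc l) \<longleftrightarrow> fst (bs ! i) \<le> Suc l"
      using i j l by (auto simp: alive_def)
    show ?thesis
    proof (cases "fwd l")
      case True
      have "\<phi>' (Suc l) z = restr bs l (\<phi>' l z)" if z: "z \<in> Z l" for z
      proof
        fix k
        have *: "\<phi> (Suc l) z = restr bs l (\<phi> l z)" using comp True z by (simp add: compatible_def)
        have "fst (bs ! j) = Suc l \<Longrightarrow> \<not> fst (bs ! i) \<le> l"
          using key True by (auto simp: birth_key_def split: if_splits)
        then have "fst (bs ! j) = Suc l \<Longrightarrow> \<phi> l z i = 0" using zero[of l z i] z l aj by auto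
        moreover have "\<not> fst (bs ! i) \<le> l \<Longrightarrow> \<phi> l z i = 0" using zero[of l z i] z l aj by auto
        moreover have v: "\<phi> (Suc l) z k' = (if alive bs k' l \<and> alive bs k' (Suc l) then \<phi> l z k' else 0)" for k'
          unfolding * restr_def ..
        moreover have "fst (bs ! j) \<le> l \<or> fst (bs ! j) = Suc l \<or> fst (bs ! j) > Suc l" by linarith
        ultimately show "\<phi>' (Suc l) z k = restr bs l (\<phi>' l z) k"
          by (cases "k = j"; elim disjE) (simp_all add: \<phi>'_def restr_def aj)
      qed
      then show ?thesis using True by (simp add: compatible_def)
    next
      case False
      have "\<phi>' l z = restr bs l (\<phi>' (Suc l) z)" if z: "z \<in> Z (Suc l)" for z
      proof
        fix k
        have *: "\<phi> l z = restr bs l (\<phi> (Suc l) z)" using comp False z by (simp add: compatible_def)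
        have "fst (bs ! i) = Suc l \<Longrightarrow> \<not> fst (bs ! j) \<le> l"
          using key False by (auto simp: birth_key_def split: if_splits)
        moreover have "\<not> fst (bs ! i) \<le> Suc l \<Longrightarrow> \<phi> (Suc l) z i = 0" using zero[of "Suc l" z i] z l aj by auto
        moreover have v: "\<phi> l z k' = (if alive bs k' l \<and> alive bs k' (Suc l) then \<phi> (Suc l) z k' else 0)" for k'
          unfolding * restr_def ..
        moreover have "fst (bs ! i) \<le> l \<or> fst (bs ! i) = Suc l \<or> fst (bs ! i) > Suc l" by linarith
        ultimately show "\<phi>' l z k = restr bs l (\<phi>' (Suc l) z) k"
          by (cases "k = j"; elim disjE) (simp_all add: \<phi>'_def restr_def aj)
      qed
      then show ?thesis using False by (simp add: compatible_def)
    qed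
  qed
  ultimately show ?thesis using bar by (simp add: barcode_def)
qed

lemma alive_end:
  assumes "barcode Z B fwd n bs \<phi>" "alive bs j n"
  shows "j < length bs" "snd (bs ! j) = n"
proof -
  show j: "j < length bs" using assms(2) by (simp add: alive_def)
  then have "bs ! j \<in> set bs" by simp
  then have "snd (bs ! j) \<le> n" using assms(1) unfolding barcode_def by (metis (mono_tags, lifting) case_prod_unfold)
  then show "snd (bs ! j) = n" using assms(2) by (simp add: alive_def)
qed

text \<open>Gaussian elimination with admissible shears only. Birth keys are integers, so between
  two open bars with non-zero coordinate at least one direction of shear is allowed, and it clears
  one of the two coordinates. The induction is on the number of non-zero coordinates.\<close>

lemma barcode_reduce_vector:
  assumes "barcode Z B fwd n bs \<phi>" "u \<in> Z n" "u \<notin> B n"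
  shows "\<exists>\<phi>' i. barcode Z B fwd n bs \<phi>' \<and> \<phi>' n u i \<noteq> 0 \<and> (\<forall>j. j \<noteq> i \<longrightarrow> \<phi>' n u j = 0)"
  using assms(1)
proof (induction "card {j. \<phi> n u j \<noteq> 0}" arbitrary: \<phi> rule: less_induct)
  case less
  let ?J = "{j. \<phi> n u j \<noteq> 0}"
  have co: "coordinates bs n (Z n) (B n) (\<phi> n)" using less.prems by (simp add: barcode_def)
  then have "\<phi> n u \<in> coord bs n" using assms(2) by (auto simp: coordinates_def)
  then have J: "j < length bs \<and> snd (bs ! j) = n" if "j \<in> ?J" for j
    using that alive_end[OF less.prems, of j] by (simp add: coord_def)
  have fin: "finite ?J" by (rule finite_subset[of _ "{..<length bs}"]) (use J in auto)
  have "\<phi> n u \<noteq> 0" using co assms(2,3) by (auto simp: coordinates_def)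
  then obtain i where i: "i \<in> ?J" by (auto simp: fun_simps)
  show ?case
  proof (cases "?J = {i}")
    case True
    then show ?thesis using less.prems by (intro exI[of _ \<phi>] exI[of _ i]) auto
  next
    case False
    then obtain j0 where j0: "j0 \<in> ?J" "j0 \<noteq> i" using i by blast
    obtain i j where ij: "i \<in> ?J" "j \<in> ?J" "i \<noteq> j" "birth_key fwd (bs ! j) \<le> birth_key fwd (bs ! i)"
      using i j0 by (metis linear)
    define \<alpha> where "\<alpha> = \<phi> n u j / \<phi> n u i"
    define \<phi>' where "\<phi>' = (\<lambda>l z k. if k = j \<and> alive bs j l then \<phi> l z j - \<alpha> * \<phi> l z i else \<phi> l z k)"
    have bar: "barcode Z B fwd n bs \<phi>'"
      unfolding \<phi>'_def using barcode_shear[OF less.prems] J ij by blast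
    have "alive bs j n" using ij(2) \<open>\<phi> n u \<in> coord bs n\<close> by (auto simp: coord_def)
    then have "{j. \<phi>' n u j \<noteq> 0} = ?J - {j}" using ij by (auto simp: \<phi>'_def \<alpha>_def)
    then have "card {j. \<phi>' n u j \<noteq> 0} < card ?J"
      using ij(2) fin card_Diff1_less[of ?J j] by metis
    then show ?thesis using less.hyps[OF _ bar] by blast
  qed
qed

text \<open>The dual elimination, for a functional instead of a vector. The shear is the same, but
  now it removes the bar \<open>i\<close> with the larger key from the combination, whereas for a
  vector it clears the coordinate with the smaller key.\<close>

lemma barcode_reduce_functional:
  assumes "barcode Z B fwd n bs \<phi>" "\<And>z. z \<in> Z n \<Longrightarrow> g z = (\<Sum>j\<in>J. a j * \<phi> n z j)"
    "finite J" "\<And>j. j \<in> J \<Longrightarrow> alive bs j n \<and> a j \<noteq> 0" "J \<noteq> {}"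
  shows "\<exists>\<phi>' i c. barcode Z B fwd n bs \<phi>' \<and> alive bs i n \<and> c \<noteq> 0 \<and> (\<forall>z\<in>Z n. g z = c * \<phi>' n z i)"
  using assms
proof (induction "card J" arbitrary: \<phi> J a rule: less_induct)
  case less
  have J: "j < length bs \<and> snd (bs ! j) = n" if "j \<in> J" for j
    using less.prems(4)[OF that] alive_end[OF less.prems(1), of j] by simp
  obtain i where i: "i \<in> J" using less.prems by blast
  show ?case
  proof (cases "J = {i}")
    case True
    then show ?thesis using less.prems by (intro exI[of _ \<phi>] exI[of _ i] exI[of _ "a i"]) auto
  next
    case False
    then obtain j0 where j0: "j0 \<in> J" "j0 \<noteq> i" using i by blast
    obtain i j where ij: "i \<in> J" "j \<in> J" "i \<noteq> j" "birth_key fwd (bs ! j) \<le> birth_key fwd (bs ! i)"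
      using i j0 by (metis linear)
    \<comment> \<open>Chosen so that the new coordinate of \<open>j\<close> absorbs the term of
      \<open>i\<close>: its multiple by \<open>a j\<close> equals
      \<open>a j * \<phi> n z j + a i * \<phi> n z i\<close>.\<close>
    define \<alpha> where "\<alpha> = - a i / a j"
    define \<phi>' where "\<phi>' = (\<lambda>l z k. if k = j \<and> alive bs j l then \<phi> l z j - \<alpha> * \<phi> l z i else \<phi> l z k)"
    have bar: "barcode Z B fwd n bs \<phi>'"
      unfolding \<phi>'_def using barcode_shear[OF less.prems(1)] J ij by blast
    have "g z = (\<Sum>k\<in>J - {i}. a k * \<phi>' n z k)" if "z \<in> Z n" for z
    proof -
      have aj: "alive bs j n" "a j \<noteq> 0" using less.prems(4) ij by auto
      have "g z = a i * \<phi> n z i + (a j * \<phi> n z j + (\<Sum>k\<in>J - {i} - {j}. a k * \<phi> n z k))"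
        using less.prems(2)[OF that] ij less.prems(3)
        by (simp add: sum.remove[of J i] sum.remove[of "J - {i}" j])
      also have "a i * \<phi> n z i + (a j * \<phi> n z j + (\<Sum>k\<in>J - {i} - {j}. a k * \<phi> n z k)) =
          a j * \<phi>' n z j + (\<Sum>k\<in>J - {i} - {j}. a k * \<phi>' n z k)"
        using aj by (simp add: \<phi>'_def \<alpha>_def field_simps)
      also have "\<dots> = (\<Sum>k\<in>J - {i}. a k * \<phi>' n z k)"
        using ij less.prems(3) by (simp add: sum.remove[of "J - {i}" j])
      finally show ?thesis .
    qed
    moreover have "card (J - {i}) < card J" using ij less.prems(3) by (intro card_Diff1_less)
    ultimately show ?thesis using less.hyps[of "J - {i}", OF _ bar] less.prems ij by blast
  qed
qed

subsection \<open>Existence\<close>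

definition line_extension :: "('x \<Rightarrow> 'f::field) set \<Rightarrow> ('x \<Rightarrow> 'f) \<Rightarrow> ('x \<Rightarrow> 'f) set" where
  "line_extension W u = {w + fscale a u | w a. w \<in> W}"

text \<open>What the insertion of one simplex can do to cycles and boundaries: nothing, one new
  class, or one class killed. The relation is always read along the map, so a deletion is the same
  relation with source and target exchanged.\<close>

definition elementary ::
  "('x \<Rightarrow> 'f::field) set \<Rightarrow> ('x \<Rightarrow> 'f) set \<Rightarrow> ('x \<Rightarrow> 'f) set \<Rightarrow> ('x \<Rightarrow> 'f) set \<Rightarrow> bool" where
  "elementary Z B Z' B' \<longleftrightarrow> Z' = Z \<and> B' = B
     \<or> B' = B \<and> (\<exists>u. u \<notin> Z \<and> Z' = line_extension Z u)
     \<or> Z' = Z \<and> (\<exists>u\<in>Z. u \<notin> B \<and> B' = line_extension B u)"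

locale elementary_zigzag =
  fixes Z B :: "nat \<Rightarrow> ('x \<Rightarrow> 'f::field) set" and fwd :: "nat \<Rightarrow> bool" and n :: nat
  assumes subspace_Z: "i \<le> n \<Longrightarrow> fs.subspace (Z i)"
    and subspace_B: "i \<le> n \<Longrightarrow> fs.subspace (B i)"
    and B_subset_Z: "i \<le> n \<Longrightarrow> B i \<subseteq> Z i"
    and step: "i < n \<Longrightarrow> if fwd i then elementary (Z i) (B i) (Z (Suc i)) (B (Suc i))
                 else elementary (Z (Suc i)) (B (Suc i)) (Z i) (B i)"

lemma line_extension_superset: "W \<subseteq> line_extension W u"
proof
  fix w assume "w \<in> W"
  moreover have "w = w + fscale 0 u" by (simp add: fun_simps)
  ultimately show "w \<in> line_extension W u" unfolding line_extension_def by blast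
qed

lemma line_extension_generator:
  assumes "fs.subspace W" shows "u \<in> line_extension W u"
proof -
  have "u = 0 + fscale 1 u" by (simp add: fun_simps)
  then show ?thesis using fs.subspace_0[OF assms] unfolding line_extension_def by blast
qed

lemma elementary_mono: "elementary Z B Z' B' \<Longrightarrow> Z \<subseteq> Z' \<and> B \<subseteq> B'"
  unfolding elementary_def using line_extension_superset by blast

text \<open>\<open>X\<close> is the set of bars that end at \<open>m\<close>; all other open bars
  are prolonged. Bars keep their positions in the list, so coordinates keep their indices.\<close>

definition extend_bars :: "(nat \<times> nat) list \<Rightarrow> nat \<Rightarrow> nat set \<Rightarrow> (nat \<times> nat) list" where
  "extend_bars bs m X =
     map (\<lambda>j. if snd (bs ! j) = m \<and> j \<notin> X then (fst (bs ! j), Suc m) else bs ! j) [0..<length bs]"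

lemma length_extend_bars [simp]: "length (extend_bars bs m X) = length bs"
  by (simp add: extend_bars_def)

lemma extend_bars:
  assumes "\<forall>(b, d)\<in>set bs. b \<le> d \<and> d \<le> m"
  shows "i \<le> m \<Longrightarrow> alive (extend_bars bs m X) j i \<longleftrightarrow> alive bs j i"
    and "alive (extend_bars bs m X) j (Suc m) \<longleftrightarrow> alive bs j m \<and> j \<notin> X"
    and "\<forall>(b, d)\<in>set (extend_bars bs m X). b \<le> d \<and> d \<le> Suc m"
proof -
  have bd: "fst (bs ! j) \<le> snd (bs ! j) \<and> snd (bs ! j) \<le> m" if "j < length bs" for j
    using assms nth_mem[OF that] by (auto simp: case_prod_unfold)
  have nth: "extend_bars bs m X ! j = (if snd (bs ! j) = m \<and> j \<notin> X then (fst (bs ! j), Suc m) else bs ! j)"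
    if "j < length bs" for j
    using that by (simp add: extend_bars_def)
  show "alive (extend_bars bs m X) j i \<longleftrightarrow> alive bs j i" if "i \<le> m"
  proof (cases "j < length bs")
    case True
    then show ?thesis using bd[of j] nth[of j] that by (simp add: alive_def)
  qed (simp add: alive_def)
  show "alive (extend_bars bs m X) j (Suc m) \<longleftrightarrow> alive bs j m \<and> j \<notin> X"
  proof (cases "j < length bs")
    case True
    then show ?thesis using bd[of j] nth[of j] by (auto simp: alive_def)
  qed (simp add: alive_def)
  show "\<forall>(b, d)\<in>set (extend_bars bs m X). b \<le> d \<and> d \<le> Suc m"
  proof -
    have "fst (extend_bars bs m X ! j) \<le> snd (extend_bars bs m X ! j) \<and> snd (extend_bars bs m X ! j) \<le> Suc m"
      if "j < length bs" for j
      using bd[OF that] nth[OF that] by simp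
    then show ?thesis unfolding all_set_conv_all_nth by (simp add: case_prod_unfold)
  qed
qed

lemma alive_append: "alive (bs @ [bd]) j i \<longleftrightarrow> alive bs j i \<or> j = length bs \<and> fst bd \<le> i \<and> i \<le> snd bd"
  by (auto simp: alive_def nth_append)

context elementary_zigzag
begin

text \<open>A step affects only the bars that reach the last index. A birth needs one additional
  coordinate. A death needs coordinates in which the dying class, or the functional that cuts out
  the next space, involves one bar only; shears provide them without disturbing the earlier
  compatibilities.\<close>

lemma barcode_exists:
  assumes "Z 0 = {0}" "m \<le> n"
  shows "\<exists>bs \<phi>. barcode Z B fwd m bs \<phi>"
  using assms(2)
proof (induction m)
  case 0
  have "B 0 = {0}" using B_subset_Z[of 0] fs.subspace_0[OF subspace_B[of 0]] assms(1) by auto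
  then have "barcode Z B fwd 0 [] (\<lambda>_ _. 0)"
  proof -
    have "coord [] 0 = {0 :: nat \<Rightarrow> 'f}" by (auto simp: coord_def alive_def fun_simps)
    then show ?thesis
      using assms(1) \<open>B 0 = {0}\<close> by (simp add: barcode_def coordinates_def lin_on_def fun_simps)
  qed
  then show ?case by blast
next
  case (Suc m)
  then obtain bs \<phi> where bar: "barcode Z B fwd m bs \<phi>" by auto
  have bd: "\<forall>(b, d)\<in>set bs. b \<le> d \<and> d \<le> m" using bar by (simp add: barcode_def)
  note ext = extend_bars[OF bd]
  have m: "m \<le> n" "m < n" "Suc m \<le> n" using Suc.prems by auto
  note sub = subspace_Z[OF m(1)] subspace_Z[OF m(3)] subspace_B[OF m(1)] subspace_B[OF m(3)]
  have fin: "finite {j. alive bs j m}" by (rule finite_subset[of _ "{..<length bs}"]) (auto simp: alive_def)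
  have not_alive: "\<not> alive bs (length bs) i" for i by (simp add: alive_def)

  have same: ?case if "Z (Suc m) = Z m" "B (Suc m) = B m"
  proof -
    have c: "coord (extend_bars bs m {}) (Suc m) = (coord bs m :: (nat \<Rightarrow> 'f) set)"
      by (simp add: coord_def ext)
    have co: "coordinates bs m (Z m) (B m) (\<phi> m)" using bar by (simp add: barcode_def)
    have r: "restr (extend_bars bs m {}) m y = y" if "y \<in> coord bs m" for y :: "nat \<Rightarrow> 'f"
      using that by (auto simp: restr_def coord_def ext fun_eq_iff)
    have "barcode Z B fwd (Suc m) (extend_bars bs m {}) (\<phi>(Suc m := \<phi> m))"
    proof (rule barcode_extend[OF bar])
      show "coordinates (extend_bars bs m {}) (Suc m) (Z (Suc m)) (B (Suc m)) (\<phi> m)"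
        using co unfolding coordinates_def c that by simp
      have "\<phi> m z \<in> coord bs m" if "z \<in> Z m" for z using co that by (auto simp: coordinates_def)
      then show "compatible (extend_bars bs m {}) m (fwd m) (Z m) (Z (Suc m)) (\<phi> m) (\<phi> m)"
        using r by (simp add: compatible_def that)
    qed (use ext in auto)
    then show ?thesis by blast
  qed

  show ?case
  proof (cases "fwd m")
    case True
    then consider "Z (Suc m) = Z m" "B (Suc m) = B m"
      | u where "B (Suc m) = B m" "u \<notin> Z m" "Z (Suc m) = line_extension (Z m) u"
      | u where "Z (Suc m) = Z m" "u \<in> Z m" "u \<notin> B m" "B (Suc m) = line_extension (B m) u"
      using step[OF m(2)] unfolding elementary_def by auto
    then show ?thesis
    proof cases
      case 1
      then show ?thesis by (rule same)
    next
      case (2 u)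
      have co: "coordinates bs m (Z m) (B m) (\<phi> m)" using bar by (simp add: barcode_def)
      then have lin: "lin_on (Z m) (\<phi> m)" and im: "\<phi> m ` Z m = coord bs m"
        and ker: "\<And>z. z \<in> Z m \<Longrightarrow> \<phi> m z = 0 \<longleftrightarrow> z \<in> B m"
        by (auto simp: coordinates_def)
      obtain g where g: "functional_on (Z (Suc m)) g" "\<And>w a. w \<in> Z m \<Longrightarrow> g (w + fscale a u) = a"
        using coordinate_functional[OF sub(1) 2(2), of "Z (Suc m)"] 2(3) unfolding line_extension_def by blast
      \<comment> \<open>Projection onto \<open>Z m\<close> along \<open>u\<close>. Composed with it
        the old coordinates extend to the larger space, and the new bar, with index
        \<open>length bs\<close>, gets the coefficient \<open>g\<close>.\<close>
      define P where "P z = z - fscale (g z) u" for z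
      have P: "P (w + fscale a u) = w" if "w \<in> Z m" for w a
        using g(2)[OF that] by (simp add: P_def)
      have Pm: "P w = w" "g w = 0" if "w \<in> Z m" for w
        using P[OF that, of 0] g(2)[OF that, of 0] by simp_all
      have PZ: "P z \<in> Z m" if "z \<in> Z (Suc m)" for z
        using that P unfolding 2(3) line_extension_def by auto
      let ?bs = "extend_bars bs m {} @ [(Suc m, Suc m)]"
      have al: "alive ?bs j (Suc m) \<longleftrightarrow> alive bs j m \<or> j = length bs" for j
        by (simp add: alive_append ext)
      have al': "alive ?bs j i \<longleftrightarrow> alive bs j i" if "i \<le> m" for i j
        using that by (simp add: alive_append ext)
      define \<psi> where "\<psi> z = (\<lambda>j. if j = length bs then g z else \<phi> m (P z) j)" for z
      have "lin_on (Z (Suc m)) \<psi>"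
        unfolding lin_on_def
      proof (intro conjI ballI allI)
        fix x y assume xy: "x \<in> Z (Suc m)" "y \<in> Z (Suc m)"
        then have "g (x + y) = g x + g y" using g(1) by (simp add: functional_on_def)
        moreover from this have "P (x + y) = P x + P y" by (simp add: P_def fun_simps algebra_simps)
        moreover have "\<phi> m (P x + P y) = \<phi> m (P x) + \<phi> m (P y)" using lin PZ xy by (simp add: lin_on_def)
        ultimately have "\<psi> (x + y) j = (\<psi> x + \<psi> y) j" for j by (simp add: \<psi>_def plus_fun_apply)
        then show "\<psi> (x + y) = \<psi> x + \<psi> y" by (simp add: fun_eq_iff)
      next
        fix a x assume x: "x \<in> Z (Suc m)"
        then have "g (fscale a x) = a * g x" using g(1) by (simp add: functional_on_def)
        moreover from this have "P (fscale a x) = fscale a (P x)" by (simp add: P_def fun_simps algebra_simps)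
        moreover have "\<phi> m (fscale a (P x)) = fscale a (\<phi> m (P x))" using lin PZ x by (simp add: lin_on_def)
        ultimately have "\<psi> (fscale a x) j = fscale a (\<psi> x) j" for j by (simp add: \<psi>_def fscale_apply)
        then show "\<psi> (fscale a x) = fscale a (\<psi> x)" by (simp add: fun_eq_iff)
      qed
      moreover have "\<psi> ` Z (Suc m) = coord ?bs (Suc m)"
      proof safe
        fix z assume "z \<in> Z (Suc m)"
        then have "\<phi> m (P z) \<in> coord bs m" using im PZ by blast
        then show "\<psi> z \<in> coord ?bs (Suc m)" by (auto simp: coord_def al \<psi>_def)
      next
        fix y :: "nat \<Rightarrow> 'f" assume y: "y \<in> coord ?bs (Suc m)"
        then have "y(length bs := 0) \<in> coord bs m" by (auto simp: coord_def al)
        then have "y(length bs := 0) \<in> \<phi> m ` Z m" by (simp only: im)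
        then obtain w where w: "w \<in> Z m" "\<phi> m w = y(length bs := 0)" by (auto simp only: image_iff)
        have "w + fscale (y (length bs)) u \<in> Z (Suc m)"
          using w(1) unfolding 2(3) line_extension_def by blast
        moreover have "\<psi> (w + fscale (y (length bs)) u) = y"
          using w by (simp add: \<psi>_def P g(2) fun_eq_iff)
        ultimately show "y \<in> \<psi> ` Z (Suc m)" by (metis imageI)
      qed
      moreover have "\<psi> z = 0 \<longleftrightarrow> z \<in> B (Suc m)" if z: "z \<in> Z (Suc m)" for z
      proof
        assume *: "\<psi> z = 0"
        have "g z = 0" using fun_cong[OF *, of "length bs"] by (simp add: \<psi>_def zero_fun_apply)
        then have Pz: "P z = z" by (simp add: P_def)
        have "\<phi> m z j = 0" for j
        proof (cases "j = length bs")
          case True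
          have "\<phi> m z \<in> coord bs m" using im PZ[OF z] Pz by auto
          then show ?thesis using not_alive True by (auto simp: coord_def)
        next
          case False
          then show ?thesis using fun_cong[OF *, of j] Pz by (simp add: \<psi>_def zero_fun_apply)
        qed
        then have "\<phi> m z = 0" by (simp add: fun_eq_iff zero_fun_apply)
        then show "z \<in> B (Suc m)" using ker PZ[OF z] Pz 2(1) by auto
      next
        assume "z \<in> B (Suc m)"
        then have "z \<in> B m" using 2(1) by simp
        then have "z \<in> Z m" using B_subset_Z[OF m(1)] by blast
        then have "\<phi> m z = 0" "P z = z" "g z = 0" using ker \<open>z \<in> B m\<close> Pm by auto
        then have "\<psi> z j = 0" for j by (simp add: \<psi>_def zero_fun_apply)
        then show "\<psi> z = 0" by (simp add: fun_eq_iff zero_fun_apply)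
      qed
      ultimately have "coordinates ?bs (Suc m) (Z (Suc m)) (B (Suc m)) \<psi>"
        by (simp add: coordinates_def)
      moreover have "\<psi> z = restr ?bs m (\<phi> m z)" if "z \<in> Z m" for z
      proof -
        have "\<phi> m z \<in> coord bs m" using im that by blast
        then show ?thesis using not_alive that by (auto simp: \<psi>_def Pm restr_def al al' coord_def fun_eq_iff)
      qed
      then have "compatible ?bs m (fwd m) (Z m) (Z (Suc m)) (\<phi> m) \<psi>" using True by (simp add: compatible_def)
      ultimately have "barcode Z B fwd (Suc m) ?bs (\<phi>(Suc m := \<psi>))"
        using al' ext(3)[of "{}"] by (intro barcode_extend[OF bar]) auto
      then show ?thesis by blast
    next
      case (3 u)
      \<comment> \<open>After the elimination the killed class is a multiple of one basis class
        modulo \<open>B m\<close>, so enlarging the denominator by it ends exactly the bar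
        \<open>i\<close>.\<close>
      obtain \<phi>' i where bar': "barcode Z B fwd m bs \<phi>'" and i: "\<phi>' m u i \<noteq> 0" "\<And>j. j \<noteq> i \<Longrightarrow> \<phi>' m u j = 0"
        using barcode_reduce_vector[OF bar 3(2,3)] by blast
      have co: "coordinates bs m (Z m) (B m) (\<phi>' m)" using bar' by (simp add: barcode_def)
      then have lin: "lin_on (Z m) (\<phi>' m)" and im: "\<phi>' m ` Z m = coord bs m"
        and ker: "\<And>z. z \<in> Z m \<Longrightarrow> \<phi>' m z = 0 \<longleftrightarrow> z \<in> B m"
        by (auto simp: coordinates_def)
      let ?bs = "extend_bars bs m {i}"
      define \<psi> where "\<psi> z = (\<phi>' m z)(i := 0)" for z
      have "lin_on (Z m) \<psi>"
      proof -
        have "functional_on (Z m) (\<lambda>z. \<psi> z j)" for j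
          using lin by (cases "j = i") (auto simp: \<psi>_def lin_on_functional functional_on_def)
        then show ?thesis by (simp add: lin_on_functional)
      qed
      moreover have "\<psi> ` Z m = coord ?bs (Suc m)"
      proof safe
        fix z assume "z \<in> Z m"
        then have "\<phi>' m z \<in> coord bs m" using im by blast
        then show "\<psi> z \<in> coord ?bs (Suc m)" by (auto simp: coord_def ext \<psi>_def)
      next
        fix y :: "nat \<Rightarrow> 'f" assume y: "y \<in> coord ?bs (Suc m)"
        then have y': "y \<in> coord bs m" "y i = 0" by (auto simp: coord_def ext)
        then have "y \<in> \<phi>' m ` Z m" by (simp only: im)
        then obtain w where w: "w \<in> Z m" "\<phi>' m w = y" by (auto simp only: image_iff)
        then have "\<psi> w = y" using y'(2) by (auto simp: \<psi>_def)
        then show "y \<in> \<psi> ` Z m" using w by (metis imageI)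
      qed
      moreover have "\<psi> z = 0 \<longleftrightarrow> z \<in> B (Suc m)" if z: "z \<in> Z m" for z
      proof
        assume *: "\<psi> z = 0"
        define a where "a = \<phi>' m z i / \<phi>' m u i"
        have au: "fscale a u \<in> Z m" using 3(2) sub fs.subspace_scale by blast
        have "\<phi>' m (z - fscale a u) = \<phi>' m z - fscale a (\<phi>' m u)"
          using lin_on_diff[OF lin sub(1) z au] lin 3(2) by (simp add: lin_on_def)
        also have "\<dots> = 0"
        proof
          fix j show "(\<phi>' m z - fscale a (\<phi>' m u)) j = 0 j"
            using fun_cong[OF *, of j] i
            by (cases "j = i") (simp_all add: minus_apply zero_fun_apply fscale_apply \<psi>_def a_def)
        qed
        finally have "z - fscale a u \<in> B m" using ker fs.subspace_diff[OF sub(1) z au] by blast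
        moreover have "z = (z - fscale a u) + fscale a u" by simp
        ultimately show "z \<in> B (Suc m)" unfolding 3(4) line_extension_def by blast
      next
        assume "z \<in> B (Suc m)"
        then obtain b a where b: "z = b + fscale a u" "b \<in> B m" unfolding 3(4) line_extension_def by blast
        have "b \<in> Z m" using b B_subset_Z[OF m(1)] by blast
        have "fscale a u \<in> Z m" using 3(2) sub fs.subspace_scale by blast
        then have "\<phi>' m z = \<phi>' m b + fscale a (\<phi>' m u)" using b \<open>b \<in> Z m\<close> 3(2) lin by (simp add: lin_on_def)
        moreover have "\<phi>' m b = 0" using ker b(2) \<open>b \<in> Z m\<close> by blast
        ultimately have "\<psi> z j = 0" for j using i(2) by (simp add: \<psi>_def plus_fun_apply zero_fun_apply fscale_apply)
        then show "\<psi> z = 0" by (simp add: fun_eq_iff zero_fun_apply)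
      qed
      ultimately have "coordinates ?bs (Suc m) (Z (Suc m)) (B (Suc m)) \<psi>"
        by (simp add: coordinates_def 3(1))
      moreover have "\<psi> z = restr ?bs m (\<phi>' m z)" if "z \<in> Z m" for z
      proof -
        have "\<phi>' m z \<in> coord bs m" using im that by blast
        then show ?thesis by (auto simp: \<psi>_def restr_def ext coord_def fun_eq_iff)
      qed
      then have "compatible ?bs m (fwd m) (Z m) (Z (Suc m)) (\<phi>' m) \<psi>" using True by (simp add: compatible_def)
      ultimately have "barcode Z B fwd (Suc m) ?bs (\<phi>'(Suc m := \<psi>))"
        using ext by (intro barcode_extend[OF bar']) auto
      then show ?thesis by blast
    qed
  next
    case False
    then consider "Z (Suc m) = Z m" "B (Suc m) = B m"
      | u where "B m = B (Suc m)" "u \<notin> Z (Suc m)" "Z m = line_extension (Z (Suc m)) u"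
      | u where "Z m = Z (Suc m)" "u \<in> Z m" "u \<notin> B (Suc m)" "B m = line_extension (B (Suc m)) u"
      using step[OF m(2)] unfolding elementary_def by auto
    then show ?thesis
    proof cases
      case 1
      then show ?thesis by (rule same)
    next
      case (2 u)
      obtain g where g: "functional_on (Z m) g" "\<And>w a. w \<in> Z (Suc m) \<Longrightarrow> g (w + fscale a u) = a"
        using coordinate_functional[OF sub(2) 2(2), of "Z m"] 2(3) unfolding line_extension_def by blast
      have g0: "z \<in> Z (Suc m) \<longleftrightarrow> g z = 0" if z: "z \<in> Z m" for z
      proof -
        obtain w a where "z = w + fscale a u" "w \<in> Z (Suc m)" using z unfolding 2(3) line_extension_def by blast
        then show ?thesis using g(2)[of w a] g(2)[of z 0] by auto
      qed
      have ZZ: "Z (Suc m) \<subseteq> Z m" unfolding 2(3) by (rule line_extension_superset)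
      obtain x where x: "\<And>j. alive bs j m \<Longrightarrow> x j \<in> Z m"
        "\<And>z. z \<in> Z m \<Longrightarrow> z - (\<Sum>j | alive bs j m. fscale (\<phi> m z j) (x j)) \<in> B m"
        using barcode_dual_basis[OF bar order_refl sub(1)] by metis
      \<comment> \<open>\<open>g\<close> vanishes on \<open>Z (Suc m)\<close>, which contains
        \<open>B (Suc m) = B m\<close>. Hence it depends only on the class modulo \<open>B m\<close>
        and is a combination of the coordinates.\<close>
      have gs: "g z = (\<Sum>j | alive bs j m. g (x j) * \<phi> m z j)" if z: "z \<in> Z m" for z
      proof -
        let ?s = "\<Sum>j | alive bs j m. fscale (\<phi> m z j) (x j)"
        have s: "?s \<in> Z m" using x(1) by (intro fs.subspace_sum[OF sub(1)] fs.subspace_scale[OF sub(1)]) auto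
        have "z - ?s \<in> Z (Suc m)" using x(2)[OF z] 2(1) B_subset_Z[OF m(3)] by auto
        then have "g (z - ?s) = 0" using g0 ZZ by blast
        then have "g z = g ?s" using functional_on_diff[OF g(1) sub(1) z s] by simp
        also have "\<dots> = (\<Sum>j | alive bs j m. \<phi> m z j * g (x j))"
          using x(1) by (intro functional_on_sum[OF g(1) sub(1) fin]) auto
        finally show ?thesis by (simp add: mult.commute)
      qed
      let ?J = "{j. alive bs j m \<and> g (x j) \<noteq> 0}"
      have gs': "g z = (\<Sum>j\<in>?J. g (x j) * \<phi> m z j)" if z: "z \<in> Z m" for z
        unfolding gs[OF z] using fin by (intro sum.mono_neutral_right) auto
      have finJ: "finite ?J" using fin by (rule rev_finite_subset) auto
      have "?J \<noteq> {}"
      proof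
        assume "?J = {}"
        moreover have "u \<in> Z m" unfolding 2(3) by (rule line_extension_generator[OF sub(2)])
        ultimately have "g u = 0" using gs' by (metis sum.empty)
        then show False using 2(2) g0 \<open>u \<in> Z m\<close> by blast
      qed
      \<comment> \<open>In the new coordinates the smaller space is the zero set of a single one,
        whose bar therefore ends at \<open>m\<close>.\<close>
      then obtain \<phi>' i c where bar': "barcode Z B fwd m bs \<phi>'" and i: "alive bs i m" and c: "c \<noteq> 0"
          "\<And>z. z \<in> Z m \<Longrightarrow> g z = c * \<phi>' m z i"
        using barcode_reduce_functional[OF bar gs' finJ] by blast
      have co: "coordinates bs m (Z m) (B m) (\<phi>' m)" using bar' by (simp add: barcode_def)
      then have lin: "lin_on (Z m) (\<phi>' m)" and im: "\<phi>' m ` Z m = coord bs m"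
        and ker: "\<And>z. z \<in> Z m \<Longrightarrow> \<phi>' m z = 0 \<longleftrightarrow> z \<in> B m"
        by (auto simp: coordinates_def)
      have zi: "z \<in> Z (Suc m) \<longleftrightarrow> \<phi>' m z i = 0" if "z \<in> Z m" for z
        using g0[OF that] c(2)[OF that] c(1) by simp
      let ?bs = "extend_bars bs m {i}"
      have cc: "y \<in> coord ?bs (Suc m) \<longleftrightarrow> y \<in> coord bs m \<and> y i = 0" for y :: "nat \<Rightarrow> 'f"
        by (auto simp: coord_def ext)
      have "lin_on (Z (Suc m)) (\<phi>' m)" using lin ZZ unfolding lin_on_def by blast
      moreover have "\<phi>' m ` Z (Suc m) = coord ?bs (Suc m)"
      proof safe
        fix z assume z: "z \<in> Z (Suc m)"
        then have "\<phi>' m z \<in> coord bs m" using im ZZ by blast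
        then show "\<phi>' m z \<in> coord ?bs (Suc m)" using z zi ZZ by (auto simp: cc)
      next
        fix y :: "nat \<Rightarrow> 'f" assume y: "y \<in> coord ?bs (Suc m)"
        then have "y \<in> \<phi>' m ` Z m" by (simp only: im cc)
        then obtain w where w: "w \<in> Z m" "\<phi>' m w = y" by (auto simp only: image_iff)
        then have "w \<in> Z (Suc m)" using zi y by (auto simp: cc)
        then show "y \<in> \<phi>' m ` Z (Suc m)" using w by (metis imageI)
      qed
      ultimately have "coordinates ?bs (Suc m) (Z (Suc m)) (B (Suc m)) (\<phi>' m)"
        using ker ZZ 2(1) by (auto simp: coordinates_def)
      moreover have "\<phi>' m z = restr ?bs m (\<phi>' m z)" if "z \<in> Z (Suc m)" for z
      proof -
        have "\<phi>' m z \<in> coord bs m" "\<phi>' m z i = 0" using im that ZZ zi by blast+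
        then show ?thesis by (auto simp: restr_def ext coord_def fun_eq_iff)
      qed
      then have "compatible ?bs m (fwd m) (Z m) (Z (Suc m)) (\<phi>' m) (\<phi>' m)" using False by (simp add: compatible_def)
      ultimately have "barcode Z B fwd (Suc m) ?bs (\<phi>'(Suc m := \<phi>' m))"
        using ext by (intro barcode_extend[OF bar']) auto
      then show ?thesis by blast
    next
      case (3 u)
      have co: "coordinates bs m (Z m) (B m) (\<phi> m)" using bar by (simp add: barcode_def)
      then have lin: "lin_on (Z m) (\<phi> m)" and im: "\<phi> m ` Z m = coord bs m"
        and ker: "\<And>z. z \<in> Z m \<Longrightarrow> \<phi> m z = 0 \<longleftrightarrow> z \<in> B m"
        by (auto simp: coordinates_def)
      obtain g where g: "functional_on (B m) g" "\<And>w a. w \<in> B (Suc m) \<Longrightarrow> g (w + fscale a u) = a"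
        using coordinate_functional[OF sub(4) 3(3), of "B m"] 3(4) unfolding line_extension_def by blast
      have g0: "z \<in> B (Suc m) \<longleftrightarrow> g z = 0" if z: "z \<in> B m" for z
      proof -
        obtain w a where "z = w + fscale a u" "w \<in> B (Suc m)" using z unfolding 3(4) line_extension_def by blast
        then show ?thesis using g(2)[of w a] g(2)[of z 0] by auto
      qed
      have uB: "u \<in> B m" unfolding 3(4) by (rule line_extension_generator[OF sub(4)])
      have gu: "g u = 1" using g(2)[OF fs.subspace_0[OF sub(4)], of 1] by simp
      obtain x where x: "\<And>j. alive bs j m \<Longrightarrow> x j \<in> Z m"
        "\<And>z. z \<in> Z m \<Longrightarrow> z - (\<Sum>j | alive bs j m. fscale (\<phi> m z j) (x j)) \<in> B m"
        using barcode_dual_basis[OF bar order_refl sub(1)] by metis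
      \<comment> \<open>What is left of \<open>z\<close> after subtracting its expansion in the dual
        basis. It is linear with values in \<open>B m\<close> and the identity there, so
        \<open>g (D z)\<close> extends \<open>g\<close> from \<open>B m\<close> to all of
        \<open>Z m\<close>.\<close>
      define D where "D z = z - (\<Sum>j | alive bs j m. fscale (\<phi> m z j) (x j))" for z
      have D_B: "D z \<in> B m" if "z \<in> Z m" for z using x(2)[OF that] by (simp add: D_def)
      have D_id: "D b = b" if "b \<in> B m" for b
      proof -
        have "\<phi> m b = 0" using ker that B_subset_Z[OF m(1)] by blast
        then show ?thesis by (simp add: D_def zero_fun_apply)
      qed
      have D_add: "D (z + z') = D z + D z'" if "z \<in> Z m" "z' \<in> Z m" for z z'
      proof -
        have "\<phi> m (z + z') = \<phi> m z + \<phi> m z'" using that lin by (simp add: lin_on_def)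
        then have "D (z + z') k = (D z + D z') k" for k
          by (simp add: D_def minus_apply plus_fun_apply fscale_apply sum_fun_apply sum.distrib algebra_simps)
        then show ?thesis by (simp add: fun_eq_iff)
      qed
      have D_scale: "D (fscale a z) = fscale a (D z)" if "z \<in> Z m" for z a
      proof -
        have "\<phi> m (fscale a z) = fscale a (\<phi> m z)" using that lin by (simp add: lin_on_def)
        then have "D (fscale a z) k = fscale a (D z) k" for k
          by (simp add: D_def minus_apply fscale_apply sum_fun_apply sum_distrib_left algebra_simps)
        then show ?thesis by (simp add: fun_eq_iff)
      qed
      let ?bs = "extend_bars bs m {} @ [(Suc m, Suc m)]"
      have al: "alive ?bs j (Suc m) \<longleftrightarrow> alive bs j m \<or> j = length bs" for j
        by (simp add: alive_append ext)
      have al': "alive ?bs j i \<longleftrightarrow> alive bs j i" if "i \<le> m" for i j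
        using that by (simp add: alive_append ext)
      define \<psi> where "\<psi> z = (\<lambda>j. if j = length bs then g (D z) else \<phi> m z j)" for z
      have \<phi>0: "\<phi> m z (length bs) = 0" if "z \<in> Z m" for z
      proof -
        have "\<phi> m z \<in> coord bs m" using im that by blast
        then show ?thesis using not_alive by (auto simp: coord_def)
      qed
      have lin': "lin_on (Z m) \<psi>"
      proof -
        have "functional_on (Z m) (\<lambda>z. \<psi> z j)" for j
          using lin g(1) D_B
          by (cases "j = length bs") (simp_all add: \<psi>_def lin_on_functional functional_on_def D_add D_scale)
        then show ?thesis by (simp add: lin_on_functional)
      qed
      moreover have "\<psi> ` Z m = coord ?bs (Suc m)"
      proof safe
        fix z assume "z \<in> Z m"
        then have "\<phi> m z \<in> coord bs m" using im by blast
        then show "\<psi> z \<in> coord ?bs (Suc m)" by (auto simp: coord_def al \<psi>_def)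
      next
        fix y :: "nat \<Rightarrow> 'f" assume y: "y \<in> coord ?bs (Suc m)"
        then have "y(length bs := 0) \<in> coord bs m" by (auto simp: coord_def al)
        then have "y(length bs := 0) \<in> \<phi> m ` Z m" by (simp only: im)
        then obtain w where w: "w \<in> Z m" "\<phi> m w = y(length bs := 0)" by (auto simp only: image_iff)
        \<comment> \<open>\<open>u\<close> has coordinate 1 on the new bar and 0 on all others, so a
          multiple of it corrects the last coordinate and leaves the rest alone.\<close>
        let ?a = "y (length bs) - g (D w)"
        have au: "fscale ?a u \<in> Z m" using 3(2) by (rule fs.subspace_scale[OF sub(1)])
        have "\<phi> m u = 0" using ker uB 3(2) by blast
        then have "\<psi> u = (\<lambda>j. if j = length bs then 1 else 0)" using D_id[OF uB] gu by (auto simp: \<psi>_def zero_fun_apply)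
        moreover have "\<psi> (w + fscale ?a u) = \<psi> w + fscale ?a (\<psi> u)"
          using lin' w(1) au 3(2) by (simp add: lin_on_def)
        ultimately have "\<psi> (w + fscale ?a u) j = y j" for j
          using w(2) by (cases "j = length bs") (simp_all add: plus_fun_apply fscale_apply \<psi>_def)
        then have "\<psi> (w + fscale ?a u) = y" by (simp add: fun_eq_iff)
        moreover have "w + fscale ?a u \<in> Z m" using w(1) au by (rule fs.subspace_add[OF sub(1)])
        ultimately show "y \<in> \<psi> ` Z m" by (metis imageI)
      qed
      moreover have "\<psi> z = 0 \<longleftrightarrow> z \<in> B (Suc m)" if z: "z \<in> Z m" for z
      proof -
        have "\<psi> z = 0 \<longleftrightarrow> \<phi> m z = 0 \<and> g (D z) = 0"
          using \<phi>0[OF z] unfolding \<psi>_def fun_eq_iff zero_fun_apply by metis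
        also have "\<dots> \<longleftrightarrow> z \<in> B m \<and> g z = 0" using ker[OF z] D_id by auto
        also have "\<dots> \<longleftrightarrow> z \<in> B (Suc m)"
          using g0 line_extension_superset[of "B (Suc m)" u] 3(4) by auto
        finally show ?thesis .
      qed
      ultimately have "coordinates ?bs (Suc m) (Z (Suc m)) (B (Suc m)) \<psi>"
        by (simp add: coordinates_def 3(1))
      moreover have "\<phi> m z = restr ?bs m (\<psi> z)" if "z \<in> Z m" for z
      proof -
        have "\<phi> m z \<in> coord bs m" using im that by blast
        then show ?thesis using not_alive by (auto simp: \<psi>_def restr_def al al' coord_def fun_eq_iff)
      qed
      then have "compatible ?bs m (fwd m) (Z m) (Z (Suc m)) (\<phi> m) \<psi>" using False 3(1) by (simp add: compatible_def)
      ultimately have "barcode Z B fwd (Suc m) ?bs (\<phi>(Suc m := \<psi>))"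
        using al' ext(3)[of "{}"] by (intro barcode_extend[OF bar]) auto
      then show ?thesis by blast
    qed
  qed
qed

end

subsection \<open>Ranks\<close>

text \<open>
  The linear relation between the spaces \<open>i\<close> and \<open>i + k\<close> given by composing the maps of the
  zigzag and their inverses. The number of bars that are alive between \<open>i\<close> and \<open>i + k\<close> is the
  dimension of the domain of this relation modulo its kernel.
\<close>

definition zstep_rel where
  "zstep_rel Z B l = {(x, y). x \<in> Z l \<and> y \<in> Z (Suc l) \<and> x - y \<in> B l \<union> B (Suc l)}"

fun zrel :: "(nat \<Rightarrow> ('x \<Rightarrow> 'f::field) set) \<Rightarrow> (nat \<Rightarrow> ('x \<Rightarrow> 'f) set) \<Rightarrow> nat \<Rightarrow> nat \<Rightarrow> ('x \<Rightarrow> 'f) rel" where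
  "zrel Z B i 0 = {(x, y). x \<in> Z i \<and> y \<in> Z i \<and> x - y \<in> B i}"
| "zrel Z B i (Suc k) = zrel Z B i k O zstep_rel Z B (i + k)"

definition full_bars :: "(nat \<times> nat) list \<Rightarrow> nat \<Rightarrow> nat \<Rightarrow> nat set" where
  "full_bars bs i j = {l. l < length bs \<and> fst (bs ! l) \<le> i \<and> j \<le> snd (bs ! l)}"

context elementary_zigzag
begin

lemma nested:
  assumes "i < n"
  shows "fwd i \<Longrightarrow> Z i \<subseteq> Z (Suc i) \<and> B i \<subseteq> B (Suc i)" "\<not> fwd i \<Longrightarrow> Z (Suc i) \<subseteq> Z i \<and> B (Suc i) \<subseteq> B i"
  using step[OF assms] elementary_mono by (metis (full_types))+

text \<open>The denominators are nested, so the union is the larger one, which belongs to the target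
  of the map. This lets \<open>zstep_rel\<close> use one formula for both directions.\<close>

lemma subspace_B_Un: "i < n \<Longrightarrow> fs.subspace (B i \<union> B (Suc i))"
  using nested[of i] subspace_B[of i] subspace_B[of "Suc i"]
  by (cases "fwd i") (auto simp: Un_absorb1 Un_absorb2)

lemma zrel_Z: "(x, y) \<in> zrel Z B i k \<Longrightarrow> x \<in> Z i \<and> y \<in> Z (i + k)"
  by (induction k arbitrary: y) (auto simp: zstep_rel_def)

lemma zrel_0: "i + k \<le> n \<Longrightarrow> (0, 0) \<in> zrel Z B i k"
proof (induction k)
  case 0
  then show ?case using fs.subspace_0[OF subspace_Z] fs.subspace_0[OF subspace_B] by simp
next
  case (Suc k)
  then have "(0, 0) \<in> zstep_rel Z B (i + k)"
    using fs.subspace_0[OF subspace_Z] fs.subspace_0[OF subspace_B_Un[of "i + k"]]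
    by (simp add: zstep_rel_def)
  then show ?case using Suc by auto
qed

lemma zrel_add:
  assumes "(x, x') \<in> zrel Z B i k" "(y, y') \<in> zrel Z B i k" "i + k \<le> n"
  shows "(x + y, x' + y') \<in> zrel Z B i k"
  using assms
proof (induction k arbitrary: x' y')
  case 0
  have "(x - x') + (y - y') \<in> B i"
    using 0 fs.subspace_add[OF subspace_B[of i]] by simp
  moreover have "(x - x') + (y - y') = (x + y) - (x' + y')" by simp
  ultimately show ?case using 0 fs.subspace_add[OF subspace_Z[of i]] by simp
next
  case (Suc k)
  obtain u v where u: "(x, u) \<in> zrel Z B i k" "(u, x') \<in> zstep_rel Z B (i + k)"
    and v: "(y, v) \<in> zrel Z B i k" "(v, y') \<in> zstep_rel Z B (i + k)"
    using Suc.prems(1,2) by auto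
  have "(u - x') + (v - y') \<in> B (i + k) \<union> B (Suc (i + k))"
    using u(2) v(2) Suc.prems(3) fs.subspace_add[OF subspace_B_Un[of "i + k"]] by (simp add: zstep_rel_def)
  moreover have "(u - x') + (v - y') = (u + v) - (x' + y')" by simp
  ultimately have "(u + v, x' + y') \<in> zstep_rel Z B (i + k)"
    using u(2) v(2) Suc.prems(3) fs.subspace_add[OF subspace_Z[of "i + k"]]
      fs.subspace_add[OF subspace_Z[of "Suc (i + k)"]]
    by (simp add: zstep_rel_def)
  moreover have "(x + y, u + v) \<in> zrel Z B i k" using Suc u(1) v(1) by simp
  ultimately show ?case by auto
qed

lemma zrel_scale:
  assumes "(x, x') \<in> zrel Z B i k" "i + k \<le> n"
  shows "(fscale a x, fscale a x') \<in> zrel Z B i k"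
  using assms
proof (induction k arbitrary: x')
  case 0
  have "fscale a (x - x') \<in> B i" using 0 fs.subspace_scale[OF subspace_B[of i]] by simp
  then show ?case using 0 fs.subspace_scale[OF subspace_Z[of i]] by (simp add: fs.scale_right_diff_distrib)
next
  case (Suc k)
  obtain u where u: "(x, u) \<in> zrel Z B i k" "(u, x') \<in> zstep_rel Z B (i + k)"
    using Suc.prems(1) by auto
  have "fscale a (u - x') \<in> B (i + k) \<union> B (Suc (i + k))"
    using u(2) Suc.prems(2) fs.subspace_scale[OF subspace_B_Un[of "i + k"]] by (simp add: zstep_rel_def)
  then have "(fscale a u, fscale a x') \<in> zstep_rel Z B (i + k)"
    using u(2) Suc.prems(2) fs.subspace_scale[OF subspace_Z[of "i + k"]]
      fs.subspace_scale[OF subspace_Z[of "Suc (i + k)"]]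
    by (simp add: zstep_rel_def fs.scale_right_diff_distrib)
  moreover have "(fscale a x, fscale a u) \<in> zrel Z B i k" using Suc u(1) by simp
  ultimately show ?case by auto
qed

lemma zrel_sum:
  assumes "finite A" "\<And>l. l \<in> A \<Longrightarrow> (x l, x' l) \<in> zrel Z B i k" "i + k \<le> n"
  shows "((\<Sum>l\<in>A. fscale (a l) (x l)), (\<Sum>l\<in>A. fscale (a l) (x' l))) \<in> zrel Z B i k"
  using assms
proof (induction A)
  case empty
  then show ?case using zrel_0 by simp
next
  case (insert l A)
  then show ?case using zrel_add[OF zrel_scale, of "x l" "x' l" i k] by simp
qed

text \<open>Apart from associativity this rests on the empty composite, which is equality of classes
  and not of representatives: a change of representative at the junction has to be absorbed by the
  last step.\<close>

lemma zrel_compose: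
  assumes "i + k + l \<le> n"
  shows "zrel Z B i (k + l) = zrel Z B i k O zrel Z B (i + k) l"
  using assms
proof (induction l)
  case 0
  have "zrel Z B i k O zrel Z B (i + k) 0 \<subseteq> zrel Z B i k"
  proof (cases k)
    case 0
    have "x - z \<in> B i" if "x - y \<in> B i" "y - z \<in> B i" for x y z
      using fs.subspace_add[OF subspace_B that] assms 0 by simp
    then show ?thesis using 0 by auto
  next
    case (Suc k')
    have "x - z \<in> B (i + k') \<union> B (Suc (i + k'))"
      if "x - y \<in> B (i + k') \<union> B (Suc (i + k'))" "y - z \<in> B (Suc (i + k'))" for x y z
    proof -
      have "(x - y) + (y - z) \<in> B (i + k') \<union> B (Suc (i + k'))"
        using that assms Suc by (intro fs.subspace_add[OF subspace_B_Un]) auto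
      then show ?thesis by simp
    qed
    then show ?thesis using Suc by (auto simp: zstep_rel_def)
  qed
  moreover have "zrel Z B i k \<subseteq> zrel Z B i k O zrel Z B (i + k) 0"
  proof safe
    fix x y assume *: "(x, y) \<in> zrel Z B i k"
    have "(y, y) \<in> zrel Z B (i + k) 0"
      using zrel_Z[OF *] fs.subspace_0[OF subspace_B[of "i + k"]] assms by simp
    with * show "(x, y) \<in> zrel Z B i k O zrel Z B (i + k) 0" by blast
  qed
  ultimately show ?case by auto
next
  case (Suc l)
  then show ?case by (simp add: O_assoc add.assoc)
qed

section \<open>Transport of bar coordinates along the composite relation\<close>

context
  fixes bs \<phi> assumes bar: "barcode Z B fwd n bs \<phi>"
begin

lemma coordinates_bar:
  assumes "i \<le> n"
  shows "lin_on (Z i) (\<phi> i)" "\<phi> i ` Z i = coord bs i" "z \<in> Z i \<Longrightarrow> \<phi> i z = 0 \<longleftrightarrow> z \<in> B i"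
  using bar assms by (auto simp: barcode_def coordinates_def)

lemma coordinates_alive:
  assumes "i \<le> n" "z \<in> Z i" "\<phi> i z j \<noteq> 0"
  shows "alive bs j i"
proof -
  have "\<phi> i z \<in> coord bs i" using coordinates_bar(2)[OF assms(1)] assms(2) by blast
  then show ?thesis using assms(3) by (auto simp: coord_def)
qed

lemma coordinates_diff:
  assumes "i \<le> n" "x \<in> Z i" "y \<in> Z i"
  shows "x - y \<in> B i \<longleftrightarrow> \<phi> i x = \<phi> i y"
  using coordinates_bar(3)[OF assms(1) fs.subspace_diff[OF subspace_Z[OF assms(1)] assms(2,3)]]
    lin_on_diff[OF coordinates_bar(1)[OF assms(1)] subspace_Z[OF assms(1)] assms(2,3)]
  by simp

lemma coordinates_surj:
  assumes "i \<le> n" "\<And>j. y j \<noteq> 0 \<Longrightarrow> alive bs j i"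
  obtains z where "z \<in> Z i" "\<phi> i z = y"
proof -
  have "y \<in> \<phi> i ` Z i" using assms by (simp add: coordinates_bar(2) coord_def)
  then show ?thesis using that by blast
qed

lemma zstep_rel_coordinates:
  assumes "l < n" "x \<in> Z l" "y \<in> Z (Suc l)"
  shows "(x, y) \<in> zstep_rel Z B l \<longleftrightarrow>
    (if fwd l then \<phi> (Suc l) y = restr bs l (\<phi> l x) else \<phi> l x = restr bs l (\<phi> (Suc l) y))"
proof -
  have comp: "compatible bs l (fwd l) (Z l) (Z (Suc l)) (\<phi> l) (\<phi> (Suc l))"
    using bar assms(1) by (simp add: barcode_def)
  show ?thesis
  proof (cases "fwd l")
    case True
    then have n: "Z l \<subseteq> Z (Suc l)" "B l \<subseteq> B (Suc l)" using nested[OF assms(1)] by auto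
    have "x \<in> Z (Suc l)" using n assms(2) by auto
    then have "x - y \<in> B (Suc l) \<longleftrightarrow> \<phi> (Suc l) x = \<phi> (Suc l) y"
      using assms by (intro coordinates_diff) auto
    moreover have "\<phi> (Suc l) x = restr bs l (\<phi> l x)" using comp True assms(2) by (simp add: compatible_def)
    ultimately show ?thesis using True n assms by (auto simp: zstep_rel_def)
  next
    case False
    then have n: "Z (Suc l) \<subseteq> Z l" "B (Suc l) \<subseteq> B l" using nested[OF assms(1)] by auto
    have "y \<in> Z l" using n assms(3) by auto
    then have "x - y \<in> B l \<longleftrightarrow> \<phi> l x = \<phi> l y"
      using assms by (intro coordinates_diff) auto
    moreover have "\<phi> l y = restr bs l (\<phi> (Suc l) y)" using comp False assms(3) by (simp add: compatible_def)
    ultimately show ?thesis using False n assms by (auto simp: zstep_rel_def)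
  qed
qed

text \<open>One step preserves the coordinate of every bar that is alive at both of its ends,
  whichever way the map goes.\<close>

lemma zrel_full_bars:
  assumes "(x, y) \<in> zrel Z B i k" "i + k \<le> n" "j \<in> full_bars bs i (i + k)"
  shows "\<phi> i x j = \<phi> (i + k) y j"
  using assms
proof (induction k arbitrary: y)
  case 0
  then show ?case using coordinates_diff[of i x y] by simp
next
  case (Suc k)
  obtain u where u: "(x, u) \<in> zrel Z B i k" "(u, y) \<in> zstep_rel Z B (i + k)"
    using Suc.prems(1) by auto
  have "u \<in> Z (i + k)" "y \<in> Z (Suc (i + k))" using u(2) by (auto simp: zstep_rel_def)
  then have "if fwd (i + k) then \<phi> (Suc (i + k)) y = restr bs (i + k) (\<phi> (i + k) u)
      else \<phi> (i + k) u = restr bs (i + k) (\<phi> (Suc (i + k)) y)"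
    using zstep_rel_coordinates[of "i + k" u y] u(2) Suc.prems(2) by simp
  moreover have "alive bs j (i + k)" "alive bs j (Suc (i + k))"
    using Suc.prems(3) by (auto simp: full_bars_def alive_def)
  ultimately have "\<phi> (i + k) u j = \<phi> (Suc (i + k)) y j" by (simp add: restr_def split: if_splits)
  moreover have "j \<in> full_bars bs i (i + k)" using Suc.prems(3) by (auto simp: full_bars_def)
  ultimately show ?case using Suc.IH[OF u(1)] Suc.prems(2) by simp
qed

text \<open>Masking by a condition on the birth commutes with \<open>restr\<close>. The coordinates
  of all bars born after \<open>i\<close> can therefore be set to zero along the whole path, and at
  the start this changes nothing.\<close>

lemma zrel_kill_later:
  assumes "(x, y) \<in> zrel Z B i k" "i + k \<le> n" "y' \<in> Z (i + k)"
    "\<phi> (i + k) y' = (\<lambda>j. if fst (bs ! j) \<le> i then \<phi> (i + k) y j else 0)"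
  shows "(x, y') \<in> zrel Z B i k"
  using assms
proof (induction k arbitrary: y y')
  case 0
  then have xy: "x \<in> Z i" "y \<in> Z i" "\<phi> i x = \<phi> i y" using coordinates_diff[of i x y] by auto
  have "\<phi> i y j = 0" if "\<not> fst (bs ! j) \<le> i" for j
    using coordinates_alive[of i y j] that 0 xy by (auto simp: alive_def)
  then have "\<phi> i y' = \<phi> i y" using 0(4) by (auto simp: fun_eq_iff)
  then show ?case using coordinates_diff[of i x y'] xy 0 by simp
next
  case (Suc k)
  obtain u where u: "(x, u) \<in> zrel Z B i k" "(u, y) \<in> zstep_rel Z B (i + k)"
    using Suc.prems(1) by auto
  have uZ: "u \<in> Z (i + k)" "y \<in> Z (Suc (i + k))" using u(2) by (auto simp: zstep_rel_def)
  have "alive bs j (i + k)" if "(if fst (bs ! j) \<le> i then \<phi> (i + k) u j else 0) \<noteq> 0" for j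
    using coordinates_alive[of "i + k" u j] uZ(1) Suc.prems(2) that by (auto split: if_splits)
  then obtain u' where u': "u' \<in> Z (i + k)" "\<phi> (i + k) u' = (\<lambda>j. if fst (bs ! j) \<le> i then \<phi> (i + k) u j else 0)"
    using coordinates_surj[of "i + k" "\<lambda>j. if fst (bs ! j) \<le> i then \<phi> (i + k) u j else 0"] Suc.prems(2)
    by (metis (no_types, lifting) Suc_leD add_Suc_right)
  have mask: "restr bs l (\<lambda>j. if P j then a j else 0) = (\<lambda>j. if P j then restr bs l a j else 0)" for l P and a :: "nat \<Rightarrow> 'f"
    by (simp add: restr_def fun_eq_iff)
  have "if fwd (i + k) then \<phi> (Suc (i + k)) y = restr bs (i + k) (\<phi> (i + k) u)
      else \<phi> (i + k) u = restr bs (i + k) (\<phi> (Suc (i + k)) y)"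
    using zstep_rel_coordinates[of "i + k" u y] uZ u(2) Suc.prems(2) by simp
  then have "if fwd (i + k) then \<phi> (Suc (i + k)) y' = restr bs (i + k) (\<phi> (i + k) u')
      else \<phi> (i + k) u' = restr bs (i + k) (\<phi> (Suc (i + k)) y')"
    using Suc.prems(4) u'(2) unfolding add_Suc_right by (simp add: mask split: if_splits cong: if_cong)
  then have "(u', y') \<in> zstep_rel Z B (i + k)"
    using zstep_rel_coordinates[of "i + k" u' y'] u'(1) Suc.prems(2,3) by simp
  moreover have "(x, u') \<in> zrel Z B i k" using Suc.IH[OF u(1) _ u'] Suc.prems(2) by simp
  ultimately show ?case by auto
qed

text \<open>A vector supported on bars that span the whole range is fixed by \<open>restr\<close> at
  every step and can be carried along unchanged.\<close>

lemma zrel_realize: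
  assumes "i + k \<le> n" "\<And>j. y j \<noteq> 0 \<Longrightarrow> j \<in> full_bars bs i (i + k)"
    "x \<in> Z i" "x' \<in> Z (i + k)" "\<phi> i x = y" "\<phi> (i + k) x' = y"
  shows "(x, x') \<in> zrel Z B i k"
  using assms
proof (induction k arbitrary: x')
  case 0
  then show ?case using coordinates_diff[of i x x'] by simp
next
  case (Suc k)
  have full: "j \<in> full_bars bs i (i + k)" "alive bs j (i + k)" "alive bs j (Suc (i + k))" if "y j \<noteq> 0" for j
    using Suc.prems(2)[OF that] by (auto simp: full_bars_def alive_def)
  obtain u where u: "u \<in> Z (i + k)" "\<phi> (i + k) u = y"
    using coordinates_surj[of "i + k" y] full(2) Suc.prems(1) by auto
  have "restr bs (i + k) y = y" using full by (auto simp: restr_def fun_eq_iff)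
  then have "(u, x') \<in> zstep_rel Z B (i + k)"
    using zstep_rel_coordinates[of "i + k" u x'] u Suc.prems by simp
  moreover have "(x, u) \<in> zrel Z B i k" using Suc full(1) u by simp
  ultimately show ?case by auto
qed

text \<open>A bar alive at the end either spans the range, and then its coordinate is zero by
  conservation, or is born later, and then it can be masked.\<close>

lemma zrel_kernel:
  assumes "(x, y) \<in> zrel Z B i k" "i + k \<le> n" "\<And>j. j \<in> full_bars bs i (i + k) \<Longrightarrow> \<phi> i x j = 0"
  shows "(x, 0) \<in> zrel Z B i k"
proof (rule zrel_kill_later[OF assms(1,2)])
  show Z0: "0 \<in> Z (i + k)" using fs.subspace_0[OF subspace_Z[OF assms(2)]] .
  have "\<phi> (i + k) 0 = 0" using coordinates_bar(1) lin_on_0 subspace_Z assms(2) by blast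
  moreover have "\<phi> (i + k) y j = 0" if "fst (bs ! j) \<le> i" for j
  proof (rule ccontr)
    assume "\<phi> (i + k) y j \<noteq> 0"
    moreover from this have "alive bs j (i + k)"
      using coordinates_alive[OF assms(2)] zrel_Z[OF assms(1)] by blast
    then have "j \<in> full_bars bs i (i + k)" using that by (simp add: alive_def full_bars_def)
    ultimately show False using assms(3) zrel_full_bars[OF assms(1,2)] by metis
  qed
  ultimately show "\<phi> (i + k) 0 = (\<lambda>j. if fst (bs ! j) \<le> i then \<phi> (i + k) y j else 0)"
    by (simp add: fun_eq_iff zero_fun_apply)
qed

end

end

section \<open>The composite relations determine the bars\<close>

lemma card_le_independent_family:
  fixes \<psi> :: "'i \<Rightarrow> 'x \<Rightarrow> 'f::field"
  assumes fin: "finite F" "finite G" and supp: "\<And>l m. l \<in> F \<Longrightarrow> m \<notin> G \<Longrightarrow> \<psi> l m = 0"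
    and ind: "\<And>a l. (\<Sum>l\<in>F. fscale (a l) (\<psi> l)) = 0 \<Longrightarrow> l \<in> F \<Longrightarrow> a l = 0"
  shows "card F \<le> card G"
proof -
  define e :: "'x \<Rightarrow> 'x \<Rightarrow> 'f" where "e m = (\<lambda>k. if k = m then 1 else 0)" for m
  have inj: "inj_on \<psi> F"
  proof (rule inj_onI, rule ccontr)
    fix l l' assume l: "l \<in> F" "l' \<in> F" "\<psi> l = \<psi> l'" "l \<noteq> l'"
    \<comment> \<open>Coefficients of a linear relation between two equal members of the family; it
      contradicts \<open>ind\<close>, so the family is injective and may be treated as a
      set.\<close>
    define a :: "'i \<Rightarrow> 'f" where "a k = (if k = l then 1 else if k = l' then - 1 else 0)" for k
    have "(\<Sum>k\<in>F. fscale (a k) (\<psi> k)) = (\<Sum>k\<in>{l, l'}. fscale (a k) (\<psi> k))"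
      using l fin by (intro sum.mono_neutral_right) (auto simp: a_def)
    also have "\<dots> = 0" using l by (simp add: a_def)
    finally have "a l = 0" using ind l(1) by blast
    then show False by (simp add: a_def)
  qed
  have "fs.independent (\<psi> ` F)"
  proof (rule fs.independent_if_scalars_zero)
    fix f x assume "(\<Sum>x\<in>\<psi> ` F. fscale (f x) x) = 0" "x \<in> \<psi> ` F"
    then obtain l where l: "l \<in> F" "x = \<psi> l" "(\<Sum>l\<in>F. fscale (f (\<psi> l)) (\<psi> l)) = 0"
      using inj by (auto simp: sum.reindex)
    show "f x = 0" using ind[OF l(3,1)] l(2) by simp
  qed (use fin in simp)
  moreover have "\<psi> ` F \<subseteq> fs.span (e ` G)"
  proof safe
    fix l assume l: "l \<in> F"
    have "\<psi> l = (\<Sum>m\<in>G. fscale (\<psi> l m) (e m))"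
    proof
      fix k
      have "(\<Sum>m\<in>G. fscale (\<psi> l m) (e m)) k = (\<Sum>m\<in>G. if m = k then \<psi> l m else 0)"
        by (simp add: sum_fun_apply fscale_apply e_def if_distrib eq_commute[of k] cong: if_cong)
      also have "\<dots> = \<psi> l k" using fin supp[OF l] by (simp add: sum.delta)
      finally show "\<psi> l k = (\<Sum>m\<in>G. fscale (\<psi> l m) (e m)) k" by simp
    qed
    moreover have "\<dots> \<in> fs.span (e ` G)"
      by (intro fs.span_sum fs.span_scale fs.span_base) blast
    ultimately show "\<psi> l \<in> fs.span (e ` G)" by metis
  qed
  ultimately have "card (\<psi> ` F) \<le> card (e ` G)"
    using fs.independent_span_bound[of "e ` G"] fin by blast
  then show ?thesis using card_image[OF inj] card_image_le[OF fin(2), of e] by simp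
qed

lemma finite_full_bars [simp]: "finite (full_bars bs i j)"
  by (simp add: full_bars_def)

text \<open>The classes dual to the spanning bars of one zigzag are tested on the spanning
  coordinates of the other. A combination with zero coordinates there is related to 0, hence also in
  the first zigzag, and conservation of coordinates makes its coefficients vanish. The two zigzags
  share only the relation: lengths, indices and the spaces in between may differ.\<close>

lemma card_full_bars_le:
  fixes Z B Z' B' :: "nat \<Rightarrow> ('x \<Rightarrow> 'f::field) set"
  assumes "elementary_zigzag Z B fwd n" "elementary_zigzag Z' B' fwd' n'"
    and bar: "barcode Z B fwd n bs \<phi>" and bar': "barcode Z' B' fwd' n' bs' \<phi>'"
    and le: "i + k \<le> n" "i' + k' \<le> n'" and eq: "zrel Z B i k = zrel Z' B' i' k'"
  shows "card (full_bars bs i (i + k)) \<le> card (full_bars bs' i' (i' + k'))"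
proof -
  interpret z: elementary_zigzag Z B fwd n by fact
  interpret z': elementary_zigzag Z' B' fwd' n' by fact
  let ?F = "full_bars bs i (i + k)" and ?F' = "full_bars bs' i' (i' + k')"
  have "\<exists>x x'. (x, x') \<in> zrel Z B i k \<and> \<phi> i x = (\<lambda>m. if m = l then 1 else 0)" if l: "l \<in> ?F" for l
  proof -
    let ?y = "\<lambda>m. if m = l then 1 else (0::'f)"
    have "alive bs l i" "alive bs l (i + k)" using l by (auto simp: full_bars_def alive_def)
    then have al: "\<And>j. ?y j \<noteq> 0 \<Longrightarrow> alive bs j i" "\<And>j. ?y j \<noteq> 0 \<Longrightarrow> alive bs j (i + k)"
      by (simp_all split: if_splits)
    have "i \<le> n" using le by simp
    obtain x where x1: "x \<in> Z i" "\<phi> i x = ?y"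
      using z.coordinates_surj[OF bar \<open>i \<le> n\<close>, of ?y] al(1) by blast
    obtain x' where x2: "x' \<in> Z (i + k)" "\<phi> (i + k) x' = ?y"
      using z.coordinates_surj[OF bar le(1), of ?y] al(2) by blast
    note x = x1 x2
    have "(x, x') \<in> zrel Z B i k"
      using l x by (intro z.zrel_realize[OF bar le(1), of ?y]) (auto split: if_splits)
    then show ?thesis using x by blast
  qed
  then obtain x x' where x: "\<And>l. l \<in> ?F \<Longrightarrow> (x l, x' l) \<in> zrel Z B i k"
    "\<And>l. l \<in> ?F \<Longrightarrow> \<phi> i (x l) = (\<lambda>m. if m = l then 1 else 0)" by metis
  have xZ: "x l \<in> Z i" "x l \<in> Z' i'" if "l \<in> ?F" for l
    using z.zrel_Z[OF x(1)[OF that]] z'.zrel_Z[of "x l" "x' l" i' k'] x(1)[OF that] eq by auto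
  show ?thesis
  proof (rule card_le_independent_family[where \<psi> = "\<lambda>l m. if m \<in> ?F' then \<phi>' i' (x l) m else 0"])
    fix a l assume *: "(\<Sum>l\<in>?F. fscale (a l) (\<lambda>m. if m \<in> ?F' then \<phi>' i' (x l) m else 0)) = 0" and l: "l \<in> ?F"
    let ?x = "\<Sum>l\<in>?F. fscale (a l) (x l)"
    have r: "(?x, (\<Sum>l\<in>?F. fscale (a l) (x' l))) \<in> zrel Z B i k"
      using x(1) le by (intro z.zrel_sum) auto
    have "\<phi>' i' ?x m = 0" if m: "m \<in> ?F'" for m
    proof -
      have f: "functional_on (Z' i') (\<lambda>z. \<phi>' i' z m)"
        using z'.coordinates_bar(1)[OF bar', of i'] le by (simp add: lin_on_functional)
      have "\<phi>' i' ?x m = (\<Sum>l\<in>?F. a l * \<phi>' i' (x l) m)"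
        using functional_on_sum[OF f z'.subspace_Z, of ?F x a] xZ le by simp
      also have "\<dots> = (\<Sum>l\<in>?F. fscale (a l) (\<lambda>m. if m \<in> ?F' then \<phi>' i' (x l) m else 0)) m"
        using m by (simp add: sum_fun_apply fscale_apply)
      finally show ?thesis by (simp add: * zero_fun_apply)
    qed
    then have "(?x, 0) \<in> zrel Z' B' i' k'" using r le eq by (intro z'.zrel_kernel[OF bar']) auto
    then have "\<phi> i ?x l = \<phi> (i + k) 0 l" using z.zrel_full_bars[OF bar _ le(1) l] eq by blast
    also have "\<dots> = 0"
      using z.coordinates_bar(1)[OF bar le(1)] lin_on_0 z.subspace_Z[OF le(1)] by (metis zero_fun_apply)
    also have "\<phi> i ?x l = (\<Sum>m\<in>?F. a m * \<phi> i (x m) l)"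
    proof -
      have f: "functional_on (Z i) (\<lambda>z. \<phi> i z l)"
        using z.coordinates_bar(1)[OF bar, of i] le by (simp add: lin_on_functional)
      show ?thesis using functional_on_sum[OF f z.subspace_Z, of ?F x a] xZ le by simp
    qed
    also have "\<dots> = (\<Sum>m\<in>?F. if m = l then a m else 0)"
      by (rule sum.cong) (auto simp: x(2))
    also have "\<dots> = a l" using l by (simp add: sum.delta)
    finally show "a l = 0" .
  qed simp_all
qed

lemma card_full_bars_eq:
  assumes "elementary_zigzag Z B fwd n" "elementary_zigzag Z' B' fwd' n'"
    "barcode Z B fwd n bs \<phi>" "barcode Z' B' fwd' n' bs' \<phi>'"
    "i + k \<le> n" "i' + k' \<le> n'" "zrel Z B i k = zrel Z' B' i' k'"
  shows "card (full_bars bs i (i + k)) = card (full_bars bs' i' (i' + k'))"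
  using card_full_bars_le[OF assms] card_full_bars_le[OF assms(2,1,4,3,6,5) assms(7)[symmetric]] by simp

text \<open>Inclusion-exclusion for a box cut out by nested quadrants, written additively to stay
  within the natural numbers.\<close>

lemma size_filter_rectangle:
  assumes "\<And>x. P' x \<Longrightarrow> P x" "\<And>x. Q' x \<Longrightarrow> Q x"
  shows "size {#x\<in>#M. (P x \<and> \<not> P' x) \<and> (Q x \<and> \<not> Q' x)#} + size {#x\<in>#M. P' x \<and> Q x#} + size {#x\<in>#M. P x \<and> Q' x#}
    = size {#x\<in>#M. P x \<and> Q x#} + size {#x\<in>#M. P' x \<and> Q' x#}"
proof (induction M)
  case (add x M)
  then show ?case
    using assms(1)[of x] assms(2)[of x] by (cases "P x"; cases "P' x"; cases "Q x"; cases "Q' x") simp_all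
qed simp

lemma card_full_bars: "card (full_bars bs i j) = size {#bd\<in>#mset bs. fst bd \<le> i \<and> j \<le> snd bd#}"
proof -
  have "size {#bd\<in>#mset bs. fst bd \<le> i \<and> j \<le> snd bd#} = length (filter (\<lambda>bd. fst bd \<le> i \<and> j \<le> snd bd) bs)"
    by (simp flip: mset_filter)
  then show ?thesis by (simp add: length_filter_conv_card full_bars_def)
qed

text \<open>The multiplicity of a bar from \<open>b\<close> to \<open>d\<close> is the alternating
  sum of the ranks between \<open>b - 1\<close> or \<open>b\<close> and \<open>d\<close> or
  \<open>d + 1\<close>, and ranks depend only on the zigzag. The bounds on the bars keep these
  indices between 0 and \<open>n\<close>.\<close>

lemma barcode_unique:
  assumes z: "elementary_zigzag Z B fwd n" and bar: "barcode Z B fwd n bs \<phi>" "barcode Z B fwd n bs' \<phi>'"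
    and bd: "\<forall>(b, d)\<in>set bs. 1 \<le> b \<and> d < n" "\<forall>(b, d)\<in>set bs'. 1 \<le> b \<and> d < n"
  shows "mset bs = mset bs'"
proof (rule multiset_eqI)
  fix bd :: "nat \<times> nat"
  obtain b d where bd': "bd = (b, d)" by fastforce
  show "count (mset bs) bd = count (mset bs') bd"
  proof (cases "1 \<le> b \<and> b \<le> d \<and> d < n")
    case False
    have "bd \<notin> set bs" "bd \<notin> set bs'" using False bd bar by (auto simp: bd' barcode_def)
    then show ?thesis by (metis count_mset_0_iff)
  next
    case True
    have eq: "size {#bd\<in>#mset bs. fst bd \<le> i \<and> j \<le> snd bd#} = size {#bd\<in>#mset bs'. fst bd \<le> i \<and> j \<le> snd bd#}"
      if "i \<le> j" "j \<le> n" for i j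
      using card_full_bars_eq[OF z z bar, of i "j - i" i "j - i"] that by (simp add: card_full_bars)
    have c: "count M bd + size {#x\<in>#M. fst x \<le> b - 1 \<and> d \<le> snd x#} + size {#x\<in>#M. fst x \<le> b \<and> d + 1 \<le> snd x#}
      = size {#x\<in>#M. fst x \<le> b \<and> d \<le> snd x#} + size {#x\<in>#M. fst x \<le> b - 1 \<and> d + 1 \<le> snd x#}" for M
    proof -
      have "{#x\<in>#M. (fst x \<le> b \<and> \<not> fst x \<le> b - 1) \<and> (d \<le> snd x \<and> \<not> d + 1 \<le> snd x)#} = {#x\<in>#M. x = bd#}"
        using True by (intro filter_mset_cong) (auto simp: bd')
      then have "count M bd = size {#x\<in>#M. (fst x \<le> b \<and> \<not> fst x \<le> b - 1) \<and> (d \<le> snd x \<and> \<not> d + 1 \<le> snd x)#}"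
        by (simp add: filter_eq_replicate_mset)
      then show ?thesis
        using size_filter_rectangle[of "\<lambda>x. fst x \<le> b - 1" "\<lambda>x. fst x \<le> b" "\<lambda>x. d + 1 \<le> snd x" "\<lambda>x. d \<le> snd x" M]
        by auto
    qed
    show ?thesis
    proof -
      have "b - 1 \<le> d" "b \<le> d + 1" "b \<le> d" "b - 1 \<le> d + 1" "d \<le> n" "d + 1 \<le> n" using True by auto
      note eq[OF this(1,5)] eq[OF this(2,6)] eq[OF this(3,5)] eq[OF this(4,6)]
      then show ?thesis using c[of "mset bs"] c[of "mset bs'"] by linarith
    qed
  qed
qed

section \<open>Chains, cycles and boundaries\<close>

abbreviation face_sign :: "'v set \<Rightarrow> 'v \<Rightarrow> 'f::field" where
  "face_sign \<tau> v \<equiv> (-1) ^ card {u \<in> \<tau>. (u, v) \<in> vertex_order}"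

text \<open>An index set that does not depend on the chain makes linearity visible. The vertex type
  may be infinite, so a finite set \<open>V\<close> carrying the support has to be supplied.\<close>

lemma boundary_eq_sum:
  assumes "finite V" "\<And>\<sigma>. c \<sigma> \<noteq> 0 \<Longrightarrow> \<sigma> \<subseteq> V"
  shows "boundary c \<tau> = (if \<tau> = {} then 0 else \<Sum>v\<in>V - \<tau>. face_sign \<tau> v * c (insert v \<tau>))"
proof -
  have "(\<Sum>v | v \<notin> \<tau> \<and> c (insert v \<tau>) \<noteq> 0. face_sign \<tau> v * c (insert v \<tau>)) =
      (\<Sum>v\<in>V - \<tau>. face_sign \<tau> v * c (insert v \<tau>))"
    using assms by (intro sum.mono_neutral_left) auto
  then show ?thesis by (simp add: boundary_def)
qed

lemma boundary_nonzero:
  assumes "boundary c \<tau> \<noteq> 0"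
  shows "\<tau> \<noteq> {}" "\<exists>v. v \<notin> \<tau> \<and> c (insert v \<tau>) \<noteq> 0"
proof -
  show "\<tau> \<noteq> {}" using assms by (auto simp: boundary_def)
  show "\<exists>v. v \<notin> \<tau> \<and> c (insert v \<tau>) \<noteq> 0"
  proof (rule ccontr)
    assume "\<not> ?thesis"
    then have *: "{v. v \<notin> \<tau> \<and> c (insert v \<tau>) \<noteq> 0} = {}" by blast
    have "boundary c \<tau> = 0" unfolding boundary_def * by simp
    then show False using assms by simp
  qed
qed

lemma boundary_supported:
  assumes "boundary c \<tau> \<noteq> 0" "\<And>\<sigma>. c \<sigma> \<noteq> 0 \<Longrightarrow> \<sigma> \<subseteq> V"
  shows "\<tau> \<subseteq> V"
  using boundary_nonzero(2)[OF assms(1)] assms(2) by blast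

text \<open>The terms for (\<open>v\<close>, \<open>u\<close>) and (\<open>u\<close>,
  \<open>v\<close>) cancel. With \<open>v\<close> below \<open>u\<close>, inserting \<open>u\<close>
  leaves the position of \<open>v\<close> unchanged while inserting \<open>v\<close> raises the
  position of \<open>u\<close> by one, so the products of signs are opposite.\<close>

lemma boundary_boundary:
  assumes V: "finite V" "\<And>\<sigma>. c \<sigma> \<noteq> 0 \<Longrightarrow> \<sigma> \<subseteq> V"
  shows "boundary (boundary c) = (0 :: ('v, 'f::field) chain)"
proof
  fix \<rho> :: "'v set"
  let ?R = "vertex_order :: 'v rel"
  have lin: "linear_order ?R" by (rule linear_order_vertex_order)
  have sup: "\<And>\<sigma>. boundary c \<sigma> \<noteq> 0 \<Longrightarrow> \<sigma> \<subseteq> V" using boundary_supported V(2) by blast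
  show "boundary (boundary c) \<rho> = 0 \<rho>"
  proof (cases "\<rho> = {} \<or> \<not> \<rho> \<subseteq> V")
    case True
    then show ?thesis
    proof
      assume "\<not> \<rho> \<subseteq> V"
      then show ?thesis using boundary_supported[where c = "boundary c" and \<tau> = \<rho> and V = V] sup by (auto simp: zero_fun_apply)
    qed (simp add: boundary_def zero_fun_apply)
  next
    case False
    then have \<rho>: "\<rho> \<noteq> {}" "\<rho> \<subseteq> V" "finite \<rho>" using V(1) finite_subset by auto
    define W where "W = V - \<rho>"
    have finW: "finite W" using V(1) by (simp add: W_def)
    define a :: "'v \<times> 'v \<Rightarrow> 'f" where
      "a = (\<lambda>(v, u). face_sign \<rho> v * (face_sign (insert v \<rho>) u * c (insert u (insert v \<rho>))))"
    have "boundary (boundary c) \<rho> = (\<Sum>v\<in>W. face_sign \<rho> v * boundary c (insert v \<rho>))"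
      using boundary_eq_sum[where c = "boundary c" and \<tau> = \<rho>, OF V(1) sup] \<rho> by (simp add: W_def)
    also have "\<dots> = (\<Sum>v\<in>W. \<Sum>u\<in>W - {v}. a (v, u))"
    proof (rule sum.cong)
      fix v assume "v \<in> W"
      have "V - insert v \<rho> = W - {v}" by (auto simp: W_def)
      then show "face_sign \<rho> v * boundary c (insert v \<rho>) = (\<Sum>u\<in>W - {v}. a (v, u))"
        using boundary_eq_sum[where c = c and \<tau> = "insert v \<rho>", OF V] by (simp add: a_def sum_distrib_left)
    qed simp
    also have "\<dots> = (\<Sum>vu\<in>(SIGMA v:W. W - {v}). a vu)"
      using finW by (subst sum.Sigma) auto
    also have "(SIGMA v:W. W - {v}) = {(v, u). v \<in> W \<and> u \<in> W \<and> v \<noteq> u \<and> (v, u) \<in> ?R} \<union>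
        {(v, u). v \<in> W \<and> u \<in> W \<and> v \<noteq> u \<and> (u, v) \<in> ?R}" (is "_ = ?P \<union> ?Q")
      using lin by (auto simp: linear_order_on_def total_on_def)
    also have "sum a (?P \<union> ?Q) = sum a ?P + sum a ?Q"
    proof (rule sum.union_disjoint)
      show "finite ?P" "finite ?Q" using finW by (auto intro: finite_subset[of _ "W \<times> W"])
      show "?P \<inter> ?Q = {}"
        using lin by (auto simp: linear_order_on_def partial_order_on_def antisym_def)
    qed
    also have "sum a ?Q = (\<Sum>(v, u)\<in>?P. a (u, v))"
      by (rule sum.reindex_bij_witness[of _ "\<lambda>(v, u). (u, v)" "\<lambda>(v, u). (u, v)"]) auto
    also have "sum a ?P + (\<Sum>(v, u)\<in>?P. a (u, v)) = (\<Sum>(v, u)\<in>?P. a (v, u) + a (u, v))"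
      by (simp add: sum.distrib case_prod_unfold)
    also have "\<dots> = 0"
    proof (rule sum.neutral, safe)
      fix v u assume vu: "v \<in> W" "u \<in> W" "v \<noteq> u" "(v, u) \<in> ?R"
      then have "(u, v) \<notin> ?R" using lin by (auto simp: linear_order_on_def partial_order_on_def antisym_def)
      then have "{x \<in> insert u \<rho>. (x, v) \<in> ?R} = {x \<in> \<rho>. (x, v) \<in> ?R}" by auto
      moreover have "{x \<in> insert v \<rho>. (x, u) \<in> ?R} = insert v {x \<in> \<rho>. (x, u) \<in> ?R}" using vu by auto
      moreover have "v \<notin> \<rho>" using vu by (simp add: W_def)
      ultimately show "a (v, u) + a (u, v) = 0"
        using \<rho>(3) by (simp add: a_def insert_commute[of u v])
    qed
    finally show ?thesis by (simp add: zero_fun_apply)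
  qed
qed

lemma boundary_add:
  assumes V: "finite V" "\<And>\<sigma>. c \<sigma> \<noteq> 0 \<Longrightarrow> \<sigma> \<subseteq> V" "\<And>\<sigma>. c' \<sigma> \<noteq> 0 \<Longrightarrow> \<sigma> \<subseteq> V"
  shows "boundary (c + c') = boundary c + boundary c'"
proof
  fix \<tau>
  have "\<And>\<sigma>. (c + c') \<sigma> \<noteq> 0 \<Longrightarrow> \<sigma> \<subseteq> V" using V(2,3) by (metis add_0 plus_fun_apply)
  from boundary_eq_sum[where c = "c + c'" and \<tau> = \<tau>, OF V(1) this]
    boundary_eq_sum[where c = c and \<tau> = \<tau>, OF V(1,2)] boundary_eq_sum[where c = c' and \<tau> = \<tau>, OF V(1,3)]
  show "boundary (c + c') \<tau> = (boundary c + boundary c') \<tau>"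
    by (simp add: plus_fun_apply sum.distrib algebra_simps)
qed

lemma boundary_scale:
  assumes V: "finite V" "\<And>\<sigma>. c \<sigma> \<noteq> 0 \<Longrightarrow> \<sigma> \<subseteq> V"
  shows "boundary (fscale a c) = fscale a (boundary c)"
proof
  fix \<tau>
  have "\<And>\<sigma>. (fscale a c) \<sigma> \<noteq> 0 \<Longrightarrow> \<sigma> \<subseteq> V" using V(2) by (auto simp: fscale_apply)
  from boundary_eq_sum[where c = "fscale a c" and \<tau> = \<tau>, OF V(1) this] boundary_eq_sum[where c = c and \<tau> = \<tau>, OF V]
  show "boundary (fscale a c) \<tau> = (fscale a (boundary c)) \<tau>"
    by (simp add: fscale_apply sum_distrib_left algebra_simps)
qed

section \<open>Chain spaces of finite complexes and their subspaces\<close>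

lemma simplicial_complex_Un: "simplicial_complex K \<Longrightarrow> simplicial_complex L \<Longrightarrow> simplicial_complex (K \<union> L)"
  unfolding simplicial_complex_def by blast

lemma finite_vertices: "simplicial_complex K \<Longrightarrow> finite (\<Union>K)"
  by (auto simp: simplicial_complex_def)

lemma chains_supported: "c \<in> chains q K \<Longrightarrow> c \<sigma> \<noteq> 0 \<Longrightarrow> \<sigma> \<subseteq> \<Union>K"
  by (auto simp: chains_def)

lemma chains_cong:
  assumes "\<And>\<sigma>. sdim \<sigma> = q \<Longrightarrow> \<sigma> \<in> K \<longleftrightarrow> \<sigma> \<in> L"
  shows "chains q K = chains q L"
  using assms by (auto simp: chains_def)

lemma chains_mono: "K \<subseteq> L \<Longrightarrow> chains q K \<subseteq> chains q L"
  by (auto simp: chains_def)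

lemma cycles_mono: "K \<subseteq> L \<Longrightarrow> cycles q K \<subseteq> cycles q L"
  using chains_mono unfolding cycles_def by blast

lemma boundaries_mono: "K \<subseteq> L \<Longrightarrow> boundaries q K \<subseteq> boundaries q L"
  using chains_mono unfolding boundaries_def by blast

lemma subspace_chains: "fs.subspace (chains q K :: ('v, 'f::field) chain set)"
proof (rule fs.subspaceI)
  show "0 \<in> chains q K" by (simp add: chains_def zero_fun_apply)
  show "x + y \<in> chains q K" if "x \<in> chains q K" "y \<in> chains q K" for x y :: "('v, 'f) chain"
    using that unfolding chains_def mem_Collect_eq plus_fun_apply by (metis add_0)
  show "fscale a x \<in> chains q K" if "x \<in> chains q K" for x :: "('v, 'f) chain" and a
    using that by (auto simp: chains_def fscale_apply)
qed

context
  fixes K :: "'v set set" assumes K: "simplicial_complex K"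
begin

lemma boundary_chains_add:
  assumes "c \<in> chains q K" "c' \<in> chains q K"
  shows "boundary (c + c' :: ('v, 'f::field) chain) = boundary c + boundary c'"
  by (rule boundary_add[OF finite_vertices[OF K] chains_supported[OF assms(1)] chains_supported[OF assms(2)]])

lemma boundary_chains_scale:
  assumes "c \<in> chains q K"
  shows "boundary (fscale a c :: ('v, 'f::field) chain) = fscale a (boundary c)"
  by (rule boundary_scale[OF finite_vertices[OF K] chains_supported[OF assms]])

lemma boundary_zero: "boundary (0 :: ('v, 'f::field) chain) = 0"
  by (simp add: boundary_def fun_eq_iff zero_fun_apply)

lemma boundary_chains:
  assumes "c \<in> chains (Suc q) K" shows "boundary c \<in> chains q K"
proof -
  have "\<tau> \<in> K \<and> sdim \<tau> = q" if nz: "boundary c \<tau> \<noteq> 0" for \<tau>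
  proof -
    obtain v where v: "v \<notin> \<tau>" "c (insert v \<tau>) \<noteq> 0" using boundary_nonzero(2)[OF nz] by blast
    then have i: "insert v \<tau> \<in> K" "sdim (insert v \<tau>) = Suc q" using assms by (auto simp: chains_def)
    have "\<tau> \<noteq> {}" by (rule boundary_nonzero(1)[OF nz])
    then have "\<tau> \<in> K" "finite \<tau>" using i(1) K unfolding simplicial_complex_def by (metis subset_insertI, metis finite_insert)
    then show ?thesis using i v by (simp add: sdim_def)
  qed
  then show ?thesis by (simp add: chains_def)
qed

lemma subspace_cycles: "fs.subspace (cycles q K :: ('v, 'f::field) chain set)"
proof (rule fs.subspaceI)
  show "0 \<in> cycles q K" unfolding cycles_def using fs.subspace_0[OF subspace_chains] boundary_zero by blast
  show "x + y \<in> cycles q K" if "x \<in> cycles q K" "y \<in> cycles q K" for x y :: "('v, 'f) chain"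
    using that boundary_chains_add[of x q y] fs.subspace_add[OF subspace_chains, of x q K y] by (simp add: cycles_def)
  show "fscale a x \<in> cycles q K" if "x \<in> cycles q K" for x :: "('v, 'f) chain" and a
    using that boundary_chains_scale[of x q a] fs.subspace_scale[OF subspace_chains, of x q K a] by (simp add: cycles_def)
qed

lemma subspace_boundaries: "fs.subspace (boundaries q K :: ('v, 'f::field) chain set)"
proof (rule fs.subspaceI)
  show "0 \<in> boundaries q K"
    unfolding boundaries_def using fs.subspace_0[OF subspace_chains] boundary_zero by (metis imageI)
  show "x + y \<in> boundaries q K" if xy: "x \<in> boundaries q K" "y \<in> boundaries q K" for x y :: "('v, 'f) chain"
  proof -
    obtain c c' where "c \<in> chains (Suc q) K" "c' \<in> chains (Suc q) K" "x = boundary c" "y = boundary c'"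
      using xy unfolding boundaries_def by blast
    then show ?thesis using boundary_chains_add fs.subspace_add[OF subspace_chains]
      unfolding boundaries_def by (metis imageI)
  qed
  show "fscale a x \<in> boundaries q K" if x: "x \<in> boundaries q K" for x :: "('v, 'f) chain" and a
  proof -
    obtain c where "c \<in> chains (Suc q) K" "x = boundary c" using x unfolding boundaries_def by blast
    then show ?thesis using boundary_chains_scale fs.subspace_scale[OF subspace_chains]
      unfolding boundaries_def by (metis imageI)
  qed
qed

lemma boundaries_subset_cycles: "boundaries q K \<subseteq> (cycles q K :: ('v, 'f::field) chain set)"
proof
  fix x :: "('v, 'f) chain" assume "x \<in> boundaries q K"
  then obtain c where c: "c \<in> chains (Suc q) K" "x = boundary c" unfolding boundaries_def by blast
  have "boundary x = 0"
    unfolding c(2) using boundary_boundary[OF finite_vertices[OF K]] chains_supported[OF c(1)] by blast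
  then show "x \<in> cycles q K" using boundary_chains[OF c(1)] c(2) by (simp add: cycles_def)
qed

end

text \<open>Inserting \<sigma> changes chains only in the dimension of \<sigma>. If this is
  \<open>p\<close>, the coefficient at \<sigma> is a functional on the new cycles whose kernel
  consists of the old ones; if it is \<open>p\<close> + 1, the boundaries grow by the span of the
  boundary of \<sigma>, which may already lie in them.\<close>

lemma elementary_insert:
  assumes K: "simplicial_complex K" and K': "simplicial_complex (insert \<sigma> K)" and "\<sigma> \<notin> K"
  shows "elementary (cycles p K :: ('v, 'f::field) chain set) (boundaries p K)
           (cycles p (insert \<sigma> K)) (boundaries p (insert \<sigma> K))"
proof -
  have same: "chains q (insert \<sigma> K) = (chains q K :: ('v, 'f) chain set)" if "sdim \<sigma> \<noteq> q" for q
    using that by (intro chains_cong) auto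
  consider "sdim \<sigma> = p" | "sdim \<sigma> = Suc p" | "sdim \<sigma> \<noteq> p" "sdim \<sigma> \<noteq> Suc p" by blast
  then show ?thesis
  proof cases
    case 1
    have B: "boundaries p (insert \<sigma> K) = (boundaries p K :: ('v, 'f) chain set)"
      using same[of "Suc p"] 1 by (simp add: boundaries_def)
    show ?thesis
    proof (cases "cycles p (insert \<sigma> K) = (cycles p K :: ('v, 'f) chain set)")
      case False
      have sub: "cycles p K \<subseteq> (cycles p (insert \<sigma> K) :: ('v, 'f) chain set)" by (rule cycles_mono) auto
      then obtain u :: "('v, 'f) chain" where u: "u \<in> cycles p (insert \<sigma> K)" "u \<notin> cycles p K" using False by blast
      have vanish: "z \<in> cycles p K" if "z \<in> cycles p (insert \<sigma> K)" "z \<sigma> = 0" for z :: "('v, 'f) chain"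
      proof -
        have "z \<in> chains p K" using that by (fastforce simp: chains_def cycles_def)
        then show ?thesis using that(1) by (simp add: cycles_def)
      qed
      have "cycles p (insert \<sigma> K) = line_extension (cycles p K) u"
      proof
        show "cycles p (insert \<sigma> K) \<subseteq> line_extension (cycles p K) u"
        proof
          fix z :: "('v, 'f) chain" assume z: "z \<in> cycles p (insert \<sigma> K)"
          let ?a = "z \<sigma> / u \<sigma>"
          have "u \<sigma> \<noteq> 0" using u vanish by blast
          then have "(z - fscale ?a u) \<sigma> = 0" by (simp add: minus_apply fscale_apply)
          moreover have "z - fscale ?a u \<in> cycles p (insert \<sigma> K)"
            using subspace_cycles[OF K'] z u(1) by (intro fs.subspace_diff fs.subspace_scale)
          ultimately have "z - fscale ?a u \<in> cycles p K" by (intro vanish)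
          moreover have "z = (z - fscale ?a u) + fscale ?a u" by simp
          ultimately show "z \<in> line_extension (cycles p K) u" unfolding line_extension_def by blast
        qed
        show "line_extension (cycles p K) u \<subseteq> cycles p (insert \<sigma> K)"
          unfolding line_extension_def using sub u(1) subspace_cycles[OF K']
          by (auto intro!: fs.subspace_add fs.subspace_scale)
      qed
      then show ?thesis using B u(2) by (auto simp: elementary_def)
    qed (simp add: elementary_def B)
  next
    case 2
    then have Z: "cycles p (insert \<sigma> K) = (cycles p K :: ('v, 'f) chain set)"
      using same[of p] by (simp add: cycles_def)
    define e :: "('v, 'f) chain" where "e = (\<lambda>\<tau>. if \<tau> = \<sigma> then 1 else 0)"
    have e: "e \<in> chains (Suc p) (insert \<sigma> K)" using 2 by (auto simp: e_def chains_def)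
    have sub: "chains (Suc p) K \<subseteq> (chains (Suc p) (insert \<sigma> K) :: ('v, 'f) chain set)" by (rule chains_mono) auto
    have eq: "boundaries p (insert \<sigma> K) = line_extension (boundaries p K) (boundary e)"
    proof
      show "boundaries p (insert \<sigma> K) \<subseteq> line_extension (boundaries p K) (boundary e)"
      proof
        fix x :: "('v, 'f) chain" assume "x \<in> boundaries p (insert \<sigma> K)"
        then obtain c where c: "c \<in> chains (Suc p) (insert \<sigma> K)" "x = boundary c" unfolding boundaries_def by blast
        let ?d = "c - fscale (c \<sigma>) e"
        have d: "?d \<in> chains (Suc p) K" using c(1) by (auto simp: chains_def minus_apply fscale_apply e_def)
        have "c = ?d + fscale (c \<sigma>) e" by simp
        then have "boundary c = boundary ?d + fscale (c \<sigma>) (boundary e)"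
          using boundary_chains_add[OF K', of ?d "Suc p" "fscale (c \<sigma>) e"] d sub e
            fs.subspace_scale[OF subspace_chains e] boundary_chains_scale[OF K' e]
          by (metis subsetD)
        then show "x \<in> line_extension (boundaries p K) (boundary e)"
          using c(2) d unfolding line_extension_def boundaries_def by blast
      qed
      have "boundary e \<in> boundaries p (insert \<sigma> K)" using e unfolding boundaries_def by blast
      moreover have "boundaries p K \<subseteq> (boundaries p (insert \<sigma> K) :: ('v, 'f) chain set)" by (rule boundaries_mono) auto
      ultimately show "line_extension (boundaries p K) (boundary e) \<subseteq> boundaries p (insert \<sigma> K)"
        unfolding line_extension_def using subspace_boundaries[OF K']
        by (auto intro!: fs.subspace_add fs.subspace_scale)
    qed
    show ?thesis
    proof (cases "boundary e \<in> boundaries p K")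
      case True
      have "line_extension (boundaries p K) (boundary e) \<subseteq> boundaries p K"
        unfolding line_extension_def using subspace_boundaries[OF K] True
        by (auto intro!: fs.subspace_add fs.subspace_scale)
      then show ?thesis using eq Z line_extension_superset by (fastforce simp: elementary_def)
    next
      case False
      have "boundary e \<in> cycles p K"
        using boundaries_subset_cycles[OF K', of p] e Z unfolding boundaries_def by blast
      then show ?thesis using eq Z False by (auto simp: elementary_def)
    qed
  next
    case 3
    then show ?thesis using same by (simp add: elementary_def cycles_def boundaries_def)
  qed
qed

text \<open>
  Writing \<open>x - y\<close> as the boundary of \<open>b\<close>, the chain \<open>c = x - \<partial>(b restricted to M i)\<close> is homologous
  to \<open>x\<close> at the start and to \<open>y\<close> at the end, and it is a cycle of every complex in between.
\<close>

lemma zrel_cluster: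
  fixes M :: "nat \<Rightarrow> 'v set set" and p :: nat
  defines "Z \<equiv> \<lambda>l. cycles p (M l) :: ('v, 'f::field) chain set" and "B \<equiv> \<lambda>l. boundaries p (M l)"
  assumes zz: "elementary_zigzag Z B fwd n" and K: "\<And>l. l \<le> n \<Longrightarrow> simplicial_complex (M l)"
    and ik: "i + k \<le> n"
    and low: "\<And>l \<sigma>. i \<le> l \<Longrightarrow> l \<le> i + k \<Longrightarrow> sdim \<sigma> = p \<Longrightarrow> \<sigma> \<in> M i \<Longrightarrow> \<sigma> \<in> M (i + k) \<Longrightarrow> \<sigma> \<in> M l"
    and up: "\<And>l \<sigma>. i \<le> l \<Longrightarrow> l \<le> i + k \<Longrightarrow> sdim \<sigma> = Suc p \<Longrightarrow> \<sigma> \<in> M l \<Longrightarrow> \<sigma> \<in> M i \<union> M (i + k)"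
  shows "zrel Z B i k = {(x, y). x \<in> cycles p (M i) \<and> y \<in> cycles p (M (i + k)) \<and>
           x - y \<in> boundaries p (M i \<union> M (i + k))}"
proof -
  interpret elementary_zigzag Z B fwd n by (rule zz)
  let ?U = "M i \<union> M (i + k)"
  have U: "simplicial_complex ?U" using K ik by (intro simplicial_complex_Un) auto
  \<comment> \<open>Boundaries depend on the (\<open>p\<close> + 1)-simplices alone, and
    \<open>up\<close> confines these to the two ends.\<close>
  have BU: "B l \<subseteq> boundaries p ?U" if "i \<le> l" "l \<le> i + k" for l
  proof -
    have "chains (Suc p) (M l) \<subseteq> (chains (Suc p) ?U :: ('v, 'f) chain set)" using up[OF that] unfolding chains_def by blast
    then show ?thesis unfolding B_def boundaries_def by blast
  qed
  have le: "x - y \<in> boundaries p ?U" if "(x, y) \<in> zrel Z B i k'" "k' \<le> k" for x y k'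
    using that
  proof (induction k' arbitrary: y)
    case 0
    then show ?case using BU[of i] by auto
  next
    case (Suc k')
    then obtain u where u: "(x, u) \<in> zrel Z B i k'" "(u, y) \<in> zstep_rel Z B (i + k')" by auto
    have "x - u \<in> boundaries p ?U" using Suc u by simp
    moreover have "u - y \<in> boundaries p ?U"
      using u(2) BU[of "i + k'"] BU[of "Suc (i + k')"] Suc.prems(2) by (auto simp: zstep_rel_def)
    ultimately have "(x - u) + (u - y) \<in> boundaries p ?U" by (rule fs.subspace_add[OF subspace_boundaries[OF U]])
    then show ?case by simp
  qed
  have ge: "(x, y) \<in> zrel Z B i k"
    if x: "x \<in> cycles p (M i)" and y: "y \<in> cycles p (M (i + k))" and xy: "x - y \<in> boundaries p ?U" for x y
  proof -
    obtain b where b: "b \<in> chains (Suc p) ?U" "x - y = boundary b" using xy unfolding boundaries_def by blast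
    define b1 where "b1 = (\<lambda>\<tau>. if \<tau> \<in> M i then b \<tau> else 0)"
    define b2 where "b2 = (\<lambda>\<tau>. if \<tau> \<in> M i then 0 else b \<tau>)"
    have b1: "b1 \<in> chains (Suc p) (M i)" using b(1) by (auto simp: chains_def b1_def)
    have b2: "b2 \<in> chains (Suc p) (M (i + k))" using b(1) by (auto simp: chains_def b2_def)
    have bb: "b = b1 + b2" by (simp add: b1_def b2_def fun_eq_iff plus_fun_apply)
    have "b1 \<in> chains (Suc p) ?U" "b2 \<in> chains (Suc p) ?U"
      using b1 b2 chains_mono[of "M i" ?U] chains_mono[of "M (i + k)" ?U] by blast+
    then have "boundary b = boundary b1 + boundary b2" unfolding bb by (rule boundary_chains_add[OF U])
    define c where "c = x - boundary b1"
    have c2: "c = y + boundary b2"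
      using b(2) \<open>boundary b = boundary b1 + boundary b2\<close> by (simp add: c_def algebra_simps)
    have bi: "boundary b1 \<in> cycles p (M i)" "boundary b2 \<in> cycles p (M (i + k))"
    proof -
      have "boundary b1 \<in> boundaries p (M i)" "boundary b2 \<in> boundaries p (M (i + k))"
        unfolding boundaries_def using b1 b2 by blast+
      then show "boundary b1 \<in> cycles p (M i)" "boundary b2 \<in> cycles p (M (i + k))"
        using boundaries_subset_cycles[OF K] ik by (meson add_leD1 subsetD)+
    qed
    have c_i: "c \<in> cycles p (M i)" unfolding c_def using ik by (intro fs.subspace_diff[OF subspace_cycles[OF K]] x bi(1)) simp
    have c_k: "c \<in> cycles p (M (i + k))" unfolding c2 using ik by (intro fs.subspace_add[OF subspace_cycles[OF K]] y bi(2)) simp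
    \<comment> \<open>Being a chain of both ends, \<open>c\<close> is supported on their common
      \<open>p\<close>-simplices, and \<open>low\<close> keeps these throughout.\<close>
    have cZ: "c \<in> Z l" if l: "i \<le> l" "l \<le> i + k" for l
    proof -
      have "c \<in> chains p (M i)" "c \<in> chains p (M (i + k))" "boundary c = 0" using c_i c_k by (auto simp: cycles_def)
      then show ?thesis using low[OF l] unfolding Z_def cycles_def chains_def by blast
    qed
    have "(x, c) \<in> zrel Z B i k'" if "k' \<le> k" for k'
      using that
    proof (induction k')
      case 0
      have "x - c \<in> B i" using b1 by (simp add: c_def B_def boundaries_def)
      then show ?case using x c_i by (simp add: Z_def)
    next
      case (Suc k')
      have "0 \<in> B (i + k')" using fs.subspace_0[OF subspace_B[of "i + k'"]] Suc.prems ik by simp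
      then have "(c, c) \<in> zstep_rel Z B (i + k')" using cZ Suc.prems by (simp add: zstep_rel_def)
      then show ?case using Suc by auto
    qed
    then have "(x, c) \<in> zrel Z B i k" by simp
    moreover have "(c, y) \<in> zrel Z B (i + k) 0"
      using c_k y b2 by (simp add: Z_def B_def c2 boundaries_def)
    ultimately show ?thesis using zrel_compose[of i k 0] ik by auto
  qed
  show ?thesis
  proof safe
    fix x y assume *: "(x, y) \<in> zrel Z B i k"
    then show "x \<in> cycles p (M i)" "y \<in> cycles p (M (i + k))" using zrel_Z[OF *] by (simp_all add: Z_def)
    show "x - y \<in> boundaries p ?U" using le[OF *] by simp
  qed (rule ge)
qed

section \<open>Interval decompositions of homology zigzags\<close>

definition valid_events :: "'v event list \<Rightarrow> bool" where
  "valid_events es \<longleftrightarrow> (\<forall>i\<le>length es. simplicial_complex (complex_after es i)) \<and>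
     (\<forall>i<length es. case es ! i of Ins \<sigma> \<Rightarrow> \<sigma> \<notin> complex_after es i | Del \<sigma> \<Rightarrow> \<sigma> \<in> complex_after es i)"

lemma complex_after_0 [simp]: "complex_after es 0 = {}"
  by (simp add: complex_after_def)

lemma complex_after_Suc:
  "i < length es \<Longrightarrow> complex_after es (Suc i) = apply_event (es ! i) (complex_after es i)"
  by (simp add: complex_after_def take_Suc_conv_app_nth)

lemma elementary_zigzag_homology:
  assumes "valid_events es"
  shows "elementary_zigzag (\<lambda>i. cycles p (complex_after es i) :: ('v, 'f::field) chain set)
    (\<lambda>i. boundaries p (complex_after es i)) (\<lambda>i. \<exists>\<sigma>. es ! i = Ins \<sigma>) (length es)"
proof
  have K: "simplicial_complex (complex_after es i)" if "i \<le> length es" for i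
    using assms that by (simp add: valid_events_def)
  show "fs.subspace (cycles p (complex_after es i) :: ('v, 'f) chain set)"
    "fs.subspace (boundaries p (complex_after es i) :: ('v, 'f) chain set)"
    "boundaries p (complex_after es i) \<subseteq> (cycles p (complex_after es i) :: ('v, 'f) chain set)"
    if "i \<le> length es" for i
    using K[OF that] by (rule subspace_cycles subspace_boundaries boundaries_subset_cycles)+
  fix i assume i: "i < length es"
  show "if \<exists>\<sigma>. es ! i = Ins \<sigma>
    then elementary (cycles p (complex_after es i) :: ('v, 'f) chain set) (boundaries p (complex_after es i))
      (cycles p (complex_after es (Suc i))) (boundaries p (complex_after es (Suc i)))
    else elementary (cycles p (complex_after es (Suc i)) :: ('v, 'f) chain set) (boundaries p (complex_after es (Suc i)))
      (cycles p (complex_after es i)) (boundaries p (complex_after es i))"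
  proof (cases "es ! i")
    case (Ins \<sigma>)
    then have "complex_after es (Suc i) = insert \<sigma> (complex_after es i)" "\<sigma> \<notin> complex_after es i"
      using i assms by (auto simp: complex_after_Suc valid_events_def split: event.splits)
    then show ?thesis using elementary_insert[of "complex_after es i" \<sigma> p] K[of i] K[of "Suc i"] i Ins by simp
  next
    case (Del \<sigma>)
    then have "complex_after es (Suc i) = complex_after es i - {\<sigma>}" "\<sigma> \<in> complex_after es i"
      using i assms by (auto simp: complex_after_Suc valid_events_def split: event.splits)
    moreover from this have "complex_after es i = insert \<sigma> (complex_after es (Suc i))" "\<sigma> \<notin> complex_after es (Suc i)"
      by auto
    ultimately show ?thesis
      using elementary_insert[of "complex_after es (Suc i)" \<sigma> p] K[of i] K[of "Suc i"] i Del by simp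
  qed
qed

section \<open>Arithmetic of cosets\<close>

lemma in_coset_iff: "z \<in> x +o B \<longleftrightarrow> z - x \<in> (B :: 'a::ab_group_add set)"
proof
  assume "z \<in> x +o B"
  then obtain b where "b \<in> B" "z = x + b" unfolding elt_set_plus_def by blast
  then show "z - x \<in> B" by simp
next
  assume "z - x \<in> B"
  moreover have "z = x + (z - x)" by simp
  ultimately show "z \<in> x +o B" unfolding elt_set_plus_def by blast
qed

lemma coset_eq_iff:
  assumes "fs.subspace B"
  shows "x +o B = y +o B \<longleftrightarrow> x - y \<in> B"
proof
  assume *: "x +o B = y +o B"
  have "x \<in> x +o B" using fs.subspace_0[OF assms] by (simp add: in_coset_iff)
  then have "x \<in> y +o B" by (simp only: *)
  then show "x - y \<in> B" by (simp add: in_coset_iff)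
next
  assume xy: "x - y \<in> B"
  have "z - x \<in> B \<longleftrightarrow> z - y \<in> B" for z
    using fs.subspace_add[OF assms _ xy, of "z - x"] fs.subspace_diff[OF assms _ xy, of "z - y"] by auto
  then show "x +o B = y +o B" by (intro set_eqI) (simp only: in_coset_iff)
qed

text \<open>This is the map on classes induced by an inclusion of complexes: the larger denominator
  absorbs the smaller one.\<close>

lemma coset_plus_subspace:
  assumes "fs.subspace B'" "B \<subseteq> B'" "0 \<in> B"
  shows "(x +o B) + B' = x +o B'"
proof safe
  fix z assume "z \<in> (x +o B) + B'"
  then obtain b b' where "b \<in> B" "b' \<in> B'" "z = (x + b) + b'"
    unfolding elt_set_plus_def set_plus_def by blast
  moreover from this have "b + b' \<in> B'" using assms(2) by (intro fs.subspace_add[OF assms(1)]) auto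
  moreover have "z = x + (b + b')" using calculation by (simp add: add.assoc)
  ultimately show "z \<in> x +o B'" unfolding elt_set_plus_def by blast
next
  fix z assume "z \<in> x +o B'"
  then obtain b where "b \<in> B'" "z = x + b" unfolding elt_set_plus_def by blast
  moreover from this have "z = (x + 0) + b" by simp
  ultimately show "z \<in> (x +o B) + B'" using assms(3) unfolding elt_set_plus_def set_plus_def by blast
qed

lemma coset_add:
  assumes "fs.subspace B"
  shows "(x +o B) + (y +o B) = (x + y) +o B"
proof safe
  fix z assume "z \<in> (x +o B) + (y +o B)"
  then obtain b b' where b: "b \<in> B" "b' \<in> B" "z = (x + b) + (y + b')"
    unfolding elt_set_plus_def set_plus_def by blast
  then have "z = (x + y) + (b + b')" by (simp add: algebra_simps)
  then show "z \<in> (x + y) +o B" using fs.subspace_add[OF assms b(1,2)] unfolding elt_set_plus_def by blast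
next
  fix z assume "z \<in> (x + y) +o B"
  then obtain b where b: "b \<in> B" "z = (x + y) + b" unfolding elt_set_plus_def by blast
  then have "z = (x + b) + (y + 0)" by (simp add: algebra_simps)
  then show "z \<in> (x +o B) + (y +o B)"
    using b(1) fs.subspace_0[OF assms] unfolding elt_set_plus_def set_plus_def by blast
qed

lemma coset_scale:
  assumes "fs.subspace B"
  shows "(\<lambda>c \<sigma>. a * c \<sigma>) ` (x +o B) + B = fscale a x +o B"
proof safe
  fix z assume "z \<in> (\<lambda>c \<sigma>. a * c \<sigma>) ` (x +o B) + B"
  then obtain b b' where b: "b \<in> B" "b' \<in> B" "z = fscale a (x + b) + b'"
    unfolding elt_set_plus_def set_plus_def fscale_def by blast
  then have "z = fscale a x + (fscale a b + b')" by (simp add: fs.scale_right_distrib add.assoc)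
  then show "z \<in> fscale a x +o B"
    using fs.subspace_add[OF assms fs.subspace_scale[OF assms b(1)] b(2)] unfolding elt_set_plus_def by blast
next
  fix z assume "z \<in> fscale a x +o B"
  then obtain b where b: "b \<in> B" "z = fscale a x + b" unfolding elt_set_plus_def by blast
  then have "z = fscale a (x + 0) + b" by simp
  then show "z \<in> (\<lambda>c \<sigma>. a * c \<sigma>) ` (x +o B) + B"
    using b(1) fs.subspace_0[OF assms] unfolding elt_set_plus_def set_plus_def fscale_def by blast
qed

section \<open>Sums of interval modules as spaces of coordinate functions\<close>

abbreviation interval_sum :: "nat \<Rightarrow> (nat \<Rightarrow> bool) \<Rightarrow> (nat \<times> nat) list \<Rightarrow> ('f::field, nat \<Rightarrow> 'f) zigzag" where
  "interval_sum n dir bs \<equiv> direct_sum n dir (map (interval_module n dir) bs)"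

lemma interval_sum_simps [simp]:
  "zlen (interval_sum n dir bs) = n" "zfwd (interval_sum n dir bs) = dir"
  by (simp_all add: direct_sum_def)

lemma interval_sum_carrier: "vcarrier (zspace (interval_sum n dir bs) i) = coord bs i"
proof -
  have "(\<forall>j<length bs. x j \<in> (if fst (bs ! j) \<le> i \<and> i \<le> snd (bs ! j) then UNIV else {0})) \<and> (\<forall>j\<ge>length bs. x j = 0)
    \<longleftrightarrow> (\<forall>j. x j \<noteq> 0 \<longrightarrow> alive bs j i)" for x :: "nat \<Rightarrow> 'a"
    by (auto simp: alive_def split: if_splits) (meson not_le)+
  then show ?thesis
    by (simp add: direct_sum_def coord_def interval_module_def case_prod_unfold cong: conj_cong)
qed

lemma interval_sum_add:
  assumes "x \<in> coord bs i" "y \<in> coord bs i"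
  shows "vadd (zspace (interval_sum n dir bs) i) x y = x + y"
proof
  fix j
  have "x j = 0" "y j = 0" if "\<not> j < length bs" using assms that by (auto simp: coord_def alive_def)
  then show "vadd (zspace (interval_sum n dir bs) i) x y j = (x + y) j"
    by (auto simp: direct_sum_def interval_module_def case_prod_unfold plus_fun_apply)
qed

lemma interval_sum_scale:
  assumes "x \<in> coord bs i"
  shows "vscale (zspace (interval_sum n dir bs) i) a x = fscale a x"
proof
  fix j
  have "x j = 0" if "\<not> j < length bs" using assms that by (auto simp: coord_def alive_def)
  then show "vscale (zspace (interval_sum n dir bs) i) a x j = fscale a x j"
    by (auto simp: direct_sum_def interval_module_def case_prod_unfold fscale_apply)
qed

lemma interval_sum_map: "zmap (interval_sum n dir bs) i x = restr bs i x"
proof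
  fix j
  show "zmap (interval_sum n dir bs) i x j = restr bs i x j"
    by (auto simp: direct_sum_def interval_module_def case_prod_unfold restr_def alive_def)
qed

section \<open>Barcodes and interval decompositions of the homology zigzag\<close>

context
  fixes es :: "'v event list" and p :: nat and Z B :: "nat \<Rightarrow> ('v, 'f::field) chain set" and n :: nat
    and fwd :: "nat \<Rightarrow> bool" and M :: "('f, ('v, 'f) chain set) zigzag"
  assumes es: "valid_events es"
  defines "Z \<equiv> \<lambda>i. cycles p (complex_after es i)" and "B \<equiv> \<lambda>i. boundaries p (complex_after es i)"
    and "n \<equiv> length es" and "fwd \<equiv> \<lambda>i. \<exists>\<sigma>. es ! i = Ins \<sigma>" and "M \<equiv> homology_zigzag p es"
begin

interpretation elementary_zigzag Z B fwd n
  unfolding Z_def B_def n_def fwd_def by (rule elementary_zigzag_homology[OF es])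

lemma homology_zigzag_simps: "zlen M = n" "zfwd M = fwd" "vcarrier (zspace M i) = (\<lambda>z. z +o B i) ` Z i"
  by (simp_all add: M_def homology_zigzag_def n_def fwd_def homology_def Z_def B_def)

lemma homology_zigzag_add:
  assumes "i \<le> n" shows "vadd (zspace M i) (x +o B i) (y +o B i) = (x + y) +o B i"
  using coset_add[OF subspace_B[OF assms]] by (simp add: M_def homology_zigzag_def homology_def)

lemma homology_zigzag_scale:
  assumes "i \<le> n" shows "vscale (zspace M i) a (x +o B i) = fscale a x +o B i"
  using coset_scale[OF subspace_B[OF assms]] by (simp add: M_def homology_zigzag_def homology_def B_def)

lemma homology_zigzag_map:
  assumes "i < n"
  shows "zmap M i (x +o B (if fwd i then i else Suc i)) = x +o B (if fwd i then Suc i else i)"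
proof -
  have "zmap M i = (\<lambda>X. X + B (if fwd i then Suc i else i))"
    by (simp add: M_def homology_zigzag_def inclusion_map_def fun_eq_iff fwd_def B_def)
  then show ?thesis
    using nested[OF assms] subspace_B[of i] subspace_B[of "Suc i"] assms
    by (cases "fwd i") (simp_all add: coset_plus_subspace fs.subspace_0)
qed

text \<open>Composing the given isomorphisms with the quotient maps from cycles to homology turns
  them into coordinates.\<close>

lemma interval_decomposition_barcode:
  assumes "interval_decomposition M D"
  obtains bs \<phi> where "mset bs = D" "barcode Z B fwd n bs \<phi>" "\<forall>(b, d)\<in>set bs. 1 \<le> b \<and> b \<le> d \<and> d < n"
proof -
  let ?N = "\<lambda>bs. interval_sum n fwd bs :: ('f, nat \<Rightarrow> 'f) zigzag"
  obtain bs where bs: "mset bs = D" "zigzag_iso M (?N bs)"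
    using assms by (auto simp: interval_decomposition_def homology_zigzag_simps)
  have bd: "\<forall>(b, d)\<in>set bs. 1 \<le> b \<and> b \<le> d \<and> d < n"
    using assms bs(1) by (auto simp: interval_decomposition_def homology_zigzag_simps)
  obtain \<psi> where iso: "\<And>i. i \<le> n \<Longrightarrow> linear_iso (zspace M i) (zspace (?N bs) i) (\<psi> i)"
    and comm: "\<And>i. i < n \<Longrightarrow> if fwd i
             then \<forall>x\<in>vcarrier (zspace M i). \<psi> (Suc i) (zmap M i x) = zmap (?N bs) i (\<psi> i x)
             else \<forall>x\<in>vcarrier (zspace M (Suc i)). \<psi> i (zmap M i x) = zmap (?N bs) i (\<psi> (Suc i) x)"
    using bs(2) unfolding zigzag_iso_def homology_zigzag_simps by blast
  define \<phi> where "\<phi> i z = \<psi> i (z +o B i)" for i z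
  have "coordinates bs i (Z i) (B i) (\<phi> i)" if i: "i \<le> n" for i
  proof -
    have bij: "bij_betw (\<psi> i) ((\<lambda>z. z +o B i) ` Z i) (coord bs i)"
      using iso[OF i] by (simp add: linear_iso_def interval_sum_carrier homology_zigzag_simps)
    have im: "\<phi> i ` Z i = coord bs i" using bij by (simp add: bij_betw_def \<phi>_def image_image)
    have c: "\<phi> i z \<in> coord bs i" if "z \<in> Z i" for z using im that by blast
    have lin: "lin_on (Z i) (\<phi> i)"
      unfolding lin_on_def
    proof (intro conjI ballI allI)
      fix x y assume xy: "x \<in> Z i" "y \<in> Z i"
      then have "\<psi> i (vadd (zspace M i) (x +o B i) (y +o B i)) = vadd (zspace (?N bs) i) (\<phi> i x) (\<phi> i y)"
        using iso[OF i] by (simp add: linear_iso_def homology_zigzag_simps \<phi>_def)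
      then show "\<phi> i (x + y) = \<phi> i x + \<phi> i y"
        using interval_sum_add[OF c[OF xy(1)] c[OF xy(2)], of n fwd] homology_zigzag_add[OF i] by (simp add: \<phi>_def)
    next
      fix a x assume x: "x \<in> Z i"
      then have "\<psi> i (vscale (zspace M i) a (x +o B i)) = vscale (zspace (?N bs) i) a (\<phi> i x)"
        using iso[OF i] by (simp add: linear_iso_def homology_zigzag_simps \<phi>_def)
      then show "\<phi> i (fscale a x) = fscale a (\<phi> i x)"
        using interval_sum_scale[OF c[OF x], of n fwd] homology_zigzag_scale[OF i] by (simp add: \<phi>_def)
    qed
    have "\<phi> i z = 0 \<longleftrightarrow> z \<in> B i" if z: "z \<in> Z i" for z
    proof -
      have Z0: "0 \<in> Z i" by (rule fs.subspace_0[OF subspace_Z[OF i]])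
      have "\<phi> i z = 0 \<longleftrightarrow> \<phi> i z = \<phi> i 0" using lin_on_0[OF lin subspace_Z[OF i]] by simp
      also have "\<dots> \<longleftrightarrow> z +o B i = 0 +o B i"
        unfolding \<phi>_def by (rule inj_on_eq_iff[OF bij_betw_imp_inj_on[OF bij]]) (use z Z0 in blast)+
      also have "\<dots> \<longleftrightarrow> z \<in> B i" by (simp only: coset_eq_iff[OF subspace_B[OF i]] diff_zero)
      finally show ?thesis .
    qed
    then show ?thesis using lin im by (simp add: coordinates_def)
  qed
  moreover have "compatible bs i (fwd i) (Z i) (Z (Suc i)) (\<phi> i) (\<phi> (Suc i))" if i: "i < n" for i
    using comm[OF i] homology_zigzag_map[OF i]
    by (cases "fwd i") (auto simp: compatible_def \<phi>_def homology_zigzag_simps interval_sum_map)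
  ultimately have "barcode Z B fwd n bs \<phi>" using bd by (auto simp: barcode_def)
  then show ?thesis using that bs(1) bd by blast
qed

text \<open>Coordinates are constant on the cosets of the boundaries, so their value at a chosen
  representative defines an isomorphism on homology.\<close>

lemma barcode_interval_decomposition:
  assumes bar: "barcode Z B fwd n bs \<phi>" and bd: "\<forall>(b, d)\<in>set bs. 1 \<le> b \<and> b \<le> d \<and> d < n"
  shows "interval_decomposition M (mset bs)"
proof -
  let ?N = "interval_sum n fwd bs :: ('f, nat \<Rightarrow> 'f) zigzag"
  define \<psi> where "\<psi> i X = \<phi> i (SOME z. z \<in> X)" for i X
  have \<psi>: "\<psi> i (z +o B i) = \<phi> i z" if i: "i \<le> n" and z: "z \<in> Z i" for i z
  proof -
    let ?z = "SOME z'. z' \<in> z +o B i"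
    have "z = z + 0" by simp
    then have "z \<in> z +o B i" using fs.subspace_0[OF subspace_B[OF i]] unfolding elt_set_plus_def by blast
    then have "?z \<in> z +o B i" by (rule someI[where P = "\<lambda>z'. z' \<in> z +o B i"])
    then obtain b where b: "b \<in> B i" "?z = z + b" unfolding elt_set_plus_def by blast
    have "b \<in> Z i" using b(1) B_subset_Z[OF i] by blast
    then have "?z \<in> Z i" unfolding b(2) using z fs.subspace_add[OF subspace_Z[OF i]] by blast
    moreover have "?z - z \<in> B i" using b by simp
    ultimately show ?thesis using coordinates_diff[OF bar i _ z] by (simp add: \<psi>_def)
  qed
  have "linear_iso (zspace M i) (zspace ?N i) (\<psi> i)" if i: "i \<le> n" for i
  proof -
    have c: "\<phi> i z \<in> coord bs i" if "z \<in> Z i" for z using coordinates_bar(2)[OF bar i] that by blast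
    note cl = fs.subspace_add[OF subspace_Z[OF i]] fs.subspace_scale[OF subspace_Z[OF i]]
    have "bij_betw (\<psi> i) ((\<lambda>z. z +o B i) ` Z i) (coord bs i)"
    proof (rule bij_betw_imageI)
      show "inj_on (\<psi> i) ((\<lambda>z. z +o B i) ` Z i)"
      proof (rule inj_onI)
        fix X Y assume XY: "X \<in> (\<lambda>z. z +o B i) ` Z i" "Y \<in> (\<lambda>z. z +o B i) ` Z i" "\<psi> i X = \<psi> i Y"
        then obtain x y where x: "X = x +o B i" "x \<in> Z i" and y: "Y = y +o B i" "y \<in> Z i" by blast
        then have "\<phi> i x = \<phi> i y" using XY(3) \<psi>[OF i] by simp
        then have "x - y \<in> B i" using coordinates_diff[OF bar i x(2) y(2)] by simp
        then show "X = Y" unfolding x y using coset_eq_iff[OF subspace_B[OF i]] by simp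
      qed
      have "\<psi> i ` (\<lambda>z. z +o B i) ` Z i = \<phi> i ` Z i" unfolding image_image using \<psi>[OF i] by (rule image_cong[OF refl])
      then show "\<psi> i ` (\<lambda>z. z +o B i) ` Z i = coord bs i" using coordinates_bar(2)[OF bar i] by simp
    qed
    moreover have "\<psi> i (vadd (zspace M i) (x +o B i) (y +o B i)) = vadd (zspace ?N i) (\<psi> i (x +o B i)) (\<psi> i (y +o B i))"
      if "x \<in> Z i" "y \<in> Z i" for x y
      using that interval_sum_add[OF c[OF that(1)] c[OF that(2)], of n fwd] coordinates_bar(1)[OF bar i] cl(1)[OF that]
      by (simp add: homology_zigzag_add[OF i] \<psi>[OF i] lin_on_def)
    moreover have "\<psi> i (vscale (zspace M i) a (x +o B i)) = vscale (zspace ?N i) a (\<psi> i (x +o B i))"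
      if "x \<in> Z i" for x a
      using that interval_sum_scale[OF c[OF that], of n fwd] coordinates_bar(1)[OF bar i] cl(2)[OF that]
      by (simp add: homology_zigzag_scale[OF i] \<psi>[OF i] lin_on_def)
    ultimately show ?thesis
      unfolding linear_iso_def interval_sum_carrier homology_zigzag_simps by blast
  qed
  moreover have "if fwd i
             then \<forall>x\<in>vcarrier (zspace M i). \<psi> (Suc i) (zmap M i x) = zmap ?N i (\<psi> i x)
             else \<forall>x\<in>vcarrier (zspace M (Suc i)). \<psi> i (zmap M i x) = zmap ?N i (\<psi> (Suc i) x)"
    if i: "i < n" for i
  proof -
    have comp: "compatible bs i (fwd i) (Z i) (Z (Suc i)) (\<phi> i) (\<phi> (Suc i))"
      using bar i by (simp add: barcode_def)
    show ?thesis
    proof (cases "fwd i")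
      case True
      have "\<psi> (Suc i) (zmap M i (z +o B i)) = zmap ?N i (\<psi> i (z +o B i))" if z: "z \<in> Z i" for z
      proof -
        have "z \<in> Z (Suc i)" using nested(1)[OF i True] z by blast
        then show ?thesis
          using comp True z i homology_zigzag_map[OF i, of z] by (simp add: \<psi> interval_sum_map compatible_def)
      qed
      then show ?thesis using True by (simp add: homology_zigzag_simps)
    next
      case False
      have "\<psi> i (zmap M i (z +o B (Suc i))) = zmap ?N i (\<psi> (Suc i) (z +o B (Suc i)))" if z: "z \<in> Z (Suc i)" for z
      proof -
        have "z \<in> Z i" using nested(2)[OF i False] z by blast
        then show ?thesis
          using comp False z i homology_zigzag_map[OF i, of z] by (simp add: \<psi> interval_sum_map compatible_def)
      qed
      then show ?thesis using False by (simp add: homology_zigzag_simps)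
    qed
  qed
  ultimately have "zigzag_iso M ?N"
    unfolding zigzag_iso_def homology_zigzag_simps interval_sum_simps by blast
  moreover have "\<forall>(b, d)\<in>#mset bs. 1 \<le> b \<and> b \<le> d \<and> d < n" using bd by simp
  ultimately show ?thesis unfolding interval_decomposition_def homology_zigzag_simps by blast
qed

lemma cycles_empty: "cycles p {} = {0 :: ('v, 'f) chain}"
  using boundary_zero[of "{}"] by (auto simp: cycles_def chains_def fun_simps simplicial_complex_def)

text \<open>Existence and uniqueness together give the definite description of the intervals its
  value. The strict bounds come from the empty complexes at both ends, over which no bar can be
  alive.\<close>

lemma persistence_intervals_barcode:
  assumes "complex_after es n = {}"
  obtains bs \<phi> where "barcode Z B fwd n bs \<phi>" "\<forall>(b, d)\<in>set bs. 1 \<le> b \<and> b \<le> d \<and> d < n"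
    "persistence_intervals TYPE('f) p es = image_mset (\<lambda>(b, d). (b, d + 1)) (mset bs)"
proof -
  have Z0: "Z 0 = {0}" and Zn: "Z n = {0}" using assms cycles_empty by (simp_all add: Z_def)
  obtain bs \<phi> where bar: "barcode Z B fwd n bs \<phi>" using barcode_exists[OF Z0, of n] by auto
  \<comment> \<open>The unit vector of a bar alive over a zero space would have to be the image of
    0.\<close>
  have dead: "\<not> alive bs j i" if i: "i \<le> n" "Z i = {0}" for i j
  proof
    assume "alive bs j i"
    then have "(\<lambda>k. if k = j then 1 else 0) \<in> (coord bs i :: (nat \<Rightarrow> 'f) set)" by (simp add: coord_def)
    then have "(\<lambda>k. if k = j then 1 else 0) \<in> \<phi> i ` Z i" by (simp only: coordinates_bar(2)[OF bar i(1)])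
    then have "(\<lambda>k. if k = j then 1 else 0) = \<phi> i 0" by (simp only: i(2) image_insert image_empty singleton_iff)
    moreover have "\<phi> i 0 = 0" using coordinates_bar(1)[OF bar i(1)] lin_on_0 subspace_Z[OF i(1)] by blast
    ultimately have "(\<lambda>k. if k = j then 1 else 0) = (0 :: nat \<Rightarrow> 'f)" by (simp only:)
    then have "(if j = j then 1 else 0) = (0 :: nat \<Rightarrow> 'f) j" by (rule fun_cong)
    then show False by (simp add: zero_fun_apply)
  qed
  have bd: "\<forall>(b, d)\<in>set bs. 1 \<le> b \<and> b \<le> d \<and> d < n"
  proof safe
    fix b d assume "(b, d) \<in> set bs"
    moreover from this have "b \<le> d" "d \<le> n" using bar by (auto simp: barcode_def)
    moreover from \<open>(b, d) \<in> set bs\<close> obtain j where "j < length bs" "bs ! j = (b, d)" by (metis in_set_conv_nth)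
    ultimately show "1 \<le> b" "b \<le> d" "d < n"
      using dead[of 0 j] dead[of n j] Z0 Zn by (simp_all add: alive_def)
  qed
  have "(THE D. interval_decomposition M D) = mset bs"
  proof (rule the_equality[where P = "interval_decomposition M", OF barcode_interval_decomposition[OF bar bd]])
    fix D assume "interval_decomposition M D"
    then obtain bs' \<phi>' where "mset bs' = D" "barcode Z B fwd n bs' \<phi>'" "\<forall>(b, d)\<in>set bs'. 1 \<le> b \<and> b \<le> d \<and> d < n"
      by (rule interval_decomposition_barcode)
    then show "D = mset bs"
      using barcode_unique[OF elementary_zigzag_axioms bar, of bs' \<phi>'] bd by (auto simp: case_prod_unfold)
  qed
  then have "persistence_intervals TYPE('f) p es = image_mset (\<lambda>(b, d). (b, d + 1)) (mset bs)"
    by (simp add: persistence_intervals_def M_def)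
  then show ?thesis using that bar bd by blast
qed

end

section \<open>Matchings of diagrams\<close>

text \<open>An upper bound for \<open>d_B\<close> given by an explicit witness. Such bounds can be
  reversed and composed without handling infima; the clause of \<open>d_B\<close> about infinite
  points is settled in \<open>d_B_le\<close>.\<close>

definition matched :: "real \<Rightarrow> diagram \<Rightarrow> diagram \<Rightarrow> bool" where
  "matched \<delta> D1 D2 \<longleftrightarrow> (\<exists>\<gamma>. bij_betw \<gamma> (dplus D1) (dplus D2) \<and>
     (\<forall>x\<in>dplus D1. point_dist (fst x) (fst (\<gamma> x)) \<le> ereal \<delta>))"

lemma point_dist_le_iff:
  assumes "0 \<le> \<delta>"
  shows "point_dist x y \<le> ereal \<delta> \<longleftrightarrow> \<bar>fst x - fst y\<bar> \<le> \<delta> \<and>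
    (snd x = snd y \<or> (\<exists>a b. snd x = ereal a \<and> snd y = ereal b \<and> \<bar>a - b\<bar> \<le> \<delta>))"
  using assms by (cases "snd x"; cases "snd y") (auto simp: point_dist_def)

lemma point_dist_triangle:
  assumes "0 \<le> \<delta>" "0 \<le> \<delta>'" "point_dist x y \<le> ereal \<delta>" "point_dist y z \<le> ereal \<delta>'"
  shows "point_dist x z \<le> ereal (\<delta> + \<delta>')"
proof -
  have xy: "\<bar>fst x - fst y\<bar> \<le> \<delta>" "snd x = snd y \<or> (\<exists>a b. snd x = ereal a \<and> snd y = ereal b \<and> \<bar>a - b\<bar> \<le> \<delta>)"
    using assms by (auto simp: point_dist_le_iff)
  have yz: "\<bar>fst y - fst z\<bar> \<le> \<delta>'" "snd y = snd z \<or> (\<exists>a b. snd y = ereal a \<and> snd z = ereal b \<and> \<bar>a - b\<bar> \<le> \<delta>')"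
    using assms by (auto simp: point_dist_le_iff)
  have "\<bar>fst x - fst z\<bar> \<le> \<delta> + \<delta>'" using xy(1) yz(1) by linarith
  moreover have "snd x = snd z \<or> (\<exists>a b. snd x = ereal a \<and> snd z = ereal b \<and> \<bar>a - b\<bar> \<le> \<delta> + \<delta>')"
    using xy(2)
  proof
    assume "snd x = snd y"
    then show ?thesis using yz(2) assms(1) by force
  next
    assume "\<exists>a b. snd x = ereal a \<and> snd y = ereal b \<and> \<bar>a - b\<bar> \<le> \<delta>"
    then obtain a b where ab: "snd x = ereal a" "snd y = ereal b" "\<bar>a - b\<bar> \<le> \<delta>" by blast
    obtain c where "snd z = ereal c" "\<bar>b - c\<bar> \<le> \<delta>'"
      using yz(2) ab(2) assms(2) by (metis abs_zero cancel_comm_monoid_add_class.diff_cancel ereal.inject)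
    then show ?thesis using ab by (intro disjI2 exI[of _ a] exI[of _ c]) auto
  qed
  ultimately show ?thesis using assms(1,2) by (subst point_dist_le_iff) auto
qed

lemma matched_trans:
  assumes "0 \<le> \<delta>" "0 \<le> \<delta>'" "matched \<delta> D1 D2" "matched \<delta>' D2 D3"
  shows "matched (\<delta> + \<delta>') D1 D3"
proof -
  obtain \<gamma> where g: "bij_betw \<gamma> (dplus D1) (dplus D2)" "\<And>x. x \<in> dplus D1 \<Longrightarrow> point_dist (fst x) (fst (\<gamma> x)) \<le> ereal \<delta>"
    using assms(3) unfolding matched_def by blast
  obtain \<gamma>' where g': "bij_betw \<gamma>' (dplus D2) (dplus D3)" "\<And>x. x \<in> dplus D2 \<Longrightarrow> point_dist (fst x) (fst (\<gamma>' x)) \<le> ereal \<delta>'"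
    using assms(4) unfolding matched_def by blast
  have "bij_betw (\<gamma>' \<circ> \<gamma>) (dplus D1) (dplus D3)" using g(1) g'(1) by (rule bij_betw_trans)
  moreover have "point_dist (fst x) (fst ((\<gamma>' \<circ> \<gamma>) x)) \<le> ereal (\<delta> + \<delta>')" if "x \<in> dplus D1" for x
    using point_dist_triangle[OF assms(1,2) g(2)[OF that] g'(2)] g(1) that by (auto dest: bij_betwE)
  ultimately show ?thesis unfolding matched_def by blast
qed

lemma matched_sym:
  assumes "0 \<le> \<delta>" "matched \<delta> D1 D2"
  shows "matched \<delta> D2 D1"
proof -
  obtain \<gamma> where g: "bij_betw \<gamma> (dplus D1) (dplus D2)" "\<And>x. x \<in> dplus D1 \<Longrightarrow> point_dist (fst x) (fst (\<gamma> x)) \<le> ereal \<delta>"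
    using assms unfolding matched_def by blast
  have "point_dist (fst y) (fst (inv_into (dplus D1) \<gamma> y)) \<le> ereal \<delta>" if y: "y \<in> dplus D2" for y
  proof -
    have "inv_into (dplus D1) \<gamma> y \<in> dplus D1" "\<gamma> (inv_into (dplus D1) \<gamma> y) = y"
      using g(1) y by (auto simp: bij_betw_def intro: inv_into_into f_inv_into_f)
    with g(2)[of "inv_into (dplus D1) \<gamma> y"] show ?thesis
      using assms(1) by (auto simp: point_dist_le_iff abs_minus_commute)
  qed
  then show ?thesis using bij_betw_inv_into[OF g(1)] unfolding matched_def by blast
qed

lemma matched_dplus_eq:
  assumes "0 \<le> \<delta>" "dplus D1 = dplus D2"
  shows "matched \<delta> D1 D2"
  unfolding matched_def
  using assms by (intro exI[of _ id]) (simp add: point_dist_le_iff)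

text \<open>All points, including those of the diagonal, are finite here, so the required bijection
  between infinite points is one between empty sets.\<close>

lemma d_B_le:
  assumes "matched \<delta> D1 D2" "\<And>x. x \<in># D1 \<Longrightarrow> snd x \<noteq> \<infinity>" "\<And>x. x \<in># D2 \<Longrightarrow> snd x \<noteq> \<infinity>"
  shows "d_B D1 D2 \<le> ereal \<delta>"
proof -
  obtain \<gamma> where g: "bij_betw \<gamma> (dplus D1) (dplus D2)" "\<And>x. x \<in> dplus D1 \<Longrightarrow> point_dist (fst x) (fst (\<gamma> x)) \<le> ereal \<delta>"
    using assms(1) unfolding matched_def by blast
  have e: "{x \<in> dplus D. snd (fst x) = \<infinity>} = {}" if "\<And>x. x \<in># D \<Longrightarrow> snd x \<noteq> \<infinity>" for D
  proof -
    have "snd x \<noteq> \<infinity>" if "(x, k) \<in> dplus D" for x k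
      using that \<open>\<And>x. x \<in># D \<Longrightarrow> snd x \<noteq> \<infinity>\<close>[of x] by (auto simp: dplus_def simp flip: count_greater_zero_iff)
    then show ?thesis by fastforce
  qed
  have e1: "{x \<in> dplus D1. snd (fst x) = \<infinity>} = {}" by (rule e) (rule assms(2))
  have e2: "{x \<in> dplus D2. snd (fst x) = \<infinity>} = {}" by (rule e) (rule assms(3))
  have "bij_betw \<gamma> {x \<in> dplus D1. snd (fst x) = \<infinity>} {x \<in> dplus D2. snd (fst x) = \<infinity>}"
    unfolding e1 e2 by (simp add: bij_betw_def)
  then have "bottleneck_matching D1 D2 \<gamma>"
    using g(1) unfolding bottleneck_matching_def by blast
  then show ?thesis
    unfolding d_B_def using g(2) by (intro INF_lower2[of \<gamma>] SUP_least) auto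
qed

section \<open>Adding points to matched diagrams\<close>

lemma dplus_add_diagonal: "ereal (fst a) = snd a \<Longrightarrow> dplus (add_mset a D) = dplus D"
  by (auto simp: dplus_def split: if_splits)

lemma dplus_add_off_diagonal:
  assumes "ereal (fst a) \<noteq> snd a"
  shows "dplus (add_mset a D) = insert (a, count D a) (dplus D)" "(a, count D a) \<notin> dplus D"
  using assms by (auto simp: dplus_def less_Suc_eq split: if_splits)

text \<open>The new copies of \<open>a\<close> and \<open>b\<close> are matched with each other. If
  \<open>b\<close> lies on the diagonal, adding it creates no new label, and a copy has to be freed
  among the infinitely many already present.\<close>

lemma matched_add_off_diagonal:
  assumes "0 \<le> \<delta>" "matched \<delta> D1 D2" "point_dist a b \<le> ereal \<delta>" "ereal (fst a) \<noteq> snd a"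
  shows "matched \<delta> (add_mset a D1) (add_mset b D2)"
proof -
  obtain \<gamma> where g: "bij_betw \<gamma> (dplus D1) (dplus D2)" "\<And>x. x \<in> dplus D1 \<Longrightarrow> point_dist (fst x) (fst (\<gamma> x)) \<le> ereal \<delta>"
    using assms unfolding matched_def by blast
  note a = dplus_add_off_diagonal[OF assms(4), of D1]
  have ext: "matched \<delta> (add_mset a D1) (add_mset b D2)"
    if h: "bij_betw h (dplus D1) Y" "\<And>x. x \<in> dplus D1 \<Longrightarrow> fst (h x) = fst (\<gamma> x)"
      and Y: "dplus (add_mset b D2) = insert (b, k) Y" "(b, k) \<notin> Y" for h Y k
  proof -
    let ?h = "h((a, count D1 a) := (b, k))"
    have "bij_betw ?h (dplus D1) Y" using h(1) by (rule bij_betw_cong[THEN iffD1, rotated]) (use a(2) in auto)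
    then have "bij_betw ?h (dplus (add_mset a D1)) (dplus (add_mset b D2))"
      unfolding a(1) Y(1) using a(2) Y(2) by (auto simp: bij_betw_def)
    moreover have "point_dist (fst x) (fst (?h x)) \<le> ereal \<delta>" if "x \<in> dplus (add_mset a D1)" for x
    proof (cases "x = (a, count D1 a)")
      case False
      then have "x \<in> dplus D1" using that a(1) by blast
      then show ?thesis using g(2)[of x] h(2)[of x] False by simp
    qed (simp add: assms(3))
    ultimately show ?thesis unfolding matched_def by blast
  qed
  show ?thesis
  proof (cases "ereal (fst b) = snd b")
    case False
    then show ?thesis using ext[OF g(1) refl] dplus_add_off_diagonal[OF False] by blast
  next
    case True
    \<comment> \<open>Shifts the labels of the copies of \<open>b\<close> by one. This frees the
      copy with label 0 and moves no point.\<close>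
    define h where "h = (\<lambda>(x, k). if x = b then (x, Suc k) else (x, k))"
    have "bij_betw h (dplus D2) (dplus D2 - {(b, 0)})"
    proof (rule bij_betw_imageI)
      show "inj_on h (dplus D2)" by (auto simp: inj_on_def h_def split: if_splits)
      show "h ` dplus D2 = dplus D2 - {(b, 0)}"
      proof (intro equalityI subsetI)
        fix y assume "y \<in> h ` dplus D2"
        then obtain x k where "(x, k) \<in> dplus D2" "y = h (x, k)" by auto
        then show "y \<in> dplus D2 - {(b, 0)}" using True by (cases "x = b") (auto simp: h_def dplus_def)
      next
        fix y assume y: "y \<in> dplus D2 - {(b, 0)}"
        obtain x k where xk: "y = (x, k)" by fastforce
        let ?y = "(x, if x = b then k - 1 else k)"
        have "?y \<in> dplus D2" using y True by (auto simp: dplus_def xk)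
        moreover have "h ?y = y" using y by (auto simp: h_def xk)
        ultimately show "y \<in> h ` dplus D2" by (metis imageI)
      qed
    qed
    then have "bij_betw (h \<circ> \<gamma>) (dplus D1) (dplus D2 - {(b, 0)})" by (rule bij_betw_trans[OF g(1)])
    moreover have "fst ((h \<circ> \<gamma>) x) = fst (\<gamma> x)" for x by (simp add: h_def case_prod_unfold)
    moreover have "dplus (add_mset b D2) = insert (b, 0) (dplus D2 - {(b, 0)})"
      using True by (auto simp: dplus_add_diagonal) (auto simp: dplus_def)
    ultimately show ?thesis by (intro ext[where Y = "dplus D2 - {(b, 0)}" and k = 0]) blast+
  qed
qed

lemma matched_add:
  assumes "0 \<le> \<delta>" "matched \<delta> D1 D2" "point_dist a b \<le> ereal \<delta>"
  shows "matched \<delta> (add_mset a D1) (add_mset b D2)"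
proof (cases "ereal (fst a) = snd a")
  case False
  then show ?thesis using matched_add_off_diagonal assms by blast
next
  case a: True
  show ?thesis
  proof (cases "ereal (fst b) = snd b")
    case True
    then show ?thesis using a assms(2) by (simp add: matched_def dplus_add_diagonal)
  next
    case False
    have "point_dist b a \<le> ereal \<delta>" using assms(1,3) by (auto simp: point_dist_le_iff abs_minus_commute)
    then have "matched \<delta> (add_mset b D2) (add_mset a D1)"
      using matched_add_off_diagonal[OF assms(1) matched_sym[OF assms(1,2)] _ False] by blast
    then show ?thesis by (rule matched_sym[OF assms(1)])
  qed
qed

lemma matched_image:
  assumes "0 \<le> \<delta>" "\<And>x. x \<in># M \<Longrightarrow> point_dist (f x) (g x) \<le> ereal \<delta>"
  shows "matched \<delta> (image_mset f M) (image_mset g M)"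
  using assms(2)
proof (induction M)
  case empty
  then show ?case using matched_dplus_eq[OF assms(1)] by simp
next
  case (add x M)
  then show ?case by (simp add: matched_add[OF assms(1)])
qed

text \<open>Each local estimate compares only with its centre \<open>s\<close>, in a radius that may
  depend on \<open>s\<close>. The supremum of the parameters reached with constant \<open>L\<close>
  is itself reached, by the estimate around it, and the same estimate leads beyond it if it is below
  1. The bounds add up exactly because the parameters increase.\<close>

lemma matched_path:
  assumes "0 \<le> L"
    and loc: "\<And>s. s \<in> {0..1} \<Longrightarrow> \<exists>\<delta>>0. \<forall>s'\<in>{0..1}. \<bar>s - s'\<bar> < \<delta> \<longrightarrow> matched (L * \<bar>s - s'\<bar>) (D s) (D s')"
  shows "matched L (D 0) (D (1::real))"
proof -
  define T where "T = {s \<in> {0..1}. matched (L * s) (D 0) (D s)}"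
  have step: "s' \<in> T" if "s \<in> T" "s \<le> s'" "s' \<le> 1" "matched (L * (s' - s)) (D s) (D s')" for s s'
  proof -
    have "matched (L * s + L * (s' - s)) (D 0) (D s')"
      using that assms(1) by (intro matched_trans[of _ _ _ "D s"]) (auto simp: T_def)
    moreover have "L * s + L * (s' - s) = L * s'" by (simp add: algebra_simps)
    ultimately show ?thesis using that by (simp add: T_def)
  qed
  have T0: "0 \<in> T" by (simp add: T_def matched_dplus_eq)
  have bdd: "bdd_above T" by (rule bdd_aboveI[of _ 1]) (simp add: T_def)
  define u where "u = Sup T"
  have u01: "0 \<le> u" "u \<le> 1"
  proof -
    show "0 \<le> u" unfolding u_def by (rule cSup_upper[OF T0 bdd])
    show "u \<le> 1" unfolding u_def
    proof (rule cSup_least)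
      show "T \<noteq> {}" using T0 by blast
    qed (simp add: T_def)
  qed
  obtain \<delta> where d: "\<delta> > 0" "\<And>s'. s' \<in> {0..1} \<Longrightarrow> \<bar>u - s'\<bar> < \<delta> \<Longrightarrow> matched (L * \<bar>u - s'\<bar>) (D u) (D s')"
    using loc[of u] u01 by auto
  obtain s where s: "s \<in> T" "u - \<delta> < s"
    using less_cSupD[of T "u - \<delta>"] T0 d(1) unfolding u_def[symmetric] by auto
  have su: "s \<le> u" using cSup_upper[OF s(1) bdd] by (simp add: u_def)
  have s01: "s \<in> {0..1}" using s(1) by (simp add: T_def)
  have us: "\<bar>u - s\<bar> = u - s" using su by simp
  then have "matched (L * \<bar>u - s\<bar>) (D u) (D s)" using s(2) by (intro d(2)[OF s01]) simp
  then have "matched (L * (u - s)) (D u) (D s)" by (simp only: us)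
  then have "matched (L * (u - s)) (D s) (D u)" using su assms(1) by (intro matched_sym[of _ "D u" "D s"]) simp_all
  then have uT: "u \<in> T" using step[OF s(1) su u01(2)] by simp
  have "u = 1"
  proof (rule ccontr)
    assume "u \<noteq> 1"
    define s' where "s' = min 1 (u + \<delta> / 2)"
    have s': "u < s'" "s' \<le> 1" "\<bar>u - s'\<bar> < \<delta>" "0 \<le> s'" using \<open>u \<noteq> 1\<close> u01 d(1) by (simp_all add: s'_def min_def)
    have us': "\<bar>u - s'\<bar> = s' - u" using s'(1) by simp
    have "matched (L * \<bar>u - s'\<bar>) (D u) (D s')" using s' by (intro d(2)) simp_all
    then have "matched (L * (s' - u)) (D u) (D s')" by (simp only: us')
    then have "s' \<in> T" using step[OF uT, of s'] s' by simp
    then have "s' \<le> u" using cSup_upper[OF _ bdd] by (simp add: u_def)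
    then show False using s'(1) by simp
  qed
  then show ?thesis using uT by (simp add: T_def)
qed

section \<open>Snapping endpoints to separated times\<close>

lemma count_image_mset_filter: "count (image_mset f M) x = size {#q\<in>#M. f q = x#}"
  by (induction M) auto

abbreviation emb :: "real \<times> real \<Rightarrow> real \<times> ereal" where
  "emb q \<equiv> (fst q, ereal (snd q))"

text \<open>Moving each endpoint to the nearby element of \<open>C\<close> costs at most \<eta>.
  Afterwards the multiplicity at (\<open>c\<close>, \<open>c'\<close>) with \<open>c < c'\<close>
  counts the original pairs in a box of half-width \<gamma>, and this is determined by the quadrant
  counts at its four corners. What remains undetermined lies on the diagonal, where
  \<open>dplus\<close> has infinitely many copies anyway.\<close>

lemma matched_snap:
  fixes Q Q' :: "(real \<times> real) multiset"
  assumes sep: "\<And>c c'. c \<in> C \<Longrightarrow> c' \<in> C \<Longrightarrow> c \<noteq> c' \<Longrightarrow> 2 * \<gamma> < \<bar>c - c'\<bar>"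
    and \<eta>: "0 \<le> \<eta>" "\<eta> < \<gamma>"
    and Q: "\<And>x y. (x, y) \<in># Q \<Longrightarrow> x \<le> y \<and> (\<exists>c\<in>C. \<bar>x - c\<bar> \<le> \<eta>) \<and> (\<exists>c\<in>C. \<bar>y - c\<bar> \<le> \<eta>)"
    and Q': "\<And>x y. (x, y) \<in># Q' \<Longrightarrow> x \<le> y \<and> x \<in> C \<and> y \<in> C"
    and counts: "\<And>c c' s t. c \<in> C \<Longrightarrow> c' \<in> C \<Longrightarrow> s \<in> {c - \<gamma>, c + \<gamma>} \<Longrightarrow> t \<in> {c' - \<gamma>, c' + \<gamma>} \<Longrightarrow> s \<le> t \<Longrightarrow>
      size {#q\<in>#Q. fst q \<le> s \<and> t < snd q#} = size {#q\<in>#Q'. fst q \<le> s \<and> t < snd q#}"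
  shows "matched \<eta> (image_mset emb Q) (image_mset emb Q')"
proof -
  define snap where "snap t = (SOME c. c \<in> C \<and> \<bar>t - c\<bar> < \<gamma>)" for t
  have snap: "snap t = c" if "c \<in> C" "\<bar>t - c\<bar> < \<gamma>" for t c
  proof -
    have *: "snap t \<in> C \<and> \<bar>t - snap t\<bar> < \<gamma>"
      unfolding snap_def by (rule someI[where P = "\<lambda>c. c \<in> C \<and> \<bar>t - c\<bar> < \<gamma>"]) (use that in blast)
    show ?thesis using sep[of c "snap t"] * that by linarith
  qed
  define f where "f q = (snap (fst q), snap (snd q))" for q
  have count: "count (image_mset (\<lambda>q. emb (f q)) R) (c, z) =
      (if c \<in> C \<and> (\<exists>c'\<in>C. z = ereal c' \<and> c < c') then
        size {#q\<in>#R. (fst q \<le> c + \<gamma> \<and> \<not> fst q \<le> c - \<gamma>) \<and> (real_of_ereal z - \<gamma> < snd q \<and> \<not> real_of_ereal z + \<gamma> < snd q)#}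
      else 0)"
    if z: "ereal c \<noteq> z" and R: "\<forall>x y. (x, y) \<in># R \<longrightarrow> x \<le> y \<and> (\<exists>c\<in>C. \<bar>x - c\<bar> \<le> \<eta>) \<and> (\<exists>c\<in>C. \<bar>y - c\<bar> \<le> \<eta>)" for R c z
  proof -
    have q: "fst q \<le> snd q" "snap (fst q) \<in> C" "\<bar>fst q - snap (fst q)\<bar> < \<gamma>"
      "snap (snd q) \<in> C" "\<bar>snd q - snap (snd q)\<bar> < \<gamma>" if qR: "q \<in># R" for q
    proof -
      obtain c c' where c: "fst q \<le> snd q" "c \<in> C" "\<bar>fst q - c\<bar> \<le> \<eta>" "c' \<in> C" "\<bar>snd q - c'\<bar> \<le> \<eta>"
        using R[rule_format, of "fst q" "snd q"] qR by auto
      have "snap (fst q) = c" "snap (snd q) = c'" using c \<eta> by (auto intro!: snap)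
      then show "fst q \<le> snd q" "snap (fst q) \<in> C" "\<bar>fst q - snap (fst q)\<bar> < \<gamma>"
      "snap (snd q) \<in> C" "\<bar>snd q - snap (snd q)\<bar> < \<gamma>" using c \<eta> by auto
    qed
    show ?thesis
    proof (cases "c \<in> C \<and> (\<exists>c'\<in>C. z = ereal c' \<and> c < c')")
      case True
      then obtain c' where c': "c \<in> C" "c' \<in> C" "z = ereal c'" "c < c'" by blast
      have "emb (f q) = (c, z) \<longleftrightarrow>
        (fst q \<le> c + \<gamma> \<and> \<not> fst q \<le> c - \<gamma>) \<and> (c' - \<gamma> < snd q \<and> \<not> c' + \<gamma> < snd q)" if "q \<in># R" for q
      proof -
        have 1: "t \<le> c + \<gamma> \<and> \<not> t \<le> c - \<gamma> \<longleftrightarrow> snap t = c" if "snap t \<in> C" "\<bar>t - snap t\<bar> < \<gamma>" for t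
          using sep[OF c'(1) that(1)] that(2) by (cases "snap t = c") (auto simp: abs_if split: if_splits)
        have 2: "c' - \<gamma> < t \<and> \<not> c' + \<gamma> < t \<longleftrightarrow> snap t = c'" if "snap t \<in> C" "\<bar>t - snap t\<bar> < \<gamma>" for t
          using sep[OF c'(2) that(1)] that(2) by (cases "snap t = c'") (auto simp: abs_if split: if_splits)
        show ?thesis using 1[OF q(2,3)] 2[OF q(4,5)] that by (simp add: f_def c'(3))
      qed
      then have "{#q\<in>#R. emb (f q) = (c, z)#} =
        {#q\<in>#R. (fst q \<le> c + \<gamma> \<and> \<not> fst q \<le> c - \<gamma>) \<and> (real_of_ereal z - \<gamma> < snd q \<and> \<not> real_of_ereal z + \<gamma> < snd q)#}"
        by (intro filter_mset_cong) (auto simp: c'(3))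
      then show ?thesis using True by (simp add: count_image_mset_filter)
    next
      case False
      have "emb (f q) \<noteq> (c, z)" if "q \<in># R" for q
      proof
        assume *: "emb (f q) = (c, z)"
        then have c: "c = snap (fst q)" "z = ereal (snap (snd q))" by (auto simp: f_def)
        \<comment> \<open>Snapping keeps the order of birth and death: a reversal would leave them
          more than 2 \<gamma> apart, although each has moved by less than \<gamma>.\<close>
        then have "snap (snd q) < snap (fst q)" using False z q(2,4)[OF that] by force
        then have "2 * \<gamma> < snap (fst q) - snap (snd q)" using sep[OF q(2)[OF that] q(4)[OF that]] by simp
        then show False using q(1,3,5)[OF that] by linarith
      qed
      then have "{#q\<in>#R. emb (f q) = (c, z)#} = {#q\<in>#R. False#}" by (intro filter_mset_cong) auto
      then have "{#q\<in>#R. emb (f q) = (c, z)#} = {#}" by simp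
      then show ?thesis using False by (simp only: count_image_mset_filter size_empty if_False)
    qed
  qed
  have R: "\<forall>x y. (x, y) \<in># Q \<longrightarrow> x \<le> y \<and> (\<exists>c\<in>C. \<bar>x - c\<bar> \<le> \<eta>) \<and> (\<exists>c\<in>C. \<bar>y - c\<bar> \<le> \<eta>)"
    using Q by blast
  have "\<bar>x - x\<bar> \<le> \<eta>" for x :: real using \<eta>(1) by simp
  then have R': "\<forall>x y. (x, y) \<in># Q' \<longrightarrow> x \<le> y \<and> (\<exists>c\<in>C. \<bar>x - c\<bar> \<le> \<eta>) \<and> (\<exists>c\<in>C. \<bar>y - c\<bar> \<le> \<eta>)"
    using Q' by blast
  have eq: "count (image_mset (\<lambda>q. emb (f q)) Q) (c, z) = count (image_mset (\<lambda>q. emb (f q)) Q') (c, z)"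
    if z: "ereal c \<noteq> z" for c z
  proof (cases "c \<in> C \<and> (\<exists>c'\<in>C. z = ereal c' \<and> c < c')")
    case True
    then obtain c' where c': "c \<in> C" "c' \<in> C" "z = ereal c'" "c < c'" by blast
    \<comment> \<open>Hence all four corners satisfy \<open>s \<le> t\<close>, as the hypothesis on
      the counts demands.\<close>
    have lt: "c + \<gamma> < c' - \<gamma>" using sep[OF c'(1,2)] c'(4) by simp
    have g: "0 < \<gamma>" using \<eta> by simp
    let ?P = "\<lambda>q::real \<times> real. fst q \<le> c + \<gamma>" and ?P' = "\<lambda>q::real \<times> real. fst q \<le> c - \<gamma>"
      and ?R = "\<lambda>q::real \<times> real. c' - \<gamma> < snd q" and ?R' = "\<lambda>q::real \<times> real. c' + \<gamma> < snd q"
    have rect: "size {#x\<in>#M. (?P x \<and> \<not> ?P' x) \<and> (?R x \<and> \<not> ?R' x)#} + size {#x\<in>#M. ?P' x \<and> ?R x#} + size {#x\<in>#M. ?P x \<and> ?R' x#}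
      = size {#x\<in>#M. ?P x \<and> ?R x#} + size {#x\<in>#M. ?P' x \<and> ?R' x#}" for M
      using g by (intro size_filter_rectangle) auto
    have "size {#q\<in>#Q. fst q \<le> s \<and> t < snd q#} = size {#q\<in>#Q'. fst q \<le> s \<and> t < snd q#}"
      if "s \<in> {c - \<gamma>, c + \<gamma>}" "t \<in> {c' - \<gamma>, c' + \<gamma>}" for s t
      using counts[OF c'(1,2) that] that lt g by fastforce
    then have "size {#x\<in>#Q. (?P x \<and> \<not> ?P' x) \<and> (?R x \<and> \<not> ?R' x)#} = size {#x\<in>#Q'. (?P x \<and> \<not> ?P' x) \<and> (?R x \<and> \<not> ?R' x)#}"
      using rect[of Q] rect[of Q'] by simp
    then show ?thesis using True unfolding count[OF z R] count[OF z R'] by (simp add: c'(3))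
  next
    case False
    then show ?thesis unfolding count[OF z R] count[OF z R'] by (simp only: if_False)
  qed
  have "dplus (image_mset (\<lambda>q. emb (f q)) Q) = dplus (image_mset (\<lambda>q. emb (f q)) Q')"
  proof -
    have "k < count (image_mset (\<lambda>q. emb (f q)) Q) x \<or> ereal (fst x) = snd x \<longleftrightarrow>
      k < count (image_mset (\<lambda>q. emb (f q)) Q') x \<or> ereal (fst x) = snd x" for x k
      using eq[of "fst x" "snd x"] by (cases "ereal (fst x) = snd x") simp_all
    then show ?thesis unfolding dplus_def by simp
  qed
  also have "image_mset (\<lambda>q. emb (f q)) Q' = image_mset emb Q'"
  proof (rule image_mset_cong)
    fix q assume "q \<in># Q'"
    then have "fst q \<in> C" "snd q \<in> C" using Q'[of "fst q" "snd q"] by auto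
    then have "snap (fst q) = fst q" "snap (snd q) = snd q" using \<eta> by (auto intro!: snap)
    then show "emb (f q) = emb q" by (simp add: f_def)
  qed
  finally have "matched 0 (image_mset (\<lambda>q. emb (f q)) Q) (image_mset emb Q')"
    by (intro matched_dplus_eq) auto
  moreover have "matched \<eta> (image_mset emb Q) (image_mset (\<lambda>q. emb (f q)) Q)"
  proof (rule matched_image[OF \<eta>(1)])
    fix q assume "q \<in># Q"
    then obtain c c' where c: "c \<in> C" "\<bar>fst q - c\<bar> \<le> \<eta>" "c' \<in> C" "\<bar>snd q - c'\<bar> \<le> \<eta>"
      using Q[of "fst q" "snd q"] by auto
    then have "snap (fst q) = c" "snap (snd q) = c'" using \<eta> by (auto intro!: snap)
    then show "point_dist (emb q) (emb (f q)) \<le> ereal \<eta>"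
      using c \<eta>(1) by (subst point_dist_le_iff) (auto simp: f_def)
  qed
  ultimately show ?thesis using matched_trans[OF \<eta>(1), of 0] by simp
qed

section \<open>The event list of a sequence\<close>

lemma sorted_wrt_unique:
  assumes "antisym r" "sorted_wrt (\<lambda>a b. (a, b) \<in> r) xs" "sorted_wrt (\<lambda>a b. (a, b) \<in> r) ys"
    "distinct xs" "distinct ys" "set xs = set ys"
  shows "xs = ys"
  using assms(2-)
proof (induction xs arbitrary: ys)
  case (Cons x xs)
  then obtain y ys' where y: "ys = y # ys'" by (cases ys) auto
  have "x = y"
  proof (rule ccontr)
    assume "x \<noteq> y"
    then have "x \<in> set ys'" "y \<in> set xs" using Cons.prems(5) y by auto
    then have "(y, x) \<in> r" "(x, y) \<in> r" using Cons.prems(1,2) y by auto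
    then show False using assms(1) \<open>x \<noteq> y\<close> by (auto dest: antisymD)
  qed
  moreover have "set xs = set ys'" using Cons.prems(3,4,5) y \<open>x = y\<close> by auto
  ultimately show ?case using Cons y by auto
qed simp

text \<open>Insertion into a sorted list: everything from the first element not below
  \<open>x\<close> onwards lies above \<open>x\<close>, by totality and transitivity.\<close>

lemma sorted_wrt_exists:
  assumes "finite A" "linear_order_on E r" "A \<subseteq> E"
  shows "\<exists>xs. set xs = A \<and> distinct xs \<and> sorted_wrt (\<lambda>a b. (a, b) \<in> r) xs"
  using assms(1,3)
proof (induction A)
  case (insert x A)
  then obtain xs where xs: "set xs = A" "distinct xs" "sorted_wrt (\<lambda>a b. (a, b) \<in> r) xs" by auto
  have trans: "trans r" and total: "total_on E r"
    using assms(2) by (auto simp: linear_order_on_def partial_order_on_def preorder_on_def)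
  let ?P = "\<lambda>y. (y, x) \<in> r"
  let ?ys = "takeWhile ?P xs @ x # dropWhile ?P xs"
  have s: "sorted_wrt (\<lambda>a b. (a, b) \<in> r) (takeWhile ?P xs @ dropWhile ?P xs)" using xs(3) by simp
  have gt: "(x, y) \<in> r" if "y \<in> set (dropWhile ?P xs)" for y
  proof -
    obtain z zs where z: "dropWhile ?P xs = z # zs" using \<open>y \<in> set (dropWhile ?P xs)\<close> by (cases "dropWhile ?P xs") auto
    have "\<not> ?P z" using hd_dropWhile[of ?P xs] z by simp
    moreover have "z \<in> A" using z xs(1) set_dropWhileD[of z ?P xs] by simp
    moreover have "x \<in> E" "z \<in> E" "z \<noteq> x" using insert.prems insert.hyps \<open>z \<in> A\<close> by auto
    ultimately have "(x, z) \<in> r" using total unfolding total_on_def by blast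
    moreover have "y = z \<or> (z, y) \<in> r" using s z that by (auto simp: sorted_wrt_append)
    ultimately show ?thesis using trans by (auto dest: transD)
  qed
  have "sorted_wrt (\<lambda>a b. (a, b) \<in> r) ?ys"
    using s gt unfolding sorted_wrt_append by (auto dest: set_takeWhileD)
  moreover have "mset (takeWhile ?P xs) + mset (dropWhile ?P xs) = mset xs"
    by (metis mset_append takeWhile_dropWhile_id)
  then have "mset ?ys = mset (x # xs)" by simp
  then have "set ?ys = set (x # xs)" "distinct ?ys \<longleftrightarrow> distinct (x # xs)"
    by (rule mset_eq_setD, rule mset_eq_imp_distinct_iff)
  then have "set ?ys = insert x A" "distinct ?ys" using xs insert.hyps by simp_all
  ultimately show ?case by blast
qed simp

lemma sort_events:
  assumes "finite A" "linear_order_on E r" "A \<subseteq> E"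
  shows "set (sort_events r A) = A" "distinct (sort_events r A)" "sorted_wrt (\<lambda>a b. (a, b) \<in> r) (sort_events r A)"
proof -
  obtain xs where xs: "set xs = A \<and> distinct xs \<and> sorted_wrt (\<lambda>a b. (a, b) \<in> r) xs"
    using sorted_wrt_exists[OF assms] by blast
  have "antisym r" using assms(2) by (simp add: linear_order_on_def partial_order_on_def)
  then have "sort_events r A = xs"
    unfolding sort_events_def using xs by (intro the_equality) (auto intro: sorted_wrt_unique)
  then show "set (sort_events r A) = A" "distinct (sort_events r A)" "sorted_wrt (\<lambda>a b. (a, b) \<in> r) (sort_events r A)"
    using xs by auto
qed

text \<open>A form of \<open>valid_events\<close> that starts from an arbitrary complex and
  therefore splits along concatenations, as the treatment of groups of simultaneous events
  requires.\<close>

fun valid_from :: "'v set set \<Rightarrow> 'v event list \<Rightarrow> bool" where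
  "valid_from L [] \<longleftrightarrow> simplicial_complex L"
| "valid_from L (e # es) \<longleftrightarrow> simplicial_complex L \<and> (case e of Ins \<sigma> \<Rightarrow> \<sigma> \<notin> L | Del \<sigma> \<Rightarrow> \<sigma> \<in> L) \<and>
     valid_from (apply_event e L) es"

lemma valid_from_append:
  "valid_from L (xs @ ys) \<longleftrightarrow> valid_from L xs \<and> valid_from (fold apply_event xs L) ys"
proof (induction xs arbitrary: L)
  case Nil
  show ?case by (cases ys) auto
qed auto

lemma valid_from_nth:
  assumes "valid_from L es"
  shows "i \<le> length es \<Longrightarrow> simplicial_complex (fold apply_event (take i es) L)"
    and "i < length es \<Longrightarrow> case es ! i of Ins \<sigma> \<Rightarrow> \<sigma> \<notin> fold apply_event (take i es) L
          | Del \<sigma> \<Rightarrow> \<sigma> \<in> fold apply_event (take i es) L"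
proof -
  have es: "take i es @ drop i es = es" by simp
  have v: "valid_from (fold apply_event (take i es) L) (drop i es)"
    using assms valid_from_append[of L "take i es" "drop i es"] by simp
  then show "simplicial_complex (fold apply_event (take i es) L)" by (cases "drop i es") auto
  show "case es ! i of Ins \<sigma> \<Rightarrow> \<sigma> \<notin> fold apply_event (take i es) L
          | Del \<sigma> \<Rightarrow> \<sigma> \<in> fold apply_event (take i es) L" if "i < length es"
    using v Cons_nth_drop_Suc[OF that] by (metis valid_from.simps(2))
qed

lemma valid_from_valid_events:
  assumes "valid_from {} es" shows "valid_events es"
  unfolding valid_events_def complex_after_def
  by (intro conjI allI impI valid_from_nth[OF assms])

context
  fixes K :: "'v set set" and r :: "'v event rel"
  assumes K: "simplicial_complex K" and r: "event_order K r"
begin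

text \<open>The first event of a group is minimal for \<open>r\<close>. If it inserts \<sigma>, a
  missing face of \<sigma> would lie in \<open>L\<close> and its insertion would come earlier; if it
  deletes \<sigma>, a larger simplex still present cannot lie in \<open>L\<close> and its deletion
  would come earlier. Hence every intermediate complex is closed under faces. The target
  \<open>L\<close> is fixed while \<open>M\<close> moves towards it.\<close>

lemma valid_from_group:
  assumes "simplicial_complex L" "simplicial_complex M" "L \<subseteq> K" "M \<subseteq> K"
    "set es = Ins ` (L - M) \<union> Del ` (M - L)" "distinct es" "sorted_wrt (\<lambda>a b. (a, b) \<in> r) es"
  shows "valid_from M es \<and> fold apply_event es M = L"
  using assms(2,4-)
proof (induction es arbitrary: M)
  case Nil
  then show ?case by auto
next
  case (Cons e es)
  have "antisym r" using r by (simp add: event_order_def linear_order_on_def partial_order_on_def)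
  then have first: "e' = e" if "e' \<in> set (e # es)" "(e', e) \<in> r" for e'
    using that Cons.prems(5) by (auto dest: antisymD)
  have ord: "(Ins \<tau>, Ins \<sigma>) \<in> r" "(Del \<sigma>, Del \<tau>) \<in> r" if "\<sigma> \<in> K" "\<tau> \<in> K" "\<tau> \<subseteq> \<sigma>" for \<sigma> \<tau>
    using r that by (auto simp: event_order_def)
  show ?case
  proof (cases e)
    case (Ins \<sigma>)
    then have \<sigma>: "\<sigma> \<in> L" "\<sigma> \<notin> M" using Cons.prems(3) by auto
    let ?M = "insert \<sigma> M"
    have "\<tau> \<in> ?M" if "\<tau> \<subseteq> \<sigma>" "\<tau> \<noteq> {}" for \<tau>
    proof (rule ccontr)
      assume \<tau>: "\<tau> \<notin> ?M"
      have "\<tau> \<in> L" using assms(1) \<sigma>(1) that unfolding simplicial_complex_def by blast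
      then have "Ins \<tau> \<in> set (e # es)" "(Ins \<tau>, e) \<in> r"
        using \<tau> Cons.prems(3) ord[of \<sigma> \<tau>] assms(3) \<sigma>(1) that(1) Ins by auto
      then show False using first[of "Ins \<tau>"] Ins \<tau> by simp
    qed
    moreover have "finite \<sigma>" "\<sigma> \<noteq> {}" using assms(1) \<sigma>(1) by (auto simp: simplicial_complex_def)
    ultimately have M: "simplicial_complex ?M"
      using Cons.prems(1) unfolding simplicial_complex_def by blast
    moreover have "set es = Ins ` (L - ?M) \<union> Del ` (?M - L)"
    proof -
      have "set es = set (e # es) - {e}" using Cons.prems(4) by auto
      also have "\<dots> = (Ins ` (L - M) \<union> Del ` (M - L)) - {e}" by (simp only: Cons.prems(3))
      also have "\<dots> = Ins ` (L - ?M) \<union> Del ` (?M - L)" using \<sigma> Ins by auto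
      finally show ?thesis .
    qed
    moreover have "?M \<subseteq> K" using Cons.prems(2) \<sigma>(1) assms(3) by auto
    ultimately have "valid_from ?M es \<and> fold apply_event es ?M = L"
      using Cons.IH[of ?M] Cons.prems(4,5) by simp
    then show ?thesis using Ins Cons.prems(1) \<sigma> by simp
  next
    case (Del \<sigma>)
    then have \<sigma>: "\<sigma> \<in> M" "\<sigma> \<notin> L" using Cons.prems(3) by auto
    let ?M = "M - {\<sigma>}"
    have "\<tau> \<noteq> \<sigma>" if "\<rho> \<in> ?M" "\<tau> \<subseteq> \<rho>" for \<rho> \<tau>
    proof
      assume "\<tau> = \<sigma>"
      moreover have "\<sigma> \<noteq> {}" using Cons.prems(1) \<sigma>(1) by (auto simp: simplicial_complex_def)
      ultimately have "\<rho> \<notin> L" using assms(1) \<sigma>(2) that(2) unfolding simplicial_complex_def by blast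
      then have "Del \<rho> \<in> set (e # es)" unfolding Cons.prems(3) using that(1) by blast
      moreover have "(Del \<rho>, e) \<in> r"
        unfolding Del using Cons.prems(2) \<sigma>(1) that \<open>\<tau> = \<sigma>\<close> by (intro ord(2)) auto
      ultimately show False using first[of "Del \<rho>"] Del that(1) by simp
    qed
    then have M: "simplicial_complex ?M"
      using Cons.prems(1) unfolding simplicial_complex_def by blast
    moreover have "set es = Ins ` (L - ?M) \<union> Del ` (?M - L)"
    proof -
      have "set es = set (e # es) - {e}" using Cons.prems(4) by auto
      also have "\<dots> = (Ins ` (L - M) \<union> Del ` (M - L)) - {e}" by (simp only: Cons.prems(3))
      also have "\<dots> = Ins ` (L - ?M) \<union> Del ` (?M - L)" using \<sigma> Del by auto
      finally show ?thesis .
    qed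
    moreover have "?M \<subseteq> K" using Cons.prems(2) by auto
    ultimately have "valid_from ?M es \<and> fold apply_event es ?M = L"
      using Cons.IH[of ?M] Cons.prems(4,5) by simp
    then show ?thesis using Del Cons.prems(1) \<sigma> by simp
  qed
qed

section \<open>Encoding a piecewise constant family of complexes\<close>

definition constant_between :: "(real \<Rightarrow> 'v set set) \<Rightarrow> real \<Rightarrow> real \<Rightarrow> bool" where
  "constant_between Kf a b \<longleftrightarrow> (\<forall>t\<in>{a..<b}. Kf t = Kf a)"

text \<open>The list has to contain all changes up to the end time \<open>e\<close>; a listed time
  at which nothing changes would contribute an empty group of events.\<close>

fun jumps_at :: "(real \<Rightarrow> 'v set set) \<Rightarrow> real \<Rightarrow> real \<Rightarrow> real list \<Rightarrow> bool" where
  "jumps_at Kf e T [] \<longleftrightarrow> constant_between Kf T e"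
| "jumps_at Kf e T (T' # ts) \<longleftrightarrow> T < T' \<and> constant_between Kf T T' \<and> jumps_at Kf e T' ts"

context
  fixes Kf :: "real \<Rightarrow> 'v set set"
begin

abbreviation enc :: "real list \<Rightarrow> (real \<times> 'v event) list" where
  "enc ts \<equiv> encode r (map (\<lambda>t. (t, Kf t)) ts)"

abbreviation group :: "real \<Rightarrow> real \<Rightarrow> 'v event list" where
  "group T T' \<equiv> sort_events r (Ins ` (Kf T' - Kf T) \<union> Del ` (Kf T - Kf T'))"

lemma group:
  assumes "Kf T \<subseteq> K" "Kf T' \<subseteq> K"
  shows "set (group T T') = Ins ` (Kf T' - Kf T) \<union> Del ` (Kf T - Kf T')" "distinct (group T T')"
    "sorted_wrt (\<lambda>a b. (a, b) \<in> r) (group T T')"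
proof -
  have "finite K" using K by (simp add: simplicial_complex_def)
  then have "finite (Kf T)" "finite (Kf T')" using assms finite_subset by auto
  then have fin: "finite (Ins ` (Kf T' - Kf T) \<union> Del ` (Kf T - Kf T'))" by auto
  have sub: "Ins ` (Kf T' - Kf T) \<union> Del ` (Kf T - Kf T') \<subseteq> Ins ` K \<union> Del ` K" using assms by auto
  have lin: "linear_order_on (Ins ` K \<union> Del ` K) r" using r by (simp add: event_order_def)
  show "set (group T T') = Ins ` (Kf T' - Kf T) \<union> Del ` (Kf T - Kf T')" "distinct (group T T')"
    "sorted_wrt (\<lambda>a b. (a, b) \<in> r) (group T T')"
    by (rule sort_events[OF fin lin sub])+
qed

lemma enc_Cons: "enc (T # T' # ts) = map (\<lambda>e. (T', e)) (group T T') @ enc (T' # ts)"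
  by simp

lemma enc_valid:
  assumes "\<And>t. t \<in> set (T # ts) \<Longrightarrow> simplicial_complex (Kf t) \<and> Kf t \<subseteq> K"
  shows "valid_from (Kf T) (map snd (enc (T # ts))) \<and>
    fold apply_event (map snd (enc (T # ts))) (Kf T) = Kf (last (T # ts))"
  using assms
proof (induction ts arbitrary: T)
  case Nil
  then show ?case by simp
next
  case (Cons T' ts)
  have "valid_from (Kf T) (group T T') \<and> fold apply_event (group T T') (Kf T) = Kf T'"
    using Cons.prems by (intro valid_from_group group) auto
  moreover have "valid_from (Kf T') (map snd (enc (T' # ts))) \<and>
      fold apply_event (map snd (enc (T' # ts))) (Kf T') = Kf (last (T' # ts))"
    using Cons.prems by (intro Cons.IH) auto
  moreover have "map snd (enc (T # T' # ts)) = group T T' @ map snd (enc (T' # ts))"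
    unfolding enc_Cons by (simp add: o_def)
  ultimately show ?case by (simp add: valid_from_append del: encode.simps list.map)
qed

text \<open>The previous listed time serves as \<open>a\<close>: the simplex has the opposite status
  on the whole interval from there to \<tau>. This information from the left of \<tau> is what later
  forces the value at \<tau> to be exactly \<epsilon>.\<close>

lemma enc_events:
  assumes "jumps_at Kf e T ts" "\<And>t. t \<in> set (T # ts) \<Longrightarrow> Kf t \<subseteq> K" "(\<tau>, ev) \<in> set (enc (T # ts))"
  shows "\<tau> \<in> set ts \<and> T < \<tau> \<and> (\<exists>a. T \<le> a \<and> a < \<tau> \<and> (case ev of
      Ins \<sigma> \<Rightarrow> \<sigma> \<in> Kf \<tau> \<and> (\<forall>s\<in>{a..<\<tau>}. \<sigma> \<notin> Kf s)
    | Del \<sigma> \<Rightarrow> \<sigma> \<notin> Kf \<tau> \<and> \<sigma> \<in> Kf a \<and> (\<forall>s\<in>{a..<\<tau>}. \<sigma> \<in> Kf s)))"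
  using assms
proof (induction ts arbitrary: T)
  case Nil
  then show ?case by simp
next
  case (Cons T' ts)
  have T: "T < T'" "constant_between Kf T T'" "jumps_at Kf e T' ts" using Cons.prems(1) by auto
  from Cons.prems(3) consider "\<tau> = T'" "ev \<in> set (group T T')" | "(\<tau>, ev) \<in> set (enc (T' # ts))"
    unfolding enc_Cons by auto
  then show ?case
  proof cases
    case 1
    have ev: "ev \<in> Ins ` (Kf T' - Kf T) \<union> Del ` (Kf T - Kf T')" using 1(2) group(1)[of T T'] Cons.prems(2) by simp
    then have "case ev of Ins \<sigma> \<Rightarrow> \<sigma> \<in> Kf \<tau> \<and> (\<forall>s\<in>{T..<\<tau>}. \<sigma> \<notin> Kf s)
      | Del \<sigma> \<Rightarrow> \<sigma> \<notin> Kf \<tau> \<and> \<sigma> \<in> Kf T \<and> (\<forall>s\<in>{T..<\<tau>}. \<sigma> \<in> Kf s)"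
    proof -
      have *: "\<sigma> \<in> Kf s \<longleftrightarrow> \<sigma> \<in> Kf T" if "s \<in> {T..<\<tau>}" for s \<sigma>
        using T(2) that 1(1) unfolding constant_between_def by blast
      show ?thesis
      proof (cases ev)
        case (Ins \<sigma>)
        then have "\<sigma> \<in> Kf \<tau>" "\<sigma> \<notin> Kf T" using ev 1(1) by auto
        then show ?thesis using * Ins by auto
      next
        case (Del \<sigma>)
        then have "\<sigma> \<notin> Kf \<tau>" "\<sigma> \<in> Kf T" using ev 1(1) by auto
        then show ?thesis using * Del by auto
      qed
    qed
    moreover have "\<tau> \<in> set (T' # ts)" "T < \<tau>" using T(1) 1(1) by auto
    ultimately show ?thesis by (intro conjI exI[of _ T]) (simp_all only: order_refl)
  next
    case 2
    have "\<tau> \<in> set ts \<and> T' < \<tau> \<and> (\<exists>a. T' \<le> a \<and> a < \<tau> \<and> (case ev of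
      Ins \<sigma> \<Rightarrow> \<sigma> \<in> Kf \<tau> \<and> (\<forall>s\<in>{a..<\<tau>}. \<sigma> \<notin> Kf s)
    | Del \<sigma> \<Rightarrow> \<sigma> \<notin> Kf \<tau> \<and> \<sigma> \<in> Kf a \<and> (\<forall>s\<in>{a..<\<tau>}. \<sigma> \<in> Kf s)))"
      using T(3) Cons.prems(2) 2 by (intro Cons.IH) auto
    then obtain a where a: "\<tau> \<in> set ts" "T' < \<tau>" "T' \<le> a" "a < \<tau>" "case ev of
      Ins \<sigma> \<Rightarrow> \<sigma> \<in> Kf \<tau> \<and> (\<forall>s\<in>{a..<\<tau>}. \<sigma> \<notin> Kf s)
    | Del \<sigma> \<Rightarrow> \<sigma> \<notin> Kf \<tau> \<and> \<sigma> \<in> Kf a \<and> (\<forall>s\<in>{a..<\<tau>}. \<sigma> \<in> Kf s)" by blast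
    moreover from this have "\<tau> \<in> set (T' # ts)" "T < \<tau>" "T \<le> a" using T(1) by simp_all
    ultimately show ?thesis by blast
  qed
qed

lemma enc_sorted:
  assumes "jumps_at Kf e T ts" "\<And>t. t \<in> set (T # ts) \<Longrightarrow> Kf t \<subseteq> K"
  shows "sorted (map fst (enc (T # ts)))"
  using assms
proof (induction ts arbitrary: T)
  case Nil
  then show ?case by simp
next
  case (Cons T' ts)
  have IH: "sorted (map fst (enc (T' # ts)))" using Cons.prems by (intro Cons.IH) auto
  have ge: "T' \<le> \<tau>" if \<tau>: "\<tau> \<in> set (map fst (enc (T' # ts)))" for \<tau>
  proof -
    obtain ev where "(\<tau>, ev) \<in> set (enc (T' # ts))" using \<tau> by (auto simp del: encode.simps list.map)
    then show ?thesis using enc_events[of e T' ts \<tau> ev] Cons.prems by fastforce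
  qed
  have "map fst (enc (T # T' # ts)) = replicate (length (group T T')) T' @ map fst (enc (T' # ts))"
    unfolding enc_Cons by (simp add: o_def map_replicate_const)
  then show ?case using IH ge by (simp add: sorted_append del: encode.simps list.map)
qed

text \<open>A time \<open>t\<close> cuts the event list between two groups, and whole groups lead
  from one listed complex to the next.\<close>

lemma enc_complex:
  assumes "jumps_at Kf e T ts" "\<And>t. t \<in> set (T # ts) \<Longrightarrow> simplicial_complex (Kf t) \<and> Kf t \<subseteq> K" "T \<le> t" "t < e"
  shows "fold apply_event (map snd (takeWhile (\<lambda>q. fst q \<le> t) (enc (T # ts)))) (Kf T) = Kf t"
  using assms
proof (induction ts arbitrary: T)
  case Nil
  then have "Kf t = Kf T" unfolding jumps_at.simps constant_between_def by (meson atLeastLessThan_iff)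
  then show ?case by simp
next
  case (Cons T' ts)
  show ?case
  proof (cases "t < T'")
    case True
    have "fst q > t" if "q \<in> set (enc (T # T' # ts))" for q
    proof -
      have "fst q \<in> set (T' # ts)"
        using enc_events[OF Cons.prems(1), of "fst q" "snd q"] that Cons.prems(2) by auto
      moreover have "sorted (map fst (enc (T' # ts)))"
        using Cons.prems by (intro enc_sorted[of e]) auto
      moreover have "T' \<le> fst q"
      proof -
        from that consider "fst q = T'" | "q \<in> set (enc (T' # ts))" unfolding enc_Cons by auto
        then show ?thesis
        proof cases
          case 2
          then show ?thesis using enc_events[of e T' ts "fst q" "snd q"] Cons.prems by fastforce
        qed simp
      qed
      ultimately show ?thesis using True by simp
    qed
    then have "takeWhile (\<lambda>q. fst q \<le> t) (enc (T # T' # ts)) = []"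
      by (intro takeWhile_eq_Nil_iff[THEN iffD2]) (metis hd_in_set not_le)
    moreover have "Kf t = Kf T"
      using Cons.prems(1,3) True unfolding jumps_at.simps constant_between_def by (meson atLeastLessThan_iff)
    ultimately show ?thesis by simp
  next
    case False
    have "takeWhile (\<lambda>q. fst q \<le> t) (enc (T # T' # ts)) =
        map (\<lambda>e. (T', e)) (group T T') @ takeWhile (\<lambda>q. fst q \<le> t) (enc (T' # ts))"
      unfolding enc_Cons using False by (intro takeWhile_append2) auto
    moreover have "fold apply_event (group T T') (Kf T) = Kf T'"
      using Cons.prems by (intro valid_from_group[THEN conjunct2] group) auto
    moreover have "fold apply_event (map snd (takeWhile (\<lambda>q. fst q \<le> t) (enc (T' # ts)))) (Kf T') = Kf t"
      using Cons.prems False by (intro Cons.IH) auto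
    ultimately show ?thesis by (simp add: o_def del: encode.simps list.map)
  qed
qed

end

lemma jumps_at_sorted:
  assumes "\<And>a b. 0 \<le> a \<Longrightarrow> b \<le> e \<Longrightarrow> {a<..<b} \<inter> J = {} \<Longrightarrow> \<forall>s\<in>{a..<b}. Kf s = Kf a"
    "sorted_wrt (<) (T # ts)" "0 \<le> T" "\<And>t. t \<in> J \<Longrightarrow> T < t \<Longrightarrow> t \<in> set ts" "\<And>t. t \<in> set ts \<Longrightarrow> t \<le> e"
  shows "jumps_at Kf e T ts"
  using assms(2-)
proof (induction ts arbitrary: T)
  case Nil
  then have "{T<..<e} \<inter> J = {}" by auto
  then show ?case using assms(1)[of T e] Nil.prems unfolding jumps_at.simps constant_between_def by blast
next
  case (Cons T' ts)
  have "{T<..<T'} \<inter> J = {}" using Cons.prems(1,3) by fastforce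
  then have "constant_between Kf T T'"
    unfolding constant_between_def using Cons.prems(2,4) by (intro assms(1)) auto
  moreover have "jumps_at Kf e T' ts"
    using Cons.prems by (intro Cons.IH) (auto dest: Cons.prems(3))
  ultimately show ?case using Cons.prems(1) by simp
qed

text \<open>The interface between sequences and persistence: what is used later about the events of
  a filtering function is contained in these five facts.\<close>

lemma encode_S:
  fixes N :: nat and \<epsilon> :: real and w :: "'v filt"
  defines "f \<equiv> encode r (S N K \<epsilon> w)" and "Kf \<equiv> complex_at K \<epsilon> w"
  assumes "\<epsilon> > 0" "w \<in> FF N K"
  shows "valid_events (map snd f)" "complex_after (map snd f) (length f) = {}" "sorted (map fst f)"
    "\<And>t. 0 \<le> t \<Longrightarrow> t < real (N + 1) \<Longrightarrow>
       complex_after (map snd f) (length (takeWhile (\<lambda>q. fst q \<le> t) f)) = Kf t"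
    "\<And>\<tau> ev. (\<tau>, ev) \<in> set f \<Longrightarrow> 0 < \<tau> \<and> \<tau> \<le> real (N + 1) \<and> (\<exists>a. 0 \<le> a \<and> a < \<tau> \<and> (case ev of
      Ins \<sigma> \<Rightarrow> \<sigma> \<in> Kf \<tau> \<and> (\<forall>s\<in>{a..<\<tau>}. \<sigma> \<notin> Kf s)
    | Del \<sigma> \<Rightarrow> \<sigma> \<notin> Kf \<tau> \<and> \<sigma> \<in> Kf a \<and> (\<forall>s\<in>{a..<\<tau>}. \<sigma> \<in> Kf s)))"
proof -
  let ?J = "jump_times N K \<epsilon> w"
  define ts where "ts = sorted_list_of_set ?J"
  have fin: "finite K" using K by (simp add: simplicial_complex_def)
  have J: "?J \<subseteq> {0..real (N + 1)}" "0 \<notin> ?J" "finite ?J"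
    using jump_times_bounds[OF fin assms(3,4)] finite_jump_times[OF fin] by (auto simp: jump_times_def)
  have ts: "set ts = ?J" "sorted_wrt (<) ts" using J(3) by (simp_all add: ts_def strict_sorted_list_of_set)
  have pos: "0 < t" "t \<le> real (N + 1)" if "t \<in> set ts" for t
    using that J ts(1) by (auto simp: less_le)
  have f: "f = enc Kf (0 # ts)" by (simp add: f_def S_def ts_def Kf_def)
  have simp: "simplicial_complex (Kf t) \<and> Kf t \<subseteq> K" if "t \<in> set (0 # ts)" for t
  proof -
    have "0 \<le> t" using that pos(1)[of t] by auto
    then show ?thesis using complex_at_simplicial[OF K assms(4)] by (auto simp: Kf_def complex_at_def)
  qed
  have K_seq: "S N K \<epsilon> w \<in> Seq K" by (rule S_in_Seq[OF K assms(3,4)])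
  have S: "S N K \<epsilon> w = map (\<lambda>t. (t, Kf t)) (0 # ts)" by (simp add: S_def ts_def Kf_def)
  have K0: "Kf 0 = {}" using K_seq by (simp add: Seq_def S)
  have Klast: "Kf (last (0 # ts)) = {}"
  proof -
    have "snd (last (map (\<lambda>t. (t, Kf t)) (0 # ts))) = {}" using K_seq unfolding S Seq_def by blast
    then show ?thesis by (simp only: last_map list.discI snd_conv not_False_eq_True)
  qed
  have jumps: "jumps_at Kf (real (N + 1)) 0 ts"
  proof (rule jumps_at_sorted)
    show "\<forall>s\<in>{a..<b}. Kf s = Kf a" if "0 \<le> a" "b \<le> real (N + 1)" "{a<..<b} \<inter> ?J = {}" for a b
      unfolding Kf_def using complex_at_const[OF fin that] by blast
    show "sorted_wrt (<) (0 # ts)" using ts(2) pos by simp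
  qed (use pos ts in auto)
  have v: "valid_from {} (map snd f) \<and> fold apply_event (map snd f) {} = {}"
    using enc_valid[of 0 ts Kf] simp K0 Klast unfolding f by metis
  then show "valid_events (map snd f)" by (blast intro: valid_from_valid_events)
  show "complex_after (map snd f) (length f) = {}" using v by (simp add: complex_after_def)
  show "sorted (map fst f)" unfolding f using simp by (intro enc_sorted[OF jumps]) auto
  show "complex_after (map snd f) (length (takeWhile (\<lambda>q. fst q \<le> t) f)) = Kf t"
    if "0 \<le> t" "t < real (N + 1)" for t
  proof -
    have "take (length (takeWhile (\<lambda>q. fst q \<le> t) f)) (map snd f) = map snd (takeWhile (\<lambda>q. fst q \<le> t) f)"
      unfolding take_map takeWhile_eq_take[symmetric] ..
    then show ?thesis using enc_complex[OF jumps simp that] K0 unfolding complex_after_def f by simp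
  qed
  show "0 < \<tau> \<and> \<tau> \<le> real (N + 1) \<and> (\<exists>a. 0 \<le> a \<and> a < \<tau> \<and> (case ev of
      Ins \<sigma> \<Rightarrow> \<sigma> \<in> Kf \<tau> \<and> (\<forall>s\<in>{a..<\<tau>}. \<sigma> \<notin> Kf s)
    | Del \<sigma> \<Rightarrow> \<sigma> \<notin> Kf \<tau> \<and> \<sigma> \<in> Kf a \<and> (\<forall>s\<in>{a..<\<tau>}. \<sigma> \<in> Kf s)))" if "(\<tau>, ev) \<in> set f" for \<tau> ev
    using enc_events[OF jumps _ that[unfolded f]] simp pos by blast
qed

end

section \<open>Piecewise linear functions near a level\<close>

lemma interpolate_segment:
  assumes "real i \<le> s" "s \<le> real i + 1"
  shows "interpolate a s = a i + (s - real i) * (a (Suc i) - a i)"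
  using interpolate_affine[OF assms, of a] by (simp add: algebra_simps)

lemma segment_exists:
  assumes "0 \<le> (s::real)"
  obtains i where "real i \<le> s" "s < real i + 1"
proof
  show "real (nat \<lfloor>s\<rfloor>) \<le> s" "s < real (nat \<lfloor>s\<rfloor>) + 1" using assms by linarith+
qed

text \<open>Adjacent segments agree at the integers, so the closed pieces glue; continuity on the
  half-line follows because it is a local property.\<close>

lemma continuous_on_interpolate: "continuous_on {0..} (interpolate a)"
proof -
  have n: "continuous_on {0..real n} (interpolate a)" for n
  proof (induction n)
    case 0
    then show ?case by simp
  next
    case (Suc n)
    have "continuous_on {real n..real n + 1} (\<lambda>s. a n + (s - real n) * (a (Suc n) - a n))"
      by (intro continuous_intros)
    moreover have "a n + (s - real n) * (a (Suc n) - a n) = interpolate a s" if "s \<in> {real n..real n + 1}" for s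
      using that by (intro interpolate_segment[symmetric]) auto
    ultimately have "continuous_on {real n..real n + 1} (interpolate a)"
      using continuous_on_cong[of "{real n..real n + 1}" "{real n..real n + 1}"
          "\<lambda>s. a n + (s - real n) * (a (Suc n) - a n)" "interpolate a"] by blast
    with Suc have "continuous_on ({0..real n} \<union> {real n..real n + 1}) (interpolate a)"
      by (intro continuous_on_closed_Un) auto
    moreover have "{0..real n} \<union> {real n..real n + 1} = {0..real (Suc n)}" by auto
    ultimately show ?case by simp
  qed
  show ?thesis
    unfolding continuous_on_eq_continuous_within
  proof
    fix x :: real assume x: "x \<in> {0..}"
    obtain n where n': "x < real n" using reals_Archimedean2 by blast
    have "continuous (at x within {0..real n}) (interpolate a)"
      using n[of n] x n' by (simp add: continuous_on_eq_continuous_within)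
    moreover have "at x within {0..} = at x within {0..real n}"
      by (rule at_within_nhd[of _ "{..<real n}"]) (use n' in auto)
    ultimately show "continuous (at x within {0..}) (interpolate a)" by simp
  qed
qed

lemma interpolate_zero_between:
  assumes "0 \<le> s" "s \<le> t" "interpolate a s \<le> \<epsilon> \<and> \<epsilon> \<le> interpolate a t \<or> interpolate a t \<le> \<epsilon> \<and> \<epsilon> \<le> interpolate a s"
  obtains c where "s \<le> c" "c \<le> t" "interpolate a c = \<epsilon>"
proof -
  have "continuous_on {s..t} (interpolate a)"
    using continuous_on_interpolate by (rule continuous_on_subset) (use assms in auto)
  then have "\<exists>c\<ge>s. c \<le> t \<and> interpolate a c = \<epsilon>"
    using assms IVT'[of "interpolate a" s \<epsilon> t] IVT2'[of "interpolate a" t \<epsilon> s] by auto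
  then show ?thesis using that by blast
qed

lemma interpolate_diff_le:
  assumes "0 \<le> t" "\<And>i. \<bar>a i - b i\<bar> \<le> \<eta>"
  shows "\<bar>interpolate a t - interpolate b t\<bar> \<le> \<eta>"
proof -
  obtain i where i: "real i \<le> t" "t < real i + 1" using segment_exists[OF assms(1)] .
  define \<theta> where "\<theta> = t - real i"
  have \<theta>: "0 \<le> \<theta>" "\<theta> \<le> 1" using i by (auto simp: \<theta>_def)
  have "interpolate a t - interpolate b t = (1 - \<theta>) * (a i - b i) + \<theta> * (a (Suc i) - b (Suc i))"
    using i by (simp add: interpolate_segment[of i] \<theta>_def algebra_simps)
  also have "\<bar>\<dots>\<bar> \<le> (1 - \<theta>) * \<bar>a i - b i\<bar> + \<theta> * \<bar>a (Suc i) - b (Suc i)\<bar>"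
    using abs_triangle_ineq[of "(1 - \<theta>) * (a i - b i)" "\<theta> * (a (Suc i) - b (Suc i))"] \<theta> by (simp add: abs_mult)
  also have "\<dots> \<le> (1 - \<theta>) * \<eta> + \<theta> * \<eta>"
    using \<theta> assms(2) by (intro add_mono mult_left_mono) auto
  finally show ?thesis by (simp add: algebra_simps)
qed

lemma interpolate_uminus: "interpolate (\<lambda>i. - a i) t = - interpolate a t"
  by (simp add: interpolate_def Let_def algebra_simps)

text \<open>The slope at a crossing is at least \<open>\<mu>\<close>.\<close>

lemma crossing_near:
  assumes "0 < \<mu>" "\<And>i. \<mu> \<le> max \<bar>a i - \<epsilon>\<bar> \<bar>a (Suc i) - \<epsilon>\<bar>" "\<And>i. a i \<noteq> \<epsilon> \<Longrightarrow> \<eta> < \<bar>a i - \<epsilon>\<bar>"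
    and t: "0 \<le> t" "\<bar>interpolate a t - \<epsilon>\<bar> \<le> \<eta>"
  obtains i c where "real i \<le> t" "t < real i + 1" "real i \<le> c" "c \<le> real i + 1" "interpolate a c = \<epsilon>" "\<bar>t - c\<bar> \<le> \<eta> / \<mu>"
proof -
  obtain i where i: "real i \<le> t" "t < real i + 1" using segment_exists[OF t(1)] .
  define \<theta> x y where "\<theta> = t - real i" and "x = a i - \<epsilon>" and "y = a (Suc i) - \<epsilon>"
  have \<theta>: "0 \<le> \<theta>" "\<theta> \<le> 1" using i by (auto simp: \<theta>_def)
  have seg: "interpolate a s - \<epsilon> = x + (s - real i) * (y - x)" if "real i \<le> s" "s \<le> real i + 1" for s
    using interpolate_segment[OF that, of a] by (simp add: x_def y_def algebra_simps)
  have val: "\<bar>x + \<theta> * (y - x)\<bar> \<le> \<eta>" using t(2) seg[of t] i by (simp add: \<theta>_def)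
  have \<mu>: "\<mu> \<le> max \<bar>x\<bar> \<bar>y\<bar>" using assms(2)[of i] by (simp add: x_def y_def)
  have nz: "x \<noteq> 0 \<Longrightarrow> \<eta> < \<bar>x\<bar>" "y \<noteq> 0 \<Longrightarrow> \<eta> < \<bar>y\<bar>" using assms(3) by (auto simp: x_def y_def)
  have conv: "x + \<theta> * (y - x) = (1 - \<theta>) * x + \<theta> * y" by (simp add: algebra_simps)
  \<comment> \<open>End values off the level differ from it by more than \<eta>, so a value within
    \<eta> of the level excludes two ends strictly on the same side.\<close>
  have "\<not> (0 < x \<and> 0 < y)"
  proof
    assume *: "0 < x \<and> 0 < y"
    have "min x y \<le> (1 - \<theta>) * x + \<theta> * y"
    proof -
      have "(1 - \<theta>) * min x y + \<theta> * min x y \<le> (1 - \<theta>) * x + \<theta> * y"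
        using \<theta> by (intro add_mono mult_left_mono) auto
      then show ?thesis by (simp add: algebra_simps)
    qed
    then show False using val nz * conv by (auto simp: min_def split: if_splits)
  qed
  moreover have "\<not> (x < 0 \<and> y < 0)"
  proof
    assume *: "x < 0 \<and> y < 0"
    have "(1 - \<theta>) * x + \<theta> * y \<le> max x y"
    proof -
      have "(1 - \<theta>) * x + \<theta> * y \<le> (1 - \<theta>) * max x y + \<theta> * max x y"
        using \<theta> by (intro add_mono mult_left_mono) auto
      then show ?thesis by (simp add: algebra_simps)
    qed
    then show False using val nz * conv by (auto simp: max_def split: if_splits)
  qed
  ultimately have sign: "x \<le> 0 \<and> 0 \<le> y \<or> y \<le> 0 \<and> 0 \<le> x" by linarith
  \<comment> \<open>With opposite signs the difference is at least the larger of the two absolute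
    values.\<close>
  have d: "\<mu> \<le> \<bar>x - y\<bar>" using sign \<mu> by (auto simp: max_def abs_if split: if_splits)
  then have d0: "x - y \<noteq> 0" using assms(1) by auto
  \<comment> \<open>The zero of the affine segment. The offset of \<open>t\<close> from it is the
    height of the value at \<open>t\<close> over the level, divided by the slope.\<close>
  define \<theta>' where "\<theta>' = x / (x - y)"
  have \<theta>': "0 \<le> \<theta>'" "\<theta>' \<le> 1" using sign d0 by (auto simp: \<theta>'_def divide_simps)
  have zero: "x + \<theta>' * (y - x) = 0" using d0 by (simp add: \<theta>'_def field_simps)
  have "x + \<theta> * (y - x) = (\<theta> - \<theta>') * (y - x)" using zero by (simp add: algebra_simps)
  then have "\<bar>\<theta> - \<theta>'\<bar> * \<bar>x - y\<bar> \<le> \<eta>" using val by (simp add: abs_mult abs_minus_commute)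
  moreover have "\<bar>\<theta> - \<theta>'\<bar> * \<mu> \<le> \<bar>\<theta> - \<theta>'\<bar> * \<bar>x - y\<bar>" using d by (intro mult_left_mono) auto
  ultimately have "\<bar>\<theta> - \<theta>'\<bar> \<le> \<eta> / \<mu>" using assms(1) by (simp add: pos_le_divide_eq)
  moreover have "interpolate a (real i + \<theta>') = \<epsilon>" using seg[of "real i + \<theta>'"] \<theta>' zero by simp
  ultimately show ?thesis using that[of i "real i + \<theta>'"] i \<theta>' by (simp add: \<theta>_def algebra_simps)
qed

text \<open>A segment carries at most one crossing, since a level segment at height \<epsilon> would
  have both ends on the level.\<close>

lemma finite_crossings:
  assumes "0 < \<mu>" "\<And>i. \<mu> \<le> max \<bar>a i - \<epsilon>\<bar> \<bar>a (Suc i) - \<epsilon>\<bar>"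
  shows "finite {c. 0 \<le> c \<and> c \<le> real n \<and> interpolate a c = \<epsilon>}"
proof (rule finite_subset)
  show "{c. 0 \<le> c \<and> c \<le> real n \<and> interpolate a c = \<epsilon>} \<subseteq> (\<lambda>i. real i + (\<epsilon> - a i) / (a (Suc i) - a i)) ` {..n}"
  proof safe
    fix c :: real assume c: "0 \<le> c" "c \<le> real n" "\<epsilon> = interpolate a c"
    obtain i where i: "real i \<le> c" "c < real i + 1" using segment_exists[OF c(1)] .
    have e: "interpolate a c = a i + (c - real i) * (a (Suc i) - a i)" using i by (intro interpolate_segment) auto
    then have "a (Suc i) - a i \<noteq> 0" using assms(1) assms(2)[of i] c(3) by auto
    then have "c = real i + (interpolate a c - a i) / (a (Suc i) - a i)" using e by (simp add: field_simps)
    moreover have "i \<le> n" using i c(2) by linarith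
    ultimately show "c \<in> (\<lambda>i. real i + (interpolate a c - a i) / (a (Suc i) - a i)) ` {..n}" by blast
  qed
qed simp

text \<open>Inside a segment the slope at a crossing is non-zero and one side lies below. At a
  vertex \<open>ext\<close> supplies a neighbouring vertex below the level, and the segment towards
  it descends.\<close>

lemma crossing_below_near:
  assumes "0 < \<mu>" "\<And>i. \<mu> \<le> max \<bar>a i - \<epsilon>\<bar> \<bar>a (Suc i) - \<epsilon>\<bar>"
    and ext: "\<And>i. a (Suc i) = \<epsilon> \<Longrightarrow> a i < \<epsilon> \<or> a (Suc (Suc i)) < \<epsilon>"
    and c: "0 < c" "interpolate a c = \<epsilon>" and "0 < \<gamma>"
  obtains x where "0 \<le> x" "\<bar>x - c\<bar> < \<gamma>" "interpolate a x < \<epsilon>"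
proof -
  have "0 \<le> c" using c by simp
  then obtain i where i: "real i \<le> c" "c < real i + 1" using segment_exists by blast
  have e: "interpolate a s = a i + (s - real i) * (a (Suc i) - a i)" if "real i \<le> s" "s \<le> real i + 1" for s
    using that by (rule interpolate_segment)
  show ?thesis
  proof (cases "c = real i")
    case True
    then obtain k where k: "i = Suc k" using c(1) by (cases i) auto
    have "a i = \<epsilon>" using e[of c] c(2) True by simp
    define h where "h = min (\<gamma> / 2) 1"
    have h: "0 < h" "h < \<gamma>" "h \<le> 1" using \<open>0 < \<gamma>\<close> by (auto simp: h_def)
    from ext[of k] \<open>a i = \<epsilon>\<close> k consider "a k < \<epsilon>" | "a (Suc i) < \<epsilon>" by auto
    then show ?thesis
    proof cases
      case 1
      have "interpolate a (c - h) = a k + (1 - h) * (a i - a k)"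
        using interpolate_segment[of k "c - h" a] True k h by (simp add: algebra_simps)
      also have "\<dots> = \<epsilon> - h * (\<epsilon> - a k)" using \<open>a i = \<epsilon>\<close> by (simp add: algebra_simps)
      also have "\<dots> < \<epsilon>" using 1 h by simp
      finally show ?thesis using h True k by (intro that[of "c - h"]) auto
    next
      case 2
      have "interpolate a (c + h) = \<epsilon> - h * (\<epsilon> - a (Suc i))"
        using e[of "c + h"] True h \<open>a i = \<epsilon>\<close> by (simp add: algebra_simps)
      also have "\<dots> < \<epsilon>" using 2 h by simp
      finally show ?thesis using h c by (intro that[of "c + h"]) auto
    qed
  next
    case False
    let ?s = "a (Suc i) - a i"
    have "?s \<noteq> 0" using e[of c] c(2) i assms(1) assms(2)[of i] by auto
    define h where "h = min (\<gamma> / 2) (min (c - real i) (real i + 1 - c))"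
    have h: "0 < h" "h < \<gamma>" "h \<le> c - real i" "h \<le> real i + 1 - c"
      using \<open>0 < \<gamma>\<close> i False by (auto simp: h_def)
    have v: "interpolate a s = \<epsilon> + (s - c) * ?s" if "real i \<le> s" "s \<le> real i + 1" for s
      using e[of c] e[OF that] c(2) i by (simp add: algebra_simps)
    show ?thesis
    proof (cases "0 < ?s")
      case True
      have "interpolate a (c - h) = \<epsilon> - h * ?s" using v[of "c - h"] h by simp
      also have "\<dots> < \<epsilon>" using True h by simp
      finally show ?thesis using h i by (intro that[of "c - h"]) auto
    next
      case False
      then have "?s < 0" using \<open>?s \<noteq> 0\<close> by simp
      have "interpolate a (c + h) = \<epsilon> + h * ?s" using v[of "c + h"] h by simp
      also have "\<dots> < \<epsilon>" using \<open>?s < 0\<close> h by (simp add: mult_pos_neg)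
      finally show ?thesis using h c by (intro that[of "c + h"]) auto
    qed
  qed
qed

text \<open>A value below the level would need a crossing on each side, but only one crossing is
  possible. A mere contact with the level would produce values below it nearby, by
  \<open>crossing_below_near\<close>.\<close>

lemma above_between:
  assumes "0 < \<mu>" "\<And>i. \<mu> \<le> max \<bar>a i - \<epsilon>\<bar> \<bar>a (Suc i) - \<epsilon>\<bar>"
    and ext: "\<And>i. a (Suc i) = \<epsilon> \<Longrightarrow> a i < \<epsilon> \<or> a (Suc (Suc i)) < \<epsilon>"
    and s: "0 \<le> s" "interpolate a s > \<epsilon>" and t: "interpolate a t > \<epsilon>"
    and one: "\<And>x y. s \<le> x \<Longrightarrow> x \<le> y \<Longrightarrow> y \<le> t \<Longrightarrow> interpolate a x = \<epsilon> \<Longrightarrow> interpolate a y = \<epsilon> \<Longrightarrow> x = y"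
    and x: "s \<le> x" "x \<le> t"
  shows "interpolate a x > \<epsilon>"
proof -
  have no: "\<not> interpolate a y < \<epsilon>" if y: "s \<le> y" "y \<le> t" for y
  proof
    assume *: "interpolate a y < \<epsilon>"
    obtain c where c: "s \<le> c" "c \<le> y" "interpolate a c = \<epsilon>"
      using interpolate_zero_between[of s y a \<epsilon>] s * y by auto
    obtain c' where c': "y \<le> c'" "c' \<le> t" "interpolate a c' = \<epsilon>"
      using interpolate_zero_between[of y t a \<epsilon>] s t * y by auto
    have "c = c'" using one[of c c'] c c' by auto
    then have "y = c" using c c' by auto
    then show False using * c(3) by simp
  qed
  show ?thesis
  proof (rule ccontr)
    assume "\<not> ?thesis"
    then have eq: "interpolate a x = \<epsilon>" using no[OF x] by simp
    then have sx: "s < x" "x < t" using s t x by (auto simp: less_le)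
    then have "0 < min (x - s) (t - x)" by simp
    then obtain y where "\<bar>y - x\<bar> < min (x - s) (t - x)" "interpolate a y < \<epsilon>"
      using crossing_below_near[OF assms(1,2) ext _ eq, of "min (x - s) (t - x)"] s sx by (metis order.strict_trans1)
    then show False using no[of y] by (auto simp: abs_if split: if_splits)
  qed
qed

lemma below_between:
  assumes "0 < \<mu>" "\<And>i. \<mu> \<le> max \<bar>a i - \<epsilon>\<bar> \<bar>a (Suc i) - \<epsilon>\<bar>"
    and ext: "\<And>i. a (Suc i) = \<epsilon> \<Longrightarrow> a i > \<epsilon> \<or> a (Suc (Suc i)) > \<epsilon>"
    and s: "0 \<le> s" "interpolate a s < \<epsilon>" and t: "interpolate a t < \<epsilon>"
    and one: "\<And>x y. s \<le> x \<Longrightarrow> x \<le> y \<Longrightarrow> y \<le> t \<Longrightarrow> interpolate a x = \<epsilon> \<Longrightarrow> interpolate a y = \<epsilon> \<Longrightarrow> x = y"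
    and x: "s \<le> x" "x \<le> t"
  shows "interpolate a x < \<epsilon>"
proof -
  have "interpolate (\<lambda>i. - a i) x > - \<epsilon>"
  proof (rule above_between[where s = s and t = t and \<mu> = \<mu>])
    show "\<mu> \<le> max \<bar>- a i - - \<epsilon>\<bar> \<bar>- a (Suc i) - - \<epsilon>\<bar>" for i
      using assms(2)[of i] by (simp add: abs_minus_commute)
    show "- a i < - \<epsilon> \<or> - a (Suc (Suc i)) < - \<epsilon>" if "- a (Suc i) = - \<epsilon>" for i using ext[of i] that by simp
  qed (use assms in \<open>auto simp: interpolate_uminus\<close>)
  then show ?thesis by (simp add: interpolate_uminus)
qed

section \<open>Membership in the complex at a given time\<close>

lemma complex_at_above:
  assumes "\<sigma> \<in> K" "0 \<le> t" "interpolate (w \<sigma>) t > \<epsilon>"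
  shows "\<sigma> \<in> complex_at K \<epsilon> w t"
proof -
  have "continuous (at t within {0..}) (interpolate (w \<sigma>))"
    using continuous_on_interpolate assms(2) by (auto simp: continuous_on_eq_continuous_within)
  then have "\<forall>\<^sub>F s in at t within {0..}. interpolate (w \<sigma>) s > \<epsilon>"
    using assms(3) by (auto simp: continuous_within intro: order_tendstoD)
  then obtain \<eta> where "\<eta> > 0" "\<And>s. s \<in> {0..} \<Longrightarrow> s \<noteq> t \<Longrightarrow> dist s t < \<eta> \<Longrightarrow> interpolate (w \<sigma>) s > \<epsilon>"
    unfolding eventually_at by blast
  then show ?thesis using assms(1,2) unfolding complex_at_def
    by (auto simp: dist_real_def intro!: exI[of _ \<eta>])
qed

lemma complex_at_below:
  assumes "0 \<le> t" "interpolate (w \<sigma>) t < \<epsilon>"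
  shows "\<sigma> \<notin> complex_at K \<epsilon> w t"
proof
  assume "\<sigma> \<in> complex_at K \<epsilon> w t"
  then obtain \<eta>' where e: "\<eta>' > 0" "\<forall>s\<in>{t<..<t + \<eta>'}. interpolate (w \<sigma>) s > \<epsilon>" by (auto simp: complex_at_def)
  have "continuous (at t within {0..}) (interpolate (w \<sigma>))"
    using continuous_on_interpolate assms(1) by (auto simp: continuous_on_eq_continuous_within)
  then have "\<forall>\<^sub>F s in at t within {0..}. interpolate (w \<sigma>) s < \<epsilon>"
    using assms(2) by (auto simp: continuous_within intro: order_tendstoD)
  then obtain \<eta> where d: "\<eta> > 0" "\<And>s. s \<in> {0..} \<Longrightarrow> s \<noteq> t \<Longrightarrow> dist s t < \<eta> \<Longrightarrow> interpolate (w \<sigma>) s < \<epsilon>"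
    unfolding eventually_at by blast
  define h where "h = min \<eta> \<eta>' / 2"
  have h: "0 < h" "h < \<eta>" "h < \<eta>'" using e(1) d(1) by (auto simp: h_def)
  have "interpolate (w \<sigma>) (t + h) < \<epsilon>" using h assms(1) by (intro d(2)) (auto simp: dist_real_def)
  moreover have "interpolate (w \<sigma>) (t + h) > \<epsilon>" using h e(2) by auto
  ultimately show False by simp
qed

lemma near_left:
  assumes "0 \<le> a" "a < t" "P (interpolate b t)" "open {y. P y}"
  obtains s where "a \<le> s" "s < t" "P (interpolate b s)"
proof -
  have "continuous (at t within {0..}) (interpolate b)"
    using continuous_on_interpolate assms(1,2) by (auto simp: continuous_on_eq_continuous_within)
  then have "\<forall>\<^sub>F s in at t within {0..}. interpolate b s \<in> {y. P y}"
    using topological_tendstoD[OF _ assms(4)] assms(3) unfolding continuous_within by blast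
  then obtain \<eta> where d: "\<eta> > 0" "\<And>s. s \<in> {0..} \<Longrightarrow> s \<noteq> t \<Longrightarrow> dist s t < \<eta> \<Longrightarrow> P (interpolate b s)"
    unfolding eventually_at by auto
  define s where "s = max a (t - \<eta> / 2)"
  have "a \<le> s" "s < t" "dist s t < \<eta>" using assms(2) d(1) by (auto simp: s_def dist_real_def)
  then show ?thesis using that d(2)[of s] assms(1) by auto
qed

text \<open>If the value at \<tau> were off the level, continuity would give \<sigma> the same
  status at \<tau> and at some earlier time of the interval on which the status is known to be
  opposite.\<close>

lemma event_crossing:
  assumes "0 \<le> a" "a < \<tau>" "\<sigma> \<in> K"
    and "\<sigma> \<in> complex_at K \<epsilon> w \<tau> \<and> (\<forall>s\<in>{a..<\<tau>}. \<sigma> \<notin> complex_at K \<epsilon> w s) \<or>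
         \<sigma> \<notin> complex_at K \<epsilon> w \<tau> \<and> (\<forall>s\<in>{a..<\<tau>}. \<sigma> \<in> complex_at K \<epsilon> w s)"
  shows "interpolate (w \<sigma>) \<tau> = \<epsilon>"
proof (rule ccontr)
  assume "interpolate (w \<sigma>) \<tau> \<noteq> \<epsilon>"
  then consider "interpolate (w \<sigma>) \<tau> < \<epsilon>" | "interpolate (w \<sigma>) \<tau> > \<epsilon>" by linarith
  then show False
  proof cases
    case 1
    then have "\<sigma> \<notin> complex_at K \<epsilon> w \<tau>" using assms by (intro complex_at_below) auto
    moreover obtain s where "a \<le> s" "s < \<tau>" "interpolate (w \<sigma>) s < \<epsilon>"
      using near_left[of a \<tau> "\<lambda>y. y < \<epsilon>" "w \<sigma>"] assms(1,2) 1 by (auto simp: open_lessThan simp flip: lessThan_def)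
    moreover from this have "\<sigma> \<notin> complex_at K \<epsilon> w s" using assms by (intro complex_at_below) auto
    ultimately show False using assms(4) by auto
  next
    case 2
    then have "\<sigma> \<in> complex_at K \<epsilon> w \<tau>" using assms by (intro complex_at_above) auto
    moreover obtain s where "a \<le> s" "s < \<tau>" "interpolate (w \<sigma>) s > \<epsilon>"
      using near_left[of a \<tau> "\<lambda>y. y > \<epsilon>" "w \<sigma>"] assms(1,2) 2 by (auto simp: open_greaterThan simp flip: greaterThan_def)
    moreover from this have "\<sigma> \<in> complex_at K \<epsilon> w s" using assms by (intro complex_at_above) auto
    ultimately show False using assms(4) by auto
  qed
qed

section \<open>Local stability\<close>

text \<open>If a bar began or ended at this step, \<open>restr\<close> would annihilate its unit
  vector or be unable to attain it, although the coordinate maps on both sides have the same domain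
  and the same kernel. Consequently bars begin and end only at events of dimension \<open>p\<close>
  or \<open>p\<close> + 1.\<close>

lemma (in elementary_zigzag) alive_Suc_iff:
  assumes bar: "barcode Z B fwd n bs \<phi>" and i: "i < n" and same: "Z (Suc i) = Z i" "B (Suc i) = B i"
  shows "alive bs j (Suc i) \<longleftrightarrow> alive bs j i"
proof (rule ccontr)
  assume neq: "\<not> ?thesis"
  define e :: "nat \<Rightarrow> 'f" where "e = (\<lambda>k. if k = j then 1 else 0)"
  have ej: "e j \<noteq> 0" by (simp add: e_def)
  have e0: "restr bs i e = 0" using neq by (auto simp: restr_def e_def fun_eq_iff zero_fun_apply)
  have r0: "restr bs i y j = 0" for y :: "nat \<Rightarrow> 'f" using neq by (auto simp: restr_def)
  have comp: "compatible bs i (fwd i) (Z i) (Z i) (\<phi> i) (\<phi> (Suc i))"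
  proof -
    have "compatible bs i (fwd i) (Z i) (Z (Suc i)) (\<phi> i) (\<phi> (Suc i))" using bar i by (simp add: barcode_def)
    then show ?thesis by (simp only: same(1))
  qed
  have le: "i \<le> n" "Suc i \<le> n" using i by auto
  have ker: "\<phi> i z = 0 \<longleftrightarrow> \<phi> (Suc i) z = 0" if "z \<in> Z i" for z
    using coordinates_bar(3)[OF bar le(1), of z] coordinates_bar(3)[OF bar le(2), of z] that same by simp
  have hit: "\<exists>z\<in>Z i. \<phi> l z = e" if "alive bs j l" "l = i \<or> l = Suc i" for l
  proof -
    have "e \<in> coord bs l" using that(1) by (auto simp: coord_def e_def)
    then have "e \<in> \<phi> l ` Z l" using coordinates_bar(2)[OF bar, of l] that(2) le by auto
    then show ?thesis using that(2) same by auto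
  qed
  have e_nz: "e \<noteq> 0" using ej by (metis zero_fun_apply)
  from neq consider "alive bs j i" | "alive bs j (Suc i)" by blast
  then show False
  proof cases
    case 1
    then obtain z where z: "z \<in> Z i" "\<phi> i z = e" using hit by blast
    show False
    proof (cases "fwd i")
      case True
      then have "\<phi> (Suc i) z = 0" using comp z e0 by (simp add: compatible_def)
      then show False using ker[OF z(1)] z(2) e_nz by simp
    next
      case False
      then have "e = restr bs i (\<phi> (Suc i) z)" using comp z by (simp add: compatible_def)
      then show False using r0 ej by metis
    qed
  next
    case 2
    then obtain z where z: "z \<in> Z i" "\<phi> (Suc i) z = e" using hit by blast
    show False
    proof (cases "fwd i")
      case True
      then have "e = restr bs i (\<phi> i z)" using comp z by (simp add: compatible_def)
      then show False using r0 ej by metis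
    next
      case False
      then have "\<phi> i z = 0" using comp z e0 by (simp add: compatible_def)
      then show False using ker[OF z(1)] z(2) e_nz by simp
    qed
  qed
qed

section \<open>Event positions and the homology relation between two times\<close>

definition pos :: "(real \<times> 'e) list \<Rightarrow> real \<Rightarrow> nat" where
  "pos f t = length (takeWhile (\<lambda>q. fst q \<le> t) f)"

lemma pos_le_length: "pos f t \<le> length f"
  by (simp add: pos_def length_takeWhile_le)

lemma less_pos_iff:
  assumes "sorted (map fst f)" "a < length f"
  shows "a < pos f t \<longleftrightarrow> fst (f ! a) \<le> t"
proof
  assume "a < pos f t"
  then have "takeWhile (\<lambda>q. fst q \<le> t) f ! a \<in> set (takeWhile (\<lambda>q. fst q \<le> t) f)"
    unfolding pos_def by (rule nth_mem)
  then show "fst (f ! a) \<le> t"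
    using takeWhile_nth[of a "\<lambda>q. fst q \<le> t" f] \<open>a < pos f t\<close> by (auto simp: pos_def dest: set_takeWhileD)
next
  assume le: "fst (f ! a) \<le> t"
  show "a < pos f t"
  proof (rule ccontr)
    assume *: "\<not> a < pos f t"
    then have "pos f t < length f" using assms(2) by simp
    then have "\<not> fst (f ! pos f t) \<le> t" unfolding pos_def by (rule nth_length_takeWhile)
    moreover have "fst (f ! pos f t) \<le> fst (f ! a)"
      using sorted_nth_mono[OF assms(1), of "pos f t" a] * assms(2) by simp
    ultimately show False using le by simp
  qed
qed

lemma pos_mono:
  assumes "s \<le> t" shows "pos f s \<le> pos f t"
  unfolding pos_def using assms by (induction f) auto

text \<open>The composite relation indexed by times instead of positions, which allows a comparison
  of event lists of different lengths. The argument \<open>F\<close> fixes the coefficient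
  field.\<close>

definition path_rel :: "'f::field itself \<Rightarrow> nat \<Rightarrow> (real \<times> 'v event) list \<Rightarrow> real \<Rightarrow> real \<Rightarrow> ('v, 'f) chain rel" where
  "path_rel F p f s t = zrel (\<lambda>i. cycles p (complex_after (map snd f) i)) (\<lambda>i. boundaries p (complex_after (map snd f) i))
     (pos f s) (pos f t - pos f s)"

lemma path_rel_compose:
  assumes "valid_events (map snd f)" "s \<le> u" "u \<le> t"
  shows "path_rel F p f s t = path_rel F p f s u O path_rel F p f u t"
proof -
  interpret elementary_zigzag "\<lambda>i. cycles p (complex_after (map snd f) i) :: ('a, 'b) chain set"
    "\<lambda>i. boundaries p (complex_after (map snd f) i)" "\<lambda>i. \<exists>\<sigma>. map snd f ! i = Ins \<sigma>" "length (map snd f)"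
    by (rule elementary_zigzag_homology[OF assms(1)])
  have le: "pos f s \<le> pos f u" "pos f u \<le> pos f t" "pos f t \<le> length f"
    using assms pos_mono pos_le_length by auto
  show ?thesis
    using zrel_compose[of "pos f s" "pos f u - pos f s" "pos f t - pos f u"] le by (simp add: path_rel_def)
qed

text \<open>Passes from index pairs to pairs of times: \<open>alive_Suc_iff\<close> locates the
  endpoints at events of dimension \<open>p\<close> or \<open>p\<close> + 1, and counting pairs in a
  quadrant of times becomes counting bars that span two positions.\<close>

lemma PH_pairs:
  fixes F :: "'f::field itself" and f :: "(real \<times> 'v event) list"
  assumes "valid_events (map snd f)" "complex_after (map snd f) (length f) = {}" "sorted (map fst f)"
  obtains Q where "PH F p f = image_mset emb Q"
    "\<forall>x y. (x, y) \<in># Q \<longrightarrow> x \<le> y"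
    "\<forall>x y. (x, y) \<in># Q \<longrightarrow> (\<exists>ev. (x, ev) \<in> set f \<and> (\<exists>\<sigma>. sdim \<sigma> \<in> {p, Suc p} \<and> ev \<in> {Ins \<sigma>, Del \<sigma>})) \<and>
      (\<exists>ev. (y, ev) \<in> set f \<and> (\<exists>\<sigma>. sdim \<sigma> \<in> {p, Suc p} \<and> ev \<in> {Ins \<sigma>, Del \<sigma>}))"
    "\<exists>bs \<phi>. barcode (\<lambda>i. cycles p (complex_after (map snd f) i) :: ('v, 'f) chain set)
        (\<lambda>i. boundaries p (complex_after (map snd f) i)) (\<lambda>i. \<exists>\<sigma>. map snd f ! i = Ins \<sigma>) (length f) bs \<phi> \<and>
      (\<forall>s t. size {#q\<in>#Q. fst q \<le> s \<and> t < snd q#} = card (full_bars bs (pos f s) (pos f t)))"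
proof -
  let ?es = "map snd f" and ?n = "length f"
  let ?Z = "\<lambda>i. cycles p (complex_after ?es i) :: ('v, 'f) chain set" and ?B = "\<lambda>i. boundaries p (complex_after ?es i) :: ('v, 'f) chain set"
  let ?fwd = "\<lambda>i. \<exists>\<sigma>. ?es ! i = Ins \<sigma>"
  have F: "persistence_intervals F p ?es = persistence_intervals TYPE('f) p ?es"
    by (simp add: persistence_intervals_def)
  obtain bs \<phi> where bar: "barcode ?Z ?B ?fwd ?n bs \<phi>" and bd: "\<forall>(b, d)\<in>set bs. 1 \<le> b \<and> b \<le> d \<and> d < ?n"
    and P: "persistence_intervals TYPE('f) p ?es = image_mset (\<lambda>(b, d). (b, d + 1)) (mset bs)"
    using persistence_intervals_barcode[OF assms(1), of p] assms(2) by auto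
  interpret elementary_zigzag ?Z ?B ?fwd ?n using elementary_zigzag_homology[OF assms(1), of p] by simp
  \<comment> \<open>Complex number \<open>b\<close> is produced by list entry \<open>b - 1\<close>,
    and the bar ends when entry \<open>d\<close> produces complex number
    \<open>d + 1\<close>.\<close>
  define g where "g = (\<lambda>(b, d). (fst (f ! (b - 1)), fst (f ! d)))"
  define Q where "Q = image_mset g (mset bs)"
  show ?thesis
  proof (rule that[of Q])
    show "PH F p f = image_mset emb Q"
      by (simp add: PH_def P F Q_def g_def multiset.map_comp o_def case_prod_unfold)
    have Qin: "\<exists>b d. (b, d) \<in> set bs \<and> x = fst (f ! (b - 1)) \<and> y = fst (f ! d) \<and> 1 \<le> b \<and> b \<le> d \<and> d < ?n"
      if "(x, y) \<in># Q" for x y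
      using that bd by (fastforce simp: Q_def g_def)
    have "x \<le> y" if xy: "(x, y) \<in># Q" for x y
    proof -
      obtain b d where "x = fst (f ! (b - 1))" "y = fst (f ! d)" "1 \<le> b" "b \<le> d" "d < ?n" using Qin[OF xy] by blast
      then show ?thesis using sorted_nth_mono[OF assms(3), of "b - 1" d] by simp
    qed
    then show "\<forall>x y. (x, y) \<in># Q \<longrightarrow> x \<le> y" by blast
    have dim: "\<exists>ev. (fst (f ! i), ev) \<in> set f \<and> (\<exists>\<sigma>. sdim \<sigma> \<in> {p, Suc p} \<and> ev \<in> {Ins \<sigma>, Del \<sigma>})"
      if i: "i < ?n" and al: "alive bs j (Suc i) \<noteq> alive bs j i" for i j
    proof -
      obtain \<sigma> where \<sigma>: "snd (f ! i) \<in> {Ins \<sigma>, Del \<sigma>}" by (cases "snd (f ! i)") auto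
      have "sdim \<sigma> \<in> {p, Suc p}"
      proof (rule ccontr)
        assume *: "sdim \<sigma> \<notin> {p, Suc p}"
        have "\<rho> \<in> complex_after ?es (Suc i) \<longleftrightarrow> \<rho> \<in> complex_after ?es i" if "sdim \<rho> \<in> {p, Suc p}" for \<rho>
        proof -
          have "\<rho> \<noteq> \<sigma>" using that * by metis
          moreover have e: "complex_after ?es (Suc i) = apply_event (snd (f ! i)) (complex_after ?es i)"
            using complex_after_Suc[of i ?es] i by simp
          ultimately show ?thesis using \<sigma> unfolding e by auto
        qed
        then have "chains q (complex_after ?es (Suc i)) = (chains q (complex_after ?es i) :: ('v, 'f) chain set)" if "q \<in> {p, Suc p}" for q
          using that by (intro chains_cong) auto
        then have "?Z (Suc i) = ?Z i" "?B (Suc i) = ?B i" by (simp_all add: cycles_def boundaries_def)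
        then show False using alive_Suc_iff[OF bar i] al by blast
      qed
      moreover have "(fst (f ! i), snd (f ! i)) \<in> set f" using i by simp
      ultimately show ?thesis using \<sigma> by blast
    qed
    have "(\<exists>ev. (x, ev) \<in> set f \<and> (\<exists>\<sigma>. sdim \<sigma> \<in> {p, Suc p} \<and> ev \<in> {Ins \<sigma>, Del \<sigma>})) \<and>
      (\<exists>ev. (y, ev) \<in> set f \<and> (\<exists>\<sigma>. sdim \<sigma> \<in> {p, Suc p} \<and> ev \<in> {Ins \<sigma>, Del \<sigma>}))" if xy: "(x, y) \<in># Q" for x y
    proof -
      obtain b d where b: "(b, d) \<in> set bs" "x = fst (f ! (b - 1))" "y = fst (f ! d)" "1 \<le> b" "b \<le> d" "d < ?n"
        using Qin[OF xy] by blast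
      obtain j where j: "j < length bs" "bs ! j = (b, d)" using b(1) by (metis in_set_conv_nth)
      have "alive bs j b \<noteq> alive bs j (b - 1)" "alive bs j (Suc d) \<noteq> alive bs j d" using j b by (auto simp: alive_def)
      then show ?thesis using dim[of "b - 1" j] dim[of d j] b by simp
    qed
    then show "\<forall>x y. (x, y) \<in># Q \<longrightarrow> (\<exists>ev. (x, ev) \<in> set f \<and> (\<exists>\<sigma>. sdim \<sigma> \<in> {p, Suc p} \<and> ev \<in> {Ins \<sigma>, Del \<sigma>})) \<and>
      (\<exists>ev. (y, ev) \<in> set f \<and> (\<exists>\<sigma>. sdim \<sigma> \<in> {p, Suc p} \<and> ev \<in> {Ins \<sigma>, Del \<sigma>}))" by blast
    have "size {#q\<in>#Q. fst q \<le> s \<and> t < snd q#} = card (full_bars bs (pos f s) (pos f t))" for s t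
    proof -
      have "{#q\<in>#Q. fst q \<le> s \<and> t < snd q#} = image_mset g {#x\<in>#mset bs. fst (g x) \<le> s \<and> t < snd (g x)#}"
        unfolding Q_def by (simp add: filter_mset_image_mset)
      also have "{#x\<in>#mset bs. fst (g x) \<le> s \<and> t < snd (g x)#} = {#x\<in>#mset bs. fst x \<le> pos f s \<and> pos f t \<le> snd x#}"
      proof (rule filter_mset_cong[OF refl])
        fix x assume "x \<in># mset bs"
        then have x: "1 \<le> fst x" "fst x \<le> snd x" "snd x < ?n" using bd by (auto simp: case_prod_unfold)
        have gx: "fst (g x) = fst (f ! (fst x - 1))" "snd (g x) = fst (f ! snd x)"
          by (simp_all add: g_def case_prod_unfold)
        have "fst x - 1 < length f" using x by linarith
        then have "fst (g x) \<le> s \<longleftrightarrow> fst x - 1 < pos f s" unfolding gx using less_pos_iff[OF assms(3)] by blast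
        moreover have "fst x - 1 < pos f s \<longleftrightarrow> fst x \<le> pos f s" using x(1) by linarith
        moreover have "fst (f ! snd x) \<le> t \<longleftrightarrow> snd x < pos f t" using less_pos_iff[OF assms(3) x(3)] by blast
        then have "t < snd (g x) \<longleftrightarrow> pos f t \<le> snd x" unfolding gx by linarith
        ultimately show "(fst (g x) \<le> s \<and> t < snd (g x)) \<longleftrightarrow> (fst x \<le> pos f s \<and> pos f t \<le> snd x)" by simp
      qed
      finally show ?thesis by (simp add: card_full_bars)
    qed
    then show "\<exists>bs \<phi>. barcode ?Z ?B ?fwd ?n bs \<phi> \<and>
      (\<forall>s t. size {#q\<in>#Q. fst q \<le> s \<and> t < snd q#} = card (full_bars bs (pos f s) (pos f t)))"
      using bar by blast
  qed
qed

text \<open>A quantitative form of being outside the exceptional set.\<close>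

definition nondegenerate :: "'v set set \<Rightarrow> nat \<Rightarrow> real \<Rightarrow> real \<Rightarrow> 'v filt \<Rightarrow> bool" where
  "nondegenerate K p \<epsilon> \<mu> v \<longleftrightarrow>
     (\<forall>\<sigma>\<in>K. sdim \<sigma> \<in> {p, Suc p} \<longrightarrow> (\<forall>i. \<mu> \<le> max \<bar>v \<sigma> i - \<epsilon>\<bar> \<bar>v \<sigma> (Suc i) - \<epsilon>\<bar>)) \<and>
     (\<forall>\<sigma>\<in>K. sdim \<sigma> = p \<longrightarrow> (\<forall>i. v \<sigma> (Suc i) = \<epsilon> \<longrightarrow> v \<sigma> i < \<epsilon> \<or> v \<sigma> (Suc (Suc i)) < \<epsilon>)) \<and>
     (\<forall>\<sigma>\<in>K. sdim \<sigma> = Suc p \<longrightarrow> (\<forall>i. v \<sigma> (Suc i) = \<epsilon> \<longrightarrow> v \<sigma> i > \<epsilon> \<or> v \<sigma> (Suc (Suc i)) > \<epsilon>))"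

definition crossing_times :: "nat \<Rightarrow> 'v set set \<Rightarrow> nat \<Rightarrow> real \<Rightarrow> 'v filt \<Rightarrow> real set" where
  "crossing_times N K p \<epsilon> v =
     {c. 0 \<le> c \<and> c \<le> real (N + 1) \<and> (\<exists>\<sigma>\<in>K. sdim \<sigma> \<in> {p, Suc p} \<and> interpolate (v \<sigma>) c = \<epsilon>)}"

lemma FF_zero: "v \<in> FF N K \<Longrightarrow> i \<notin> {1..N} \<Longrightarrow> v \<sigma> i = 0"
  by (auto simp: FF_def)

text \<open>A fixed centre \<open>v\<close> against which nearby functions are compared. The
  separation and the margin make \<open>c - \<gamma>\<close> and \<open>c + \<gamma>\<close>, for
  crossing times \<open>c\<close>, usable as observation times.\<close>

locale stability =
  fixes K :: "'v set set" and r :: "'v event rel" and N p :: nat and \<epsilon> \<mu> \<gamma> :: real and v :: "'v filt"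
  assumes K: "simplicial_complex K" and r: "event_order K r" and \<epsilon>: "\<epsilon> > 0" and \<mu>: "\<mu> > 0"
    and v: "v \<in> FF N K" and nd: "nondegenerate K p \<epsilon> \<mu> v"
    and \<gamma>: "\<gamma> > 0"
    and sep: "\<And>c c'. c \<in> crossing_times N K p \<epsilon> v \<Longrightarrow> c' \<in> crossing_times N K p \<epsilon> v \<Longrightarrow> c \<noteq> c' \<Longrightarrow> 2 * \<gamma> < \<bar>c - c'\<bar>"
    and margin: "\<And>c. c \<in> crossing_times N K p \<epsilon> v \<Longrightarrow> \<gamma> \<le> c \<and> c + \<gamma> < real (N + 1)"
begin

abbreviation C :: "real set" where "C \<equiv> crossing_times N K p \<epsilon> v"

text \<open>The last clause keeps vertices that are off the level on their side, so crossings of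
  \<open>w\<close> stem from crossings of \<open>v\<close>. The number \<open>\<eta> / \<mu>\<close>
  bounds the displacement of events and has to stay below the separation radius.\<close>

definition close :: "'v filt \<Rightarrow> real \<Rightarrow> bool" where
  "close w \<eta> \<longleftrightarrow> w \<in> FF N K \<and> 0 \<le> \<eta> \<and> \<eta> / \<mu> < \<gamma> \<and> (\<forall>\<sigma> i. \<bar>v \<sigma> i - w \<sigma> i\<bar> \<le> \<eta>) \<and>
     (\<forall>\<sigma>\<in>K. \<forall>i. v \<sigma> i \<noteq> \<epsilon> \<longrightarrow> \<eta> < \<bar>v \<sigma> i - \<epsilon>\<bar>)"

text \<open>At these times every simplex of dimension \<open>p\<close> or \<open>p\<close> + 1 has
  the same status for all functions close to \<open>v\<close>.\<close>

definition generic :: "real set" where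
  "generic = {u. 0 \<le> u \<and> u < real (N + 1) \<and> (\<forall>c\<in>C. \<gamma> \<le> \<bar>u - c\<bar>)}"

abbreviation events :: "'v filt \<Rightarrow> (real \<times> 'v event) list" where
  "events w \<equiv> encode r (S N K \<epsilon> w)"

lemma finite_C: "finite C"
proof (rule finite_subset)
  have fin: "finite K" using K by (simp add: simplicial_complex_def)
  show "finite (\<Union>\<sigma>\<in>{\<sigma> \<in> K. sdim \<sigma> \<in> {p, Suc p}}. {c. 0 \<le> c \<and> c \<le> real (N + 1) \<and> interpolate (v \<sigma>) c = \<epsilon>})"
    using fin nd \<mu> by (intro finite_UN_I finite_crossings[of \<mu>]) (auto simp: nondegenerate_def)
qed (auto simp: crossing_times_def)

lemma near_crossing:
  assumes w: "close w \<eta>" and \<sigma>: "\<sigma> \<in> K" "sdim \<sigma> \<in> {p, Suc p}" and x: "0 \<le> x" "x \<le> real (N + 1)"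
    and near: "\<bar>interpolate (v \<sigma>) x - \<epsilon>\<bar> \<le> \<eta>"
  obtains c where "c \<in> C" "interpolate (v \<sigma>) c = \<epsilon>" "\<bar>x - c\<bar> \<le> \<eta> / \<mu>"
proof -
  have \<eta>: "\<And>i. v \<sigma> i \<noteq> \<epsilon> \<Longrightarrow> \<eta> < \<bar>v \<sigma> i - \<epsilon>\<bar>" using w \<sigma>(1) by (simp add: close_def)
  \<comment> \<open>The last vertex has value 0, which is off the level. Excluding it keeps the
    segment found below, and with it the crossing, inside the range of
    \<open>crossing_times\<close>.\<close>
  have "x \<noteq> real (N + 1)"
  proof
    assume *: "x = real (N + 1)"
    have z: "v \<sigma> (N + 1) = 0" using FF_zero[OF v] by simp
    then have "interpolate (v \<sigma>) x = 0" using interpolate_segment[of "N + 1" x "v \<sigma>"] * by simp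
    then show False using near \<eta>[of "N + 1"] z \<epsilon> by simp
  qed
  then have xN: "x < real (N + 1)" using x by simp
  obtain i c where ic: "real i \<le> x" "x < real i + 1" "real i \<le> c" "c \<le> real i + 1" "interpolate (v \<sigma>) c = \<epsilon>" "\<bar>x - c\<bar> \<le> \<eta> / \<mu>"
    using crossing_near[OF \<mu> _ \<eta> x(1) near] nd \<sigma> unfolding nondegenerate_def by metis
  have "i \<le> N" using ic(1) xN by linarith
  then have "c \<le> real (N + 1)" "0 \<le> c" using ic by auto
  then have "c \<in> C" using \<sigma> ic(5) by (auto simp: crossing_times_def)
  then show ?thesis using that ic by blast
qed

text \<open>Only crossings of the simplex itself have to be far away, so this applies also at
  non-generic times close to crossings of other simplices. Where \<open>v\<close> is more than
  \<eta> off the level, \<open>w\<close> is on the same side.\<close>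

lemma side:
  assumes w: "close w \<eta>" and \<sigma>: "\<sigma> \<in> K" "sdim \<sigma> \<in> {p, Suc p}" and x: "0 \<le> x" "x \<le> real (N + 1)"
    and away: "\<And>c. c \<in> C \<Longrightarrow> interpolate (v \<sigma>) c = \<epsilon> \<Longrightarrow> \<gamma> \<le> \<bar>x - c\<bar>"
  shows "\<sigma> \<in> complex_at K \<epsilon> w x \<longleftrightarrow> interpolate (v \<sigma>) x > \<epsilon>" "interpolate (v \<sigma>) x \<noteq> \<epsilon>"
proof -
  have far: "\<not> \<bar>interpolate (v \<sigma>) x - \<epsilon>\<bar> \<le> \<eta>"
  proof
    assume "\<bar>interpolate (v \<sigma>) x - \<epsilon>\<bar> \<le> \<eta>"
    then obtain c where "c \<in> C" "interpolate (v \<sigma>) c = \<epsilon>" "\<bar>x - c\<bar> \<le> \<eta> / \<mu>" using near_crossing[OF w \<sigma> x] by blast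
    moreover from this have "\<gamma> \<le> \<bar>x - c\<bar>" by (intro away)
    moreover have "\<eta> / \<mu> < \<gamma>" using w by (simp add: close_def)
    ultimately show False by linarith
  qed
  have d: "\<bar>interpolate (v \<sigma>) x - interpolate (w \<sigma>) x\<bar> \<le> \<eta>" "0 \<le> \<eta>"
    using w interpolate_diff_le[OF x(1), of "v \<sigma>" "w \<sigma>"] by (auto simp: close_def)
  show "interpolate (v \<sigma>) x \<noteq> \<epsilon>" using far d(2) by auto
  show "\<sigma> \<in> complex_at K \<epsilon> w x \<longleftrightarrow> interpolate (v \<sigma>) x > \<epsilon>"
  proof (cases "interpolate (v \<sigma>) x > \<epsilon>")
    case True
    then have "interpolate (w \<sigma>) x > \<epsilon>" using far d by linarith
    then show ?thesis using True complex_at_above[OF \<sigma>(1) x(1)] by simp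
  next
    case False
    then have "interpolate (w \<sigma>) x < \<epsilon>" using far d by linarith
    then show ?thesis using False complex_at_below[OF x(1)] by blast
  qed
qed

lemma generic_C:
  assumes c: "c \<in> C" shows "c + \<gamma> \<in> generic" "c - \<gamma> \<in> generic"
proof -
  have "\<gamma> \<le> \<bar>c + \<gamma> - c'\<bar> \<and> \<gamma> \<le> \<bar>c - \<gamma> - c'\<bar>" if "c' \<in> C" for c'
  proof (cases "c' = c")
    case False
    then have "2 * \<gamma> < \<bar>c - c'\<bar>" using sep[of c c'] c that by simp
    then show ?thesis by linarith
  qed (use \<gamma> in simp)
  then show "c + \<gamma> \<in> generic" "c - \<gamma> \<in> generic" using margin[OF c] \<gamma> by (auto simp: generic_def)
qed

text \<open>Between generic times with at most one crossing time, the hypotheses of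
  \<open>zrel_cluster\<close> hold for \<open>w\<close>. A \<open>p\<close>-simplex present at both
  ends lies above the level there for \<open>v\<close>; with one possible crossing and no contact
  from above it stays above, hence has no crossing in between, and \<open>w\<close> keeps it as
  well. A (\<open>p\<close> + 1)-simplex absent at both ends is treated symmetrically.\<close>

lemma path_rel_single:
  fixes F :: "'f::field itself"
  assumes w: "close w \<eta>" and st: "s \<in> generic" "t \<in> generic" "s \<le> t" and one: "card (C \<inter> {s..t}) \<le> 1"
  shows "path_rel F p (events w) s t = {(x, y). x \<in> cycles p (complex_at K \<epsilon> w s) \<and> y \<in> cycles p (complex_at K \<epsilon> w t) \<and>
     x - y \<in> boundaries p (complex_at K \<epsilon> w s \<union> complex_at K \<epsilon> w t)}"
proof -
  let ?f = "events w" and ?es = "map snd (events w)" and ?Kf = "complex_at K \<epsilon> w"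
  have wF: "w \<in> FF N K" using w by (simp add: close_def)
  note enc = encode_S[OF K r \<epsilon> wF]
  have s: "0 \<le> s" "s < real (N + 1)" and t: "0 \<le> t" "t < real (N + 1)" using st by (auto simp: generic_def)
  have Ms: "complex_after ?es (pos ?f s) = ?Kf s" and Mt: "complex_after ?es (pos ?f t) = ?Kf t"
    using enc(4)[OF s] enc(4)[OF t] by (simp_all add: pos_def)
  have ple: "pos ?f s \<le> pos ?f t" "pos ?f t \<le> length ?f" using pos_mono[OF st(3)] pos_le_length by auto
  have pk: "pos ?f s + (pos ?f t - pos ?f s) = pos ?f t" using ple by simp
  have time: "s \<le> fst (?f ! l) \<and> fst (?f ! l) \<le> t" if "pos ?f s \<le> l" "l < pos ?f t" for l
    using less_pos_iff[OF enc(3), of l s] less_pos_iff[OF enc(3), of l t] that ple by auto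
  have ev: "f \<in> set ?f \<Longrightarrow> case snd f of Ins \<sigma> \<Rightarrow> \<sigma> \<in> ?Kf (fst f) | Del \<sigma> \<Rightarrow> \<sigma> \<notin> ?Kf (fst f)" for f
    using enc(5)[of "fst f" "snd f"] by (auto split: event.splits)
  \<comment> \<open>Complexes inside a group of simultaneous events need not be of the form
    \<open>?Kf x\<close>. They are reached by induction over the events: a simplex that is present
    at all times is never deleted, since a deletion would show at its own time.\<close>
  have persist: "\<sigma> \<in> complex_after ?es l"
    if c: "\<And>x. s \<le> x \<Longrightarrow> x \<le> t \<Longrightarrow> \<sigma> \<in> ?Kf x" and l: "pos ?f s \<le> l" "l \<le> pos ?f t" for \<sigma> l
    using l
  proof (induction l rule: dec_induct)
    case base
    then show ?case using c[of s] st(3) by (simp add: Ms)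
  next
    case (step l)
    have le: "l < length ?f" using step ple by simp
    have "?es ! l \<noteq> Del \<sigma>"
    proof
      assume "?es ! l = Del \<sigma>"
      then have "\<sigma> \<notin> ?Kf (fst (?f ! l))" using ev[of "?f ! l"] le by simp
      then show False using c time[of l] step by simp
    qed
    then show ?case using step le by (cases "?es ! l") (auto simp: complex_after_Suc)
  qed
  have avoid: "\<sigma> \<notin> complex_after ?es l"
    if c: "\<And>x. s \<le> x \<Longrightarrow> x \<le> t \<Longrightarrow> \<sigma> \<notin> ?Kf x" and l: "pos ?f s \<le> l" "l \<le> pos ?f t" for \<sigma> l
    using l
  proof (induction l rule: dec_induct)
    case base
    then show ?case using c[of s] st(3) by (simp add: Ms)
  next
    case (step l)
    have le: "l < length ?f" using step ple by simp
    have "?es ! l \<noteq> Ins \<sigma>"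
    proof
      assume "?es ! l = Ins \<sigma>"
      then have "\<sigma> \<in> ?Kf (fst (?f ! l))" using ev[of "?f ! l"] le by simp
      then show False using c time[of l] step by simp
    qed
    then show ?case using step le by (cases "?es ! l") (auto simp: complex_after_Suc)
  qed
  have single: "x = y" if "s \<le> x" "x \<le> y" "y \<le> t" "interpolate (v \<sigma>) x = \<epsilon>" "interpolate (v \<sigma>) y = \<epsilon>"
    "\<sigma> \<in> K" "sdim \<sigma> \<in> {p, Suc p}" for x y \<sigma>
  proof -
    have "x \<in> C \<inter> {s..t}" "y \<in> C \<inter> {s..t}" using that s t by (auto simp: crossing_times_def)
    then show ?thesis using one finite_C by (metis card_le_Suc0_iff_eq finite_Int One_nat_def)
  qed
  \<comment> \<open>A simplex without crossing between \<open>s\<close> and \<open>t\<close> has its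
    crossings outside, at distance at least \<gamma> from the generic ends and so from every time in
    between.\<close>
  have away: "\<gamma> \<le> \<bar>x - c\<bar>"
    if x: "s \<le> x" "x \<le> t" and c: "c \<in> C" "interpolate (v \<sigma>) c = \<epsilon>"
      and nz: "\<And>y. s \<le> y \<Longrightarrow> y \<le> t \<Longrightarrow> interpolate (v \<sigma>) y \<noteq> \<epsilon>" for x c \<sigma>
  proof -
    have "\<gamma> \<le> \<bar>s - c\<bar>" "\<gamma> \<le> \<bar>t - c\<bar>" using st c by (auto simp: generic_def)
    moreover have "c < s \<or> t < c" using nz[of c] c(2) by force
    ultimately show ?thesis using x by linarith
  qed
  have low: "\<sigma> \<in> complex_after ?es l" if l: "pos ?f s \<le> l" "l \<le> pos ?f t" and \<sigma>: "sdim \<sigma> = p" "\<sigma> \<in> ?Kf s" "\<sigma> \<in> ?Kf t" for \<sigma> l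
  proof (rule persist[OF _ l])
    have \<sigma>K: "\<sigma> \<in> K" "sdim \<sigma> \<in> {p, Suc p}" using \<sigma> by (auto simp: complex_at_def)
    have "interpolate (v \<sigma>) s > \<epsilon>" "interpolate (v \<sigma>) t > \<epsilon>"
      using side[OF w \<sigma>K, of s] side[OF w \<sigma>K, of t] s t st \<sigma> by (auto simp: generic_def)
    moreover have "\<And>i. \<mu> \<le> max \<bar>v \<sigma> i - \<epsilon>\<bar> \<bar>v \<sigma> (Suc i) - \<epsilon>\<bar>"
      "\<And>i. v \<sigma> (Suc i) = \<epsilon> \<Longrightarrow> v \<sigma> i < \<epsilon> \<or> v \<sigma> (Suc (Suc i)) < \<epsilon>"
      using nd \<sigma>K \<sigma>(1) unfolding nondegenerate_def by blast+
    ultimately have above: "interpolate (v \<sigma>) x > \<epsilon>" if "s \<le> x" "x \<le> t" for x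
      using above_between[OF \<mu> _ _ s(1) _ _ single[OF _ _ _ _ _ \<sigma>K] that] by blast
    fix x assume x: "s \<le> x" "x \<le> t"
    have "0 \<le> x" "x \<le> real (N + 1)" using x s t by auto
    moreover have "\<gamma> \<le> \<bar>x - c\<bar>" if "c \<in> C" "interpolate (v \<sigma>) c = \<epsilon>" for c
      using away[OF x that] above by (metis less_irrefl)
    ultimately have "\<sigma> \<in> ?Kf x \<longleftrightarrow> interpolate (v \<sigma>) x > \<epsilon>" by (intro side[OF w \<sigma>K])
    then show "\<sigma> \<in> ?Kf x" using above[OF x] by simp
  qed
  have up: "\<sigma> \<in> ?Kf s \<union> ?Kf t" if l: "pos ?f s \<le> l" "l \<le> pos ?f t" and \<sigma>: "sdim \<sigma> = Suc p" "\<sigma> \<in> complex_after ?es l" for \<sigma> l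
  proof (rule ccontr)
    assume no: "\<sigma> \<notin> ?Kf s \<union> ?Kf t"
    have "\<sigma> \<notin> complex_after ?es l"
    proof (cases "\<sigma> \<in> K")
      case False
      then show ?thesis by (intro avoid[OF _ l]) (auto simp: complex_at_def)
    next
      case True
      then have \<sigma>K: "\<sigma> \<in> K" "sdim \<sigma> \<in> {p, Suc p}" using \<sigma> by auto
      have "interpolate (v \<sigma>) s < \<epsilon>" "interpolate (v \<sigma>) t < \<epsilon>"
        using side[OF w \<sigma>K, of s] side[OF w \<sigma>K, of t] s t st no by (auto simp: generic_def)
      moreover have "\<And>i. \<mu> \<le> max \<bar>v \<sigma> i - \<epsilon>\<bar> \<bar>v \<sigma> (Suc i) - \<epsilon>\<bar>"
        "\<And>i. v \<sigma> (Suc i) = \<epsilon> \<Longrightarrow> v \<sigma> i > \<epsilon> \<or> v \<sigma> (Suc (Suc i)) > \<epsilon>"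
        using nd \<sigma>K \<sigma>(1) unfolding nondegenerate_def by blast+
      ultimately have below: "interpolate (v \<sigma>) x < \<epsilon>" if "s \<le> x" "x \<le> t" for x
        using below_between[OF \<mu> _ _ s(1) _ _ single[OF _ _ _ _ _ \<sigma>K] that] by blast
      show ?thesis
      proof (rule avoid[OF _ l])
        fix x assume x: "s \<le> x" "x \<le> t"
        have "0 \<le> x" "x \<le> real (N + 1)" using x s t by auto
        moreover have "\<gamma> \<le> \<bar>x - c\<bar>" if "c \<in> C" "interpolate (v \<sigma>) c = \<epsilon>" for c
          using away[OF x that] below by (metis less_irrefl)
        ultimately have "\<sigma> \<in> ?Kf x \<longleftrightarrow> interpolate (v \<sigma>) x > \<epsilon>" by (intro side[OF w \<sigma>K])
        then show "\<sigma> \<notin> ?Kf x" using below[OF x] by simp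
      qed
    qed
    then show False using \<sigma>(2) by contradiction
  qed
  have "zrel (\<lambda>l. cycles p (complex_after ?es l) :: ('v, 'f) chain set) (\<lambda>l. boundaries p (complex_after ?es l))
      (pos ?f s) (pos ?f t - pos ?f s) =
    {(x, y). x \<in> cycles p (complex_after ?es (pos ?f s)) \<and>
       y \<in> cycles p (complex_after ?es (pos ?f s + (pos ?f t - pos ?f s))) \<and>
       x - y \<in> boundaries p (complex_after ?es (pos ?f s) \<union> complex_after ?es (pos ?f s + (pos ?f t - pos ?f s)))}"
  proof (rule zrel_cluster)
    show "elementary_zigzag (\<lambda>l. cycles p (complex_after ?es l) :: ('v, 'f) chain set) (\<lambda>l. boundaries p (complex_after ?es l))
      (\<lambda>i. \<exists>\<sigma>. ?es ! i = Ins \<sigma>) (length ?es)"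
      by (rule elementary_zigzag_homology[OF enc(1)])
    show "simplicial_complex (complex_after ?es l)" if "l \<le> length ?es" for l
      using enc(1) that by (simp add: valid_events_def)
  qed (use ple low up in \<open>simp_all only: pk Ms Mt length_map\<close>)
  then show ?thesis unfolding path_rel_def pk Ms Mt .
qed

text \<open>The formula in \<open>path_rel_single\<close> involves only simplices of dimension
  \<open>p\<close> and \<open>p\<close> + 1 at generic times, whose status is the same for
  \<open>w\<close> and \<open>w'\<close>. Longer ranges are cut at a generic time and the relations
  composed, by induction on the number of crossing times.\<close>

lemma path_rel_eq:
  fixes F :: "'f::field itself"
  assumes w: "close w \<eta>" and w': "close w' \<eta>'" and st: "s \<in> generic" "t \<in> generic" "s \<le> t"
  shows "path_rel F p (events w) s t = path_rel F p (events w') s t"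
  using st
proof (induction "card (C \<inter> {s..t})" arbitrary: s t rule: less_induct)
  case less
  show ?case
  proof (cases "card (C \<inter> {s..t}) \<le> 1")
    case True
    have iff: "\<sigma> \<in> complex_at K \<epsilon> w u \<longleftrightarrow> \<sigma> \<in> complex_at K \<epsilon> w' u" if "u \<in> generic" "sdim \<sigma> \<in> {p, Suc p}" for u \<sigma>
    proof (cases "\<sigma> \<in> K")
      case True
      have "0 \<le> u" "u \<le> real (N + 1)" "\<And>c. c \<in> C \<Longrightarrow> \<gamma> \<le> \<bar>u - c\<bar>" using that by (auto simp: generic_def)
      then show ?thesis using side(1)[OF w True that(2)] side(1)[OF w' True that(2)] by simp
    qed (auto simp: complex_at_def)
    have ch: "chains q (complex_at K \<epsilon> w u) = (chains q (complex_at K \<epsilon> w' u) :: ('v, 'f) chain set)"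
      if "u \<in> generic" "q \<in> {p, Suc p}" for u q
      using iff[OF that(1)] that(2) by (intro chains_cong) auto
    have "chains (Suc p) (complex_at K \<epsilon> w s \<union> complex_at K \<epsilon> w t) =
        (chains (Suc p) (complex_at K \<epsilon> w' s \<union> complex_at K \<epsilon> w' t) :: ('v, 'f) chain set)"
      using iff[OF less.prems(1)] iff[OF less.prems(2)] by (intro chains_cong) auto
    then have "boundaries p (complex_at K \<epsilon> w s \<union> complex_at K \<epsilon> w t) =
        (boundaries p (complex_at K \<epsilon> w' s \<union> complex_at K \<epsilon> w' t) :: ('v, 'f) chain set)"
      by (simp add: boundaries_def)
    moreover have "cycles p (complex_at K \<epsilon> w u) = (cycles p (complex_at K \<epsilon> w' u) :: ('v, 'f) chain set)" if "u \<in> generic" for u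
      using ch[OF that, of p] by (simp add: cycles_def)
    ultimately show ?thesis
      using less.prems by (simp add: path_rel_single[OF w less.prems True] path_rel_single[OF w' less.prems True])
  next
    case False
    let ?A = "C \<inter> {s..t}"
    have fin: "finite ?A" using finite_C by simp
    have ne: "?A \<noteq> {}" using False by auto
    define c where "c = Min ?A"
    have c: "c \<in> ?A" "\<And>c'. c' \<in> ?A \<Longrightarrow> c \<le> c'" using Min_in[OF fin ne] Min_le[OF fin] by (auto simp: c_def)
    obtain c2 where c2: "c2 \<in> ?A" "c2 \<noteq> c"
      using False c(1) fin card_le_Suc0_iff_eq[OF fin] by (metis One_nat_def)
    \<comment> \<open>Lies strictly between the smallest crossing time of the range and every other
      one, so each of the two parts misses at least one of them.\<close>
    define u where "u = c + \<gamma>"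
    have "c < c2" using c(2)[OF c2(1)] c2(2) by simp
    then have "c + 2 * \<gamma> < c2" using sep[of c c2] c(1) c2(1) by auto
    then have ut: "u \<le> t" "s \<le> u" using c c2 \<gamma> by (auto simp: u_def)
    have ug: "u \<in> generic" using generic_C(1) c(1) by (simp add: u_def)
    have lt: "card A' < card ?A" if "A' \<subseteq> ?A - {x}" "x \<in> ?A" for A' x
      using card_mono[of "?A - {x}" A'] card_Diff1_less[OF fin that(2)] that(1) fin by simp
    have "C \<inter> {u..t} \<subseteq> ?A - {c}" using ut(2) \<gamma> by (auto simp: u_def)
    then have "card (C \<inter> {u..t}) < card ?A" using c(1) by (rule lt)
    then have "path_rel F p (events w) u t = path_rel F p (events w') u t"
      using less.hyps ug less.prems(2) ut(1) by blast
    moreover have "C \<inter> {s..u} \<subseteq> ?A - {c2}" using ut(1) \<open>c + 2 * \<gamma> < c2\<close> \<gamma> by (auto simp: u_def)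
    then have "card (C \<inter> {s..u}) < card ?A" using c2(1) by (rule lt)
    then have "path_rel F p (events w) s u = path_rel F p (events w') s u"
      using less.hyps ug less.prems(1) ut(2) by blast
    moreover have "valid_events (map snd (events w))" "valid_events (map snd (events w'))"
      using encode_S(1)[OF K r \<epsilon>] w w' by (auto simp: close_def)
    ultimately show ?thesis using path_rel_compose ut by metis
  qed
qed

lemma close_self: "close v 0"
  using v \<gamma> by (simp add: close_def)

text \<open>An event of \<open>w\<close> sits where \<open>w\<close> meets the level. There
  \<open>v\<close> is within \<eta> of the level, and the slope bound turns this into a distance in
  time.\<close>

lemma event_near:
  assumes w: "close w \<eta>" and ev: "(x, ev) \<in> set (events w)" "sdim \<sigma> \<in> {p, Suc p}" "ev \<in> {Ins \<sigma>, Del \<sigma>}"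
  shows "\<exists>c\<in>C. \<bar>x - c\<bar> \<le> \<eta> / \<mu>"
proof -
  have wF: "w \<in> FF N K" using w by (simp add: close_def)
  obtain a where a: "0 < x" "x \<le> real (N + 1)" "0 \<le> a" "a < x" "case ev of
      Ins \<sigma> \<Rightarrow> \<sigma> \<in> complex_at K \<epsilon> w x \<and> (\<forall>s\<in>{a..<x}. \<sigma> \<notin> complex_at K \<epsilon> w s)
    | Del \<sigma> \<Rightarrow> \<sigma> \<notin> complex_at K \<epsilon> w x \<and> \<sigma> \<in> complex_at K \<epsilon> w a \<and> (\<forall>s\<in>{a..<x}. \<sigma> \<in> complex_at K \<epsilon> w s)"
    using encode_S(5)[OF K r \<epsilon> wF ev(1)] by blast
  have \<sigma>: "\<sigma> \<in> K" using a(5) ev(3) by (auto simp: complex_at_def)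
  have "interpolate (w \<sigma>) x = \<epsilon>"
    using a ev(3) by (intro event_crossing[of a x \<sigma> K]) (auto simp: \<sigma>)
  then have "\<bar>interpolate (v \<sigma>) x - \<epsilon>\<bar> \<le> \<eta>"
    using interpolate_diff_le[of x "v \<sigma>" "w \<sigma>" \<eta>] a(1) w by (auto simp: close_def)
  then show ?thesis using near_crossing[OF w \<sigma> ev(2), of x] a(1,2) by (metis less_imp_le)
qed

text \<open>Equal relations between the times \<open>c - \<gamma>\<close> and
  \<open>c + \<gamma>\<close> give equal numbers of spanning bars, and these are the quadrant counts
  that allow the diagram of \<open>w\<close> to be snapped to that of \<open>v\<close>.\<close>

lemma stable:
  fixes F :: "'f::field itself"
  assumes w: "close w \<eta>"
  shows "matched (\<eta> / \<mu>) (PH F p (events w)) (PH F p (events v))"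
proof -
  have wF: "w \<in> FF N K" using w by (simp add: close_def)
  note enc = encode_S[OF K r \<epsilon> wF] and enc' = encode_S[OF K r \<epsilon> v]
  obtain Q where Q: "PH F p (events w) = image_mset emb Q" "\<forall>x y. (x, y) \<in># Q \<longrightarrow> x \<le> y"
    "\<forall>x y. (x, y) \<in># Q \<longrightarrow> (\<exists>ev. (x, ev) \<in> set (events w) \<and> (\<exists>\<sigma>. sdim \<sigma> \<in> {p, Suc p} \<and> ev \<in> {Ins \<sigma>, Del \<sigma>})) \<and>
      (\<exists>ev. (y, ev) \<in> set (events w) \<and> (\<exists>\<sigma>. sdim \<sigma> \<in> {p, Suc p} \<and> ev \<in> {Ins \<sigma>, Del \<sigma>}))"
    and ex: "\<exists>bs \<phi>. barcode (\<lambda>i. cycles p (complex_after (map snd (events w)) i) :: ('v, 'f) chain set)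
        (\<lambda>i. boundaries p (complex_after (map snd (events w)) i)) (\<lambda>i. \<exists>\<sigma>. map snd (events w) ! i = Ins \<sigma>) (length (events w)) bs \<phi> \<and>
      (\<forall>s t. size {#q\<in>#Q. fst q \<le> s \<and> t < snd q#} = card (full_bars bs (pos (events w) s) (pos (events w) t)))"
    by (rule PH_pairs[OF enc(1-3), of F p])
  obtain bs \<phi> where bar: "barcode (\<lambda>i. cycles p (complex_after (map snd (events w)) i) :: ('v, 'f) chain set)
        (\<lambda>i. boundaries p (complex_after (map snd (events w)) i)) (\<lambda>i. \<exists>\<sigma>. map snd (events w) ! i = Ins \<sigma>) (length (events w)) bs \<phi>"
    and cnt: "\<And>s t. size {#q\<in>#Q. fst q \<le> s \<and> t < snd q#} = card (full_bars bs (pos (events w) s) (pos (events w) t))"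
    using ex by blast
  obtain Q' where Q': "PH F p (events v) = image_mset emb Q'" "\<forall>x y. (x, y) \<in># Q' \<longrightarrow> x \<le> y"
    "\<forall>x y. (x, y) \<in># Q' \<longrightarrow> (\<exists>ev. (x, ev) \<in> set (events v) \<and> (\<exists>\<sigma>. sdim \<sigma> \<in> {p, Suc p} \<and> ev \<in> {Ins \<sigma>, Del \<sigma>})) \<and>
      (\<exists>ev. (y, ev) \<in> set (events v) \<and> (\<exists>\<sigma>. sdim \<sigma> \<in> {p, Suc p} \<and> ev \<in> {Ins \<sigma>, Del \<sigma>}))"
    and ex': "\<exists>bs \<phi>. barcode (\<lambda>i. cycles p (complex_after (map snd (events v)) i) :: ('v, 'f) chain set)
        (\<lambda>i. boundaries p (complex_after (map snd (events v)) i)) (\<lambda>i. \<exists>\<sigma>. map snd (events v) ! i = Ins \<sigma>) (length (events v)) bs \<phi> \<and>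
      (\<forall>s t. size {#q\<in>#Q'. fst q \<le> s \<and> t < snd q#} = card (full_bars bs (pos (events v) s) (pos (events v) t)))"
    by (rule PH_pairs[OF enc'(1-3), of F p])
  obtain bs' \<phi>' where bar': "barcode (\<lambda>i. cycles p (complex_after (map snd (events v)) i) :: ('v, 'f) chain set)
        (\<lambda>i. boundaries p (complex_after (map snd (events v)) i)) (\<lambda>i. \<exists>\<sigma>. map snd (events v) ! i = Ins \<sigma>) (length (events v)) bs' \<phi>'"
    and cnt': "\<And>s t. size {#q\<in>#Q'. fst q \<le> s \<and> t < snd q#} = card (full_bars bs' (pos (events v) s) (pos (events v) t))"
    using ex' by blast
  have "matched (\<eta> / \<mu>) (image_mset emb Q) (image_mset emb Q')"
  proof (rule matched_snap[where C = C and \<gamma> = \<gamma>])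
    show "0 \<le> \<eta> / \<mu>" "\<eta> / \<mu> < \<gamma>" using w \<mu> by (auto simp: close_def)
    show "x \<le> y \<and> (\<exists>c\<in>C. \<bar>x - c\<bar> \<le> \<eta> / \<mu>) \<and> (\<exists>c\<in>C. \<bar>y - c\<bar> \<le> \<eta> / \<mu>)" if "(x, y) \<in># Q" for x y
      using Q(2,3) that event_near[OF w] by meson
    show "x \<le> y \<and> x \<in> C \<and> y \<in> C" if "(x, y) \<in># Q'" for x y
    proof -
      \<comment> \<open>For \<open>v\<close> itself the displacement is 0, so its endpoints are
        crossing times.\<close>
      have "\<exists>c\<in>C. \<bar>x - c\<bar> \<le> 0 / \<mu>" "\<exists>c\<in>C. \<bar>y - c\<bar> \<le> 0 / \<mu>"
        using Q'(3) that event_near[OF close_self] by meson+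
      then show ?thesis using Q'(2) that by auto
    qed
    show "size {#q\<in>#Q. fst q \<le> s \<and> t < snd q#} = size {#q\<in>#Q'. fst q \<le> s \<and> t < snd q#}"
      if c: "c \<in> C" "c' \<in> C" "s \<in> {c - \<gamma>, c + \<gamma>}" "t \<in> {c' - \<gamma>, c' + \<gamma>}" and st: "s \<le> t" for c c' s t
    proof -
      have g: "s \<in> generic" "t \<in> generic" using generic_C[OF c(1)] generic_C[OF c(2)] c(3,4) by auto
      have le: "pos (events u) s \<le> pos (events u) t" "pos (events u) t \<le> length (events u)" for u
        using pos_mono[OF st] pos_le_length by auto
      have "zrel (\<lambda>i. cycles p (complex_after (map snd (events w)) i) :: ('v, 'f) chain set)
            (\<lambda>i. boundaries p (complex_after (map snd (events w)) i))
            (pos (events w) s) (pos (events w) t - pos (events w) s) =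
          zrel (\<lambda>i. cycles p (complex_after (map snd (events v)) i) :: ('v, 'f) chain set)
            (\<lambda>i. boundaries p (complex_after (map snd (events v)) i))
            (pos (events v) s) (pos (events v) t - pos (events v) s)"
        using path_rel_eq[OF w close_self g st, of F] by (simp only: path_rel_def)
      from card_full_bars_eq[OF _ _ bar bar' _ _ this] show ?thesis
        using elementary_zigzag_homology[OF enc(1), of p] elementary_zigzag_homology[OF enc'(1), of p] le[of w] le[of v]
        by (simp add: cnt cnt')
    qed
  qed (rule sep)
  then show ?thesis by (simp only: Q(1) Q'(1))
qed

end

text \<open>The radius depends on \<open>v\<close>, through the distances between its crossing times
  and of its values from the level, but the constant \<open>1 / \<mu>\<close> does not. This is the
  kind of estimate that \<open>matched_path\<close> can sum along a segment.\<close>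

lemma stable_at:
  fixes F :: "'f::field itself"
  assumes K: "simplicial_complex K" and r: "event_order K r" and \<epsilon>: "\<epsilon> > 0" and \<mu>: "\<mu> > 0"
    and v: "v \<in> FF N K" and nd: "nondegenerate K p \<epsilon> \<mu> v"
  shows "\<exists>\<delta>>0. \<forall>w\<in>FF N K. \<forall>\<eta>. 0 \<le> \<eta> \<longrightarrow> \<eta> < \<delta> \<longrightarrow> (\<forall>\<sigma> i. \<bar>v \<sigma> i - w \<sigma> i\<bar> \<le> \<eta>) \<longrightarrow>
    matched (\<eta> / \<mu>) (PH F p (encode r (S N K \<epsilon> w))) (PH F p (encode r (S N K \<epsilon> v)))"
proof -
  let ?C = "crossing_times N K p \<epsilon> v"
  have fin: "finite K" using K by (simp add: simplicial_complex_def)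
  have vz: "v \<sigma> i = 0" if "i \<notin> {1..N}" for \<sigma> i using FF_zero[OF v that] .
  have finC: "finite ?C"
  proof (rule finite_subset)
    show "finite (\<Union>\<sigma>\<in>{\<sigma> \<in> K. sdim \<sigma> \<in> {p, Suc p}}. {c. 0 \<le> c \<and> c \<le> real (N + 1) \<and> interpolate (v \<sigma>) c = \<epsilon>})"
      using fin nd \<mu> by (intro finite_UN_I finite_crossings[of \<mu>]) (auto simp: nondegenerate_def)
  qed (auto simp: crossing_times_def)
  have inside: "0 < c \<and> c < real (N + 1)" if c: "c \<in> ?C" for c
  proof -
    have "interpolate (v \<sigma>) 0 = 0" "interpolate (v \<sigma>) (real (N + 1)) = 0" for \<sigma>
      using interpolate_segment[of 0 0 "v \<sigma>"] interpolate_segment[of "N + 1" "real (N + 1)" "v \<sigma>"] vz by simp_all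
    then have "c \<noteq> 0" "c \<noteq> real (N + 1)" using c \<epsilon> by (auto simp: crossing_times_def)
    then show ?thesis using c by (auto simp: crossing_times_def)
  qed
  have "\<exists>\<gamma>>0. \<forall>(c, c')\<in>?C \<times> ?C. (c \<noteq> c' \<longrightarrow> 2 * \<gamma> < \<bar>c - c'\<bar>) \<and> \<gamma> \<le> c \<and> c + \<gamma> < real (N + 1)"
  proof (rule finite_common)
    fix x assume "x \<in> ?C \<times> ?C"
    then obtain c c' where x: "x = (c, c')" "c \<in> ?C" by auto
    \<comment> \<open>A third of the distance leaves room for the strict inequality with 2 \<gamma>,
      and half of the distance to the end leaves room for the strict inequality at
      \<open>N + 1\<close>.\<close>
    define \<gamma> where "\<gamma> = min (if c = c' then 1 else \<bar>c - c'\<bar> / 3) (min c ((real (N + 1) - c) / 2))"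
    have g: "\<gamma> \<le> (if c = c' then 1 else \<bar>c - c'\<bar> / 3)" "\<gamma> \<le> c" "\<gamma> \<le> (real (N + 1) - c) / 2"
      unfolding \<gamma>_def by (rule min.cobounded1, rule min.coboundedI2[OF min.cobounded1], rule min.coboundedI2[OF min.cobounded2])
    have "0 < \<gamma>" using inside[OF x(2)] by (auto simp: \<gamma>_def)
    moreover have "c \<noteq> c' \<longrightarrow> 2 * \<gamma> < \<bar>c - c'\<bar>"
    proof
      assume "c \<noteq> c'"
      then have "\<gamma> \<le> \<bar>c - c'\<bar> / 3" "0 < \<bar>c - c'\<bar>" using g(1) by auto
      then show "2 * \<gamma> < \<bar>c - c'\<bar>" by (simp add: pos_le_divide_eq)
    qed
    moreover have "c + \<gamma> < real (N + 1)" using g(3) inside[OF x(2)] by (simp add: pos_le_divide_eq)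
    ultimately show "\<exists>\<gamma>>0. case x of (c, c') \<Rightarrow> (c \<noteq> c' \<longrightarrow> 2 * \<gamma> < \<bar>c - c'\<bar>) \<and> \<gamma> \<le> c \<and> c + \<gamma> < real (N + 1)"
      using x(1) g(2) by auto
  qed (use finC in auto)
  then obtain \<gamma> where \<gamma>0: "0 < \<gamma>"
    and all: "\<forall>(c, c')\<in>?C \<times> ?C. (c \<noteq> c' \<longrightarrow> 2 * \<gamma> < \<bar>c - c'\<bar>) \<and> \<gamma> \<le> c \<and> c + \<gamma> < real (N + 1)"
    by (elim exE conjE)
  have pair: "(c \<noteq> c' \<longrightarrow> 2 * \<gamma> < \<bar>c - c'\<bar>) \<and> \<gamma> \<le> c \<and> c + \<gamma> < real (N + 1)" if "c \<in> ?C" "c' \<in> ?C" for c c'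
    using bspec[OF all, of "(c, c')"] that by simp
  have \<gamma>: "0 < \<gamma>" "\<And>c c'. c \<in> ?C \<Longrightarrow> c' \<in> ?C \<Longrightarrow> c \<noteq> c' \<Longrightarrow> 2 * \<gamma> < \<bar>c - c'\<bar>"
    "\<And>c. c \<in> ?C \<Longrightarrow> \<gamma> \<le> c \<and> c + \<gamma> < real (N + 1)" using \<gamma>0 pair by blast+
  interpret stability K r N p \<epsilon> \<mu> \<gamma> v
    by (rule stability.intro) (fact | rule \<gamma>; assumption)+
  have "\<exists>d>0. \<forall>(\<sigma>, i)\<in>K \<times> {..N + 1}. v \<sigma> i \<noteq> \<epsilon> \<longrightarrow> d \<le> \<bar>v \<sigma> i - \<epsilon>\<bar>"
  proof (rule finite_common)
    fix x :: "'a set \<times> nat"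
    obtain \<sigma> i where x: "x = (\<sigma>, i)" by fastforce
    show "\<exists>d>0. case x of (\<sigma>, i) \<Rightarrow> v \<sigma> i \<noteq> \<epsilon> \<longrightarrow> d \<le> \<bar>v \<sigma> i - \<epsilon>\<bar>"
      unfolding x by (intro exI[of _ "if v \<sigma> i = \<epsilon> then 1 else \<bar>v \<sigma> i - \<epsilon>\<bar>"]) auto
  qed (use fin in auto)
  then obtain d where d: "0 < d" "\<And>\<sigma> i. \<sigma> \<in> K \<Longrightarrow> i \<le> N + 1 \<Longrightarrow> v \<sigma> i \<noteq> \<epsilon> \<Longrightarrow> d \<le> \<bar>v \<sigma> i - \<epsilon>\<bar>" by auto
  \<comment> \<open>Beyond \<open>N + 1\<close> all values are 0 as at \<open>N + 1\<close>, so the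
    finitely many indices already treated decide.\<close>
  have d': "d \<le> \<bar>v \<sigma> i - \<epsilon>\<bar>" if "\<sigma> \<in> K" "v \<sigma> i \<noteq> \<epsilon>" for \<sigma> i
  proof (cases "i \<le> N + 1")
    case False
    then have "v \<sigma> i = v \<sigma> (N + 1)" using vz by simp
    then show ?thesis using d(2)[OF that(1), of "N + 1"] that(2) by simp
  qed (use d(2) that in auto)
  show ?thesis
  \<comment> \<open>The bound \<open>d\<close> keeps off-level values off the level, and
    \<open>\<gamma> * \<mu>\<close> makes the displacement of events smaller than \<gamma>.\<close>
  proof (intro exI[of _ "min d (\<gamma> * \<mu>)"] conjI ballI allI impI)
    show "0 < min d (\<gamma> * \<mu>)" using d(1) \<gamma>(1) \<mu> by simp
    fix w \<eta> assume w: "w \<in> FF N K" "0 \<le> \<eta>" "\<eta> < min d (\<gamma> * \<mu>)" "\<forall>\<sigma> i. \<bar>v \<sigma> i - w \<sigma> i\<bar> \<le> \<eta>"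
    have "\<eta> / \<mu> < \<gamma>" using w(3) \<mu> by (simp add: pos_divide_less_eq)
    moreover have "\<eta> < \<bar>v \<sigma> i - \<epsilon>\<bar>" if "\<sigma> \<in> K" "v \<sigma> i \<noteq> \<epsilon>" for \<sigma> i using d'[OF that] w(3) by simp
    ultimately have "close w \<eta>" using w by (simp add: close_def)
    then show "matched (\<eta> / \<mu>) (PH F p (events w)) (PH F p (events v))" by (rule stable)
  qed
qed

section \<open>The Lipschitz estimate\<close>

text \<open>Lying outside the exceptional set is an open condition, here with one constant for a
  whole neighbourhood. The same \<mu> is the radius and the bound on the slopes, and it yields the
  Lipschitz constant \<open>1 / \<mu>\<close>.\<close>

lemma nondegenerate_neighbourhood:
  assumes fin: "finite K" and \<epsilon>: "\<epsilon> > 0" and u: "u \<in> FF N K - N_exceptional N K \<epsilon> p"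
  shows "\<exists>\<mu>>0. \<forall>v\<in>FF N K. (\<forall>\<sigma> i. \<bar>v \<sigma> i - u \<sigma> i\<bar> < \<mu>) \<longrightarrow> nondegenerate K p \<epsilon> \<mu> v"
proof -
  have uF: "u \<in> FF N K" and ex: "u \<notin> N_exceptional N K \<epsilon> p" using u by auto
  \<comment> \<open>Outside the indices 1 to \<open>N\<close> the value is 0 and hence below
    \<epsilon>, so the index ranges in the exceptional sets lose nothing.\<close>
  have idx: "i \<in> {1..N}" if "u \<sigma> i \<ge> \<epsilon>" for \<sigma> i using FF_zero[OF uF, of i \<sigma>] that \<epsilon> by fastforce
  have flat: "\<not> (u \<sigma> i = \<epsilon> \<and> u \<sigma> (Suc i) = \<epsilon>)" if "\<sigma> \<in> K" "sdim \<sigma> \<in> {p, Suc p}" for \<sigma> i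
  proof
    assume *: "u \<sigma> i = \<epsilon> \<and> u \<sigma> (Suc i) = \<epsilon>"
    then have "i \<in> {1..N - 1}" using idx[of \<sigma> i] idx[of \<sigma> "Suc i"] by auto
    then have "\<exists>i\<in>{1..N - 1}. u \<sigma> i = \<epsilon> \<and> u \<sigma> (i + 1) = \<epsilon>" using * by (intro bexI[of _ i]) simp_all
    moreover have "sdim \<sigma> \<in> {p, p + 1}" using that(2) by simp
    ultimately have "u \<in> N_flat N K \<epsilon> p" unfolding N_flat_def mem_Collect_eq using that(1) uF by blast
    then show False using ex by (simp add: N_exceptional_def)
  qed
  have plus: "u \<sigma> i < \<epsilon> \<or> u \<sigma> (Suc (Suc i)) < \<epsilon>" if "\<sigma> \<in> K" "sdim \<sigma> = p" "u \<sigma> (Suc i) = \<epsilon>" for \<sigma> i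
  proof (rule ccontr)
    assume "\<not> ?thesis"
    then have *: "u \<sigma> i > \<epsilon>" "u \<sigma> (Suc (Suc i)) > \<epsilon>"
      using flat[OF that(1), of i] flat[OF that(1), of "Suc i"] that(2,3) by (auto simp: less_le)
    then have "Suc i \<in> {2..N - 1}" using idx[of \<sigma> i] idx[of \<sigma> "Suc (Suc i)"] by auto
    then have "\<exists>i\<in>{2..N - 1}. u \<sigma> i = \<epsilon> \<and> u \<sigma> (i - 1) > \<epsilon> \<and> u \<sigma> (i + 1) > \<epsilon>"
      using * that(3) by (intro bexI[of _ "Suc i"]) simp_all
    then have "u \<in> N_plus N K \<epsilon> p" unfolding N_plus_def mem_Collect_eq using that(1,2) uF by blast
    then show False using ex by (simp add: N_exceptional_def)
  qed
  have minus: "u \<sigma> i > \<epsilon> \<or> u \<sigma> (Suc (Suc i)) > \<epsilon>" if "\<sigma> \<in> K" "sdim \<sigma> = Suc p" "u \<sigma> (Suc i) = \<epsilon>" for \<sigma> i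
  proof (rule ccontr)
    assume "\<not> ?thesis"
    then have *: "u \<sigma> i < \<epsilon>" "u \<sigma> (Suc (Suc i)) < \<epsilon>"
      using flat[OF that(1), of i] flat[OF that(1), of "Suc i"] that(2,3) by (auto simp: less_le)
    have "Suc i \<in> {1..N}" using idx[of \<sigma> "Suc i"] that(3) by simp
    then have "\<exists>i\<in>{1..N}. u \<sigma> i = \<epsilon> \<and> u \<sigma> (i - 1) < \<epsilon> \<and> u \<sigma> (i + 1) < \<epsilon>"
      using * that(3) by (intro bexI[of _ "Suc i"]) simp_all
    moreover have "sdim \<sigma> = p + 1" using that(2) by simp
    ultimately have "u \<in> N_minus N K \<epsilon> (p + 1)" unfolding N_minus_def mem_Collect_eq using that(1) uF by blast
    then show False using ex by (simp add: N_exceptional_def)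
  qed
  \<comment> \<open>Conditions with slack: a perturbation by less than \<mu> leaves at least \<mu>
    of \<open>2 * \<mu>\<close>, and turns each alternative into a vertex off the level or a
    neighbour strictly on the required side.\<close>
  define P where "P \<sigma> i \<mu> \<longleftrightarrow>
    (sdim \<sigma> \<in> {p, Suc p} \<longrightarrow> 2 * \<mu> \<le> max \<bar>u \<sigma> i - \<epsilon>\<bar> \<bar>u \<sigma> (Suc i) - \<epsilon>\<bar>) \<and>
    (sdim \<sigma> = p \<longrightarrow> \<mu> \<le> \<bar>u \<sigma> (Suc i) - \<epsilon>\<bar> \<or> u \<sigma> i \<le> \<epsilon> - \<mu> \<or> u \<sigma> (Suc (Suc i)) \<le> \<epsilon> - \<mu>) \<and>
    (sdim \<sigma> = Suc p \<longrightarrow> \<mu> \<le> \<bar>u \<sigma> (Suc i) - \<epsilon>\<bar> \<or> u \<sigma> i \<ge> \<epsilon> + \<mu> \<or> u \<sigma> (Suc (Suc i)) \<ge> \<epsilon> + \<mu>)" for \<sigma> i \<mu>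
  have mono: "P \<sigma> i \<mu>'" if "P \<sigma> i \<mu>" "\<mu>' \<le> \<mu>" for \<sigma> i \<mu> \<mu>'
    unfolding P_def
  proof (intro conjI impI)
    assume "sdim \<sigma> \<in> {p, Suc p}"
    then have "2 * \<mu> \<le> max \<bar>u \<sigma> i - \<epsilon>\<bar> \<bar>u \<sigma> (Suc i) - \<epsilon>\<bar>" using that(1) unfolding P_def by blast
    with that(2) show "2 * \<mu>' \<le> max \<bar>u \<sigma> i - \<epsilon>\<bar> \<bar>u \<sigma> (Suc i) - \<epsilon>\<bar>" by linarith
  next
    assume "sdim \<sigma> = p"
    then have "\<mu> \<le> \<bar>u \<sigma> (Suc i) - \<epsilon>\<bar> \<or> u \<sigma> i \<le> \<epsilon> - \<mu> \<or> u \<sigma> (Suc (Suc i)) \<le> \<epsilon> - \<mu>"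
      using that(1) unfolding P_def by blast
    with that(2) show "\<mu>' \<le> \<bar>u \<sigma> (Suc i) - \<epsilon>\<bar> \<or> u \<sigma> i \<le> \<epsilon> - \<mu>' \<or> u \<sigma> (Suc (Suc i)) \<le> \<epsilon> - \<mu>'" by linarith
  next
    assume "sdim \<sigma> = Suc p"
    then have "\<mu> \<le> \<bar>u \<sigma> (Suc i) - \<epsilon>\<bar> \<or> u \<sigma> i \<ge> \<epsilon> + \<mu> \<or> u \<sigma> (Suc (Suc i)) \<ge> \<epsilon> + \<mu>"
      using that(1) unfolding P_def by blast
    with that(2) show "\<mu>' \<le> \<bar>u \<sigma> (Suc i) - \<epsilon>\<bar> \<or> u \<sigma> i \<ge> \<epsilon> + \<mu>' \<or> u \<sigma> (Suc (Suc i)) \<ge> \<epsilon> + \<mu>'" by linarith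
  qed
  have "\<exists>\<mu>>0. P \<sigma> i \<mu>" if \<sigma>: "\<sigma> \<in> K" for \<sigma> i
  proof -
    have 1: "\<exists>\<mu>>0. sdim \<sigma> \<in> {p, Suc p} \<longrightarrow> 2 * \<mu> \<le> max \<bar>u \<sigma> i - \<epsilon>\<bar> \<bar>u \<sigma> (Suc i) - \<epsilon>\<bar>"
    proof (cases "sdim \<sigma> \<in> {p, Suc p}")
      case True
      then have "0 < max \<bar>u \<sigma> i - \<epsilon>\<bar> \<bar>u \<sigma> (Suc i) - \<epsilon>\<bar>" using flat[OF \<sigma>, of i] by (auto simp: less_max_iff_disj)
      then show ?thesis by (intro exI[of _ "max \<bar>u \<sigma> i - \<epsilon>\<bar> \<bar>u \<sigma> (Suc i) - \<epsilon>\<bar> / 2"]) simp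
    qed (auto intro: exI[of _ 1])
    have 2: "\<exists>\<mu>>0. sdim \<sigma> = p \<longrightarrow> \<mu> \<le> \<bar>u \<sigma> (Suc i) - \<epsilon>\<bar> \<or> u \<sigma> i \<le> \<epsilon> - \<mu> \<or> u \<sigma> (Suc (Suc i)) \<le> \<epsilon> - \<mu>"
    proof -
      consider "sdim \<sigma> \<noteq> p" | "u \<sigma> (Suc i) \<noteq> \<epsilon>" | "u \<sigma> i < \<epsilon>" | "u \<sigma> (Suc (Suc i)) < \<epsilon>" using plus[OF \<sigma>] by blast
      then show ?thesis
      proof cases
        case 1 then show ?thesis by (intro exI[of _ 1]) simp
      next
        case 2 then show ?thesis by (intro exI[of _ "\<bar>u \<sigma> (Suc i) - \<epsilon>\<bar>"]) simp
      next
        case 3 then show ?thesis by (intro exI[of _ "\<epsilon> - u \<sigma> i"]) simp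
      next
        case 4 then show ?thesis by (intro exI[of _ "\<epsilon> - u \<sigma> (Suc (Suc i))"]) simp
      qed
    qed
    have 3: "\<exists>\<mu>>0. sdim \<sigma> = Suc p \<longrightarrow> \<mu> \<le> \<bar>u \<sigma> (Suc i) - \<epsilon>\<bar> \<or> u \<sigma> i \<ge> \<epsilon> + \<mu> \<or> u \<sigma> (Suc (Suc i)) \<ge> \<epsilon> + \<mu>"
    proof -
      consider "sdim \<sigma> \<noteq> Suc p" | "u \<sigma> (Suc i) \<noteq> \<epsilon>" | "u \<sigma> i > \<epsilon>" | "u \<sigma> (Suc (Suc i)) > \<epsilon>" using minus[OF \<sigma>] by blast
      then show ?thesis
      proof cases
        case 1 then show ?thesis by (intro exI[of _ 1]) simp
      next
        case 2 then show ?thesis by (intro exI[of _ "\<bar>u \<sigma> (Suc i) - \<epsilon>\<bar>"]) simp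
      next
        case 3 then show ?thesis by (intro exI[of _ "u \<sigma> i - \<epsilon>"]) simp
      next
        case 4 then show ?thesis by (intro exI[of _ "u \<sigma> (Suc (Suc i)) - \<epsilon>"]) simp
      qed
    qed
    obtain m1 m2 m3 where m: "m1 > 0" "m2 > 0" "m3 > 0"
      "sdim \<sigma> \<in> {p, Suc p} \<longrightarrow> 2 * m1 \<le> max \<bar>u \<sigma> i - \<epsilon>\<bar> \<bar>u \<sigma> (Suc i) - \<epsilon>\<bar>"
      "sdim \<sigma> = p \<longrightarrow> m2 \<le> \<bar>u \<sigma> (Suc i) - \<epsilon>\<bar> \<or> u \<sigma> i \<le> \<epsilon> - m2 \<or> u \<sigma> (Suc (Suc i)) \<le> \<epsilon> - m2"
      "sdim \<sigma> = Suc p \<longrightarrow> m3 \<le> \<bar>u \<sigma> (Suc i) - \<epsilon>\<bar> \<or> u \<sigma> i \<ge> \<epsilon> + m3 \<or> u \<sigma> (Suc (Suc i)) \<ge> \<epsilon> + m3"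
      using 1 2 3 by blast
    define m where "m = min m1 (min m2 m3)"
    have le: "m \<le> m1" "m \<le> m2" "m \<le> m3" "0 < m" using m(1-3) by (auto simp: m_def)
    have "P \<sigma> i m" unfolding P_def
    proof (intro conjI impI)
      assume "sdim \<sigma> \<in> {p, Suc p}"
      with m(4) have "2 * m1 \<le> max \<bar>u \<sigma> i - \<epsilon>\<bar> \<bar>u \<sigma> (Suc i) - \<epsilon>\<bar>" by blast
      with le(1) show "2 * m \<le> max \<bar>u \<sigma> i - \<epsilon>\<bar> \<bar>u \<sigma> (Suc i) - \<epsilon>\<bar>" by linarith
    next
      assume "sdim \<sigma> = p"
      with m(5) have "m2 \<le> \<bar>u \<sigma> (Suc i) - \<epsilon>\<bar> \<or> u \<sigma> i \<le> \<epsilon> - m2 \<or> u \<sigma> (Suc (Suc i)) \<le> \<epsilon> - m2" by blast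
      with le(2) show "m \<le> \<bar>u \<sigma> (Suc i) - \<epsilon>\<bar> \<or> u \<sigma> i \<le> \<epsilon> - m \<or> u \<sigma> (Suc (Suc i)) \<le> \<epsilon> - m" by linarith
    next
      assume "sdim \<sigma> = Suc p"
      with m(6) have "m3 \<le> \<bar>u \<sigma> (Suc i) - \<epsilon>\<bar> \<or> u \<sigma> i \<ge> \<epsilon> + m3 \<or> u \<sigma> (Suc (Suc i)) \<ge> \<epsilon> + m3" by blast
      with le(3) show "m \<le> \<bar>u \<sigma> (Suc i) - \<epsilon>\<bar> \<or> u \<sigma> i \<ge> \<epsilon> + m \<or> u \<sigma> (Suc (Suc i)) \<ge> \<epsilon> + m" by linarith
    qed
    then show ?thesis using le(4) by blast
  qed
  then have ex1: "\<exists>\<mu>>0. P (fst x) (snd x) \<mu>" if "x \<in> K \<times> {..N + 1}" for x using that by auto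
  have "\<exists>\<mu>>0. \<forall>x\<in>K \<times> {..N + 1}. P (fst x) (snd x) \<mu>"
    by (rule finite_common[OF _ ex1]) (use fin mono in auto)
  then obtain \<mu>0 where \<mu>0: "0 < \<mu>0" "\<forall>x\<in>K \<times> {..N + 1}. P (fst x) (snd x) \<mu>0" by blast
  \<comment> \<open>Beyond \<open>N + 1\<close> every value is 0, at distance \<epsilon> from the
    level; the minimum with \<epsilon> covers these indices.\<close>
  define \<mu> where "\<mu> = min \<mu>0 \<epsilon>"
  have \<mu>: "0 < \<mu>" "\<mu> \<le> \<epsilon>" "\<mu> \<le> \<mu>0" using \<mu>0(1) \<epsilon> by (auto simp: \<mu>_def)
  have Pall: "P \<sigma> i \<mu>" if "\<sigma> \<in> K" "i \<le> N + 1" for \<sigma> i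
    using mono[OF _ \<mu>(3), of \<sigma> i] \<mu>0(2) that by auto
  have "nondegenerate K p \<epsilon> \<mu> v" if v: "v \<in> FF N K" "\<forall>\<sigma> i. \<bar>v \<sigma> i - u \<sigma> i\<bar> < \<mu>" for v
  proof -
    have d: "v \<sigma> i < u \<sigma> i + \<mu>" "u \<sigma> i < v \<sigma> i + \<mu>" for \<sigma> i
    proof -
      have "\<bar>v \<sigma> i - u \<sigma> i\<bar> < \<mu>" using v(2) by blast
      then show "v \<sigma> i < u \<sigma> i + \<mu>" "u \<sigma> i < v \<sigma> i + \<mu>" by linarith+
    qed
    have out: "v \<sigma> i = 0" if "i > N" for \<sigma> i using FF_zero[OF v(1)] that by simp
    have "\<mu> \<le> max \<bar>v \<sigma> i - \<epsilon>\<bar> \<bar>v \<sigma> (Suc i) - \<epsilon>\<bar>" if \<sigma>: "\<sigma> \<in> K" "sdim \<sigma> \<in> {p, Suc p}" for \<sigma> i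
    proof (cases "i \<le> N + 1")
      case True
      then have "2 * \<mu> \<le> max \<bar>u \<sigma> i - \<epsilon>\<bar> \<bar>u \<sigma> (Suc i) - \<epsilon>\<bar>" using Pall[OF \<sigma>(1) True] \<sigma>(2) unfolding P_def by blast
      then consider "2 * \<mu> \<le> \<bar>u \<sigma> i - \<epsilon>\<bar>" | "2 * \<mu> \<le> \<bar>u \<sigma> (Suc i) - \<epsilon>\<bar>" by (auto simp: le_max_iff_disj)
      then show ?thesis
      proof cases
        case 1
        then have "\<mu> \<le> \<bar>v \<sigma> i - \<epsilon>\<bar>" using d[of \<sigma> i] by linarith
        then show ?thesis by simp
      next
        case 2
        then have "\<mu> \<le> \<bar>v \<sigma> (Suc i) - \<epsilon>\<bar>" using d[of \<sigma> "Suc i"] by linarith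
        then show ?thesis by simp
      qed
    next
      case False
      then show ?thesis using out[of i \<sigma>] \<mu>(2) by simp
    qed
    moreover have "v \<sigma> i < \<epsilon> \<or> v \<sigma> (Suc (Suc i)) < \<epsilon>" if \<sigma>: "\<sigma> \<in> K" "sdim \<sigma> = p" "v \<sigma> (Suc i) = \<epsilon>" for \<sigma> i
    proof -
      have "i \<le> N + 1" using out[of "Suc i" \<sigma>] \<sigma>(3) \<epsilon> by (cases "i \<le> N + 1") auto
      then have "\<mu> \<le> \<bar>u \<sigma> (Suc i) - \<epsilon>\<bar> \<or> u \<sigma> i \<le> \<epsilon> - \<mu> \<or> u \<sigma> (Suc (Suc i)) \<le> \<epsilon> - \<mu>"
        using Pall[OF \<sigma>(1)] \<sigma>(2) unfolding P_def by blast
      then show ?thesis using d[of \<sigma> i] d[of \<sigma> "Suc i"] d[of \<sigma> "Suc (Suc i)"] \<sigma>(3) by linarith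
    qed
    moreover have "v \<sigma> i > \<epsilon> \<or> v \<sigma> (Suc (Suc i)) > \<epsilon>" if \<sigma>: "\<sigma> \<in> K" "sdim \<sigma> = Suc p" "v \<sigma> (Suc i) = \<epsilon>" for \<sigma> i
    proof -
      have "i \<le> N + 1" using out[of "Suc i" \<sigma>] \<sigma>(3) \<epsilon> by (cases "i \<le> N + 1") auto
      then have "\<mu> \<le> \<bar>u \<sigma> (Suc i) - \<epsilon>\<bar> \<or> u \<sigma> i \<ge> \<epsilon> + \<mu> \<or> u \<sigma> (Suc (Suc i)) \<ge> \<epsilon> + \<mu>"
        using Pall[OF \<sigma>(1)] \<sigma>(2) unfolding P_def by blast
      then show ?thesis using d[of \<sigma> i] d[of \<sigma> "Suc i"] d[of \<sigma> "Suc (Suc i)"] \<sigma>(3) by linarith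
    qed
    ultimately show ?thesis unfolding nondegenerate_def by blast
  qed
  then show ?thesis using \<mu>(1) by blast
qed

text \<open>Thanks to the extension by zero the pointwise bound holds for all sets and indices,
  which is the form that \<open>close\<close> uses.\<close>

lemma le_sup_norm:
  assumes "finite K" "u \<in> FF N K" "v \<in> FF N K"
  shows "\<bar>u \<sigma> i - v \<sigma> i\<bar> \<le> sup_norm N K (u - v)" "0 \<le> sup_norm N K (u - v)"
proof -
  have "{\<bar>(u - v) \<sigma> i\<bar> | \<sigma> i. \<sigma> \<in> K \<and> i \<le> N + 1} = (\<lambda>(\<sigma>, i). \<bar>(u - v) \<sigma> i\<bar>) ` (K \<times> {..N + 1})" by auto
  then have fin: "finite (insert 0 {\<bar>(u - v) \<sigma> i\<bar> | \<sigma> i. \<sigma> \<in> K \<and> i \<le> N + 1})" using assms(1) by simp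
  show nn: "0 \<le> sup_norm N K (u - v)" unfolding sup_norm_def by (rule Max_ge[OF fin]) simp
  show "\<bar>u \<sigma> i - v \<sigma> i\<bar> \<le> sup_norm N K (u - v)"
  proof (cases "\<sigma> \<in> K \<and> i \<le> N + 1")
    case True
    then have "\<bar>(u - v) \<sigma> i\<bar> \<le> sup_norm N K (u - v)" unfolding sup_norm_def by (intro Max_ge[OF fin]) blast
    then show ?thesis by (simp add: minus_apply)
  next
    case False
    then have "\<not> (\<sigma> \<in> K \<and> i \<in> {1..N})" by auto
    then have "u \<sigma> i = 0" "v \<sigma> i = 0" using assms(2,3) unfolding FF_def by blast+
    then show ?thesis using nn by simp
  qed
qed

lemma FF_convex:
  assumes "u \<in> FF N K" "v \<in> FF N K" "0 \<le> s" "s \<le> 1"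
  shows "(\<lambda>\<sigma> i. (1 - s) * u \<sigma> i + s * v \<sigma> i) \<in> FF N K"
proof -
  have z: "f \<sigma> i = 0" if "f \<in> FF N K" "\<not> (\<sigma> \<in> K \<and> i \<in> {1..N})" for f \<sigma> i
    using that unfolding FF_def by blast
  have m: "f \<tau> i \<le> f \<sigma> i" if "f \<in> FF N K" "i \<in> {1..N}" "\<sigma> \<in> K" "\<tau> \<in> K" "\<sigma> \<subset> \<tau>" for f \<sigma> \<tau> i
    using that unfolding FF_def by blast
  show ?thesis
    unfolding FF_def mem_Collect_eq
  proof (intro conjI allI ballI impI)
    fix \<sigma> i assume "(1 - s) * u \<sigma> i + s * v \<sigma> i \<noteq> 0"
    then have "u \<sigma> i \<noteq> 0 \<or> v \<sigma> i \<noteq> 0" by auto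
    then show "\<sigma> \<in> K" "i \<in> {1..N}" using z[OF assms(1)] z[OF assms(2)] by metis+
  next
    fix i \<sigma> \<tau> assume "i \<in> {1..N}" "\<sigma> \<in> K" "\<tau> \<in> K" "\<sigma> \<subset> \<tau>"
    then have "u \<tau> i \<le> u \<sigma> i" "v \<tau> i \<le> v \<sigma> i" using m assms(1,2) by blast+
    then show "(1 - s) * u \<tau> i + s * v \<tau> i \<le> (1 - s) * u \<sigma> i + s * v \<sigma> i"
      using assms(3,4) by (intro add_mono mult_left_mono) simp_all
  qed
qed

theorem theorem3p9:
  fixes K :: "'v set set" and N p :: nat and \<epsilon> :: real and r :: "'v event rel"
  assumes "simplicial_complex K"
    and "event_order K r"
    and "\<epsilon> > 0"
  shows "locally_lipschitz_on N K (\<lambda>v. PH TYPE('f::field) p (encode r (S N K \<epsilon> v)))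
           (FF N K - N_exceptional N K \<epsilon> p)"
  unfolding locally_lipschitz_on_def
proof
  let ?F = "\<lambda>v. PH TYPE('f) p (encode r (S N K \<epsilon> v))"
  let ?A = "FF N K - N_exceptional N K \<epsilon> p"
  have fin: "finite K" using assms(1) by (simp add: simplicial_complex_def)
  fix u assume u: "u \<in> ?A"
  then have uF: "u \<in> FF N K" by simp
  obtain \<mu> where \<mu>: "0 < \<mu>"
    and nd: "\<And>v. v \<in> FF N K \<Longrightarrow> (\<And>\<sigma> i. \<bar>v \<sigma> i - u \<sigma> i\<bar> < \<mu>) \<Longrightarrow> nondegenerate K p \<epsilon> \<mu> v"
    using nondegenerate_neighbourhood[OF fin assms(3) u] by blast
  define U where "U = {w \<in> ?A. sup_norm N K (w - u) < \<mu>}"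
  have "d_B (?F w) (?F w') \<le> ereal (1 / \<mu> * sup_norm N K (w - w'))" if w: "w \<in> U" "w' \<in> U" for w w'
  proof -
    have wF: "w \<in> FF N K" "w' \<in> FF N K" using w by (auto simp: U_def)
    define d where "d = sup_norm N K (w - w')"
    have d: "0 \<le> d" "\<And>\<sigma> i. \<bar>w \<sigma> i - w' \<sigma> i\<bar> \<le> d" using le_sup_norm[OF fin wF] by (simp_all add: d_def)
    define g where "g s = (\<lambda>\<sigma> i. (1 - s) * w \<sigma> i + s * w' \<sigma> i)" for s :: real
    have gF: "g s \<in> FF N K" if "s \<in> {0..1}" for s
      unfolding g_def using that by (intro FF_convex wF) auto
    \<comment> \<open>The segment stays in the ball around \<open>u\<close> on which
      \<open>nondegenerate\<close> holds with the uniform \<mu>, and this together with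
      \<open>gF\<close> is what \<open>stable_at\<close> asks of its points.\<close>
    have near: "\<bar>g s \<sigma> i - u \<sigma> i\<bar> < \<mu>" if "s \<in> {0..1}" for s \<sigma> i
    proof -
      have "\<bar>w \<sigma> i - u \<sigma> i\<bar> < \<mu>" "\<bar>w' \<sigma> i - u \<sigma> i\<bar> < \<mu>"
        using le_sup_norm(1)[OF fin wF(1) uF, of \<sigma> i] le_sup_norm(1)[OF fin wF(2) uF, of \<sigma> i] w
        by (auto simp: U_def)
      moreover have "g s \<sigma> i - u \<sigma> i = (1 - s) * (w \<sigma> i - u \<sigma> i) + s * (w' \<sigma> i - u \<sigma> i)"
        by (simp add: g_def algebra_simps)
      moreover have "\<bar>(1 - s) * (w \<sigma> i - u \<sigma> i) + s * (w' \<sigma> i - u \<sigma> i)\<bar>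
          \<le> (1 - s) * \<bar>w \<sigma> i - u \<sigma> i\<bar> + s * \<bar>w' \<sigma> i - u \<sigma> i\<bar>"
        using abs_triangle_ineq[of "(1 - s) * (w \<sigma> i - u \<sigma> i)" "s * (w' \<sigma> i - u \<sigma> i)"] that by (simp add: abs_mult)
      moreover have "(1 - s) * \<bar>w \<sigma> i - u \<sigma> i\<bar> + s * \<bar>w' \<sigma> i - u \<sigma> i\<bar> < \<mu>"
        using convex_bound_lt[of "\<bar>w \<sigma> i - u \<sigma> i\<bar>" \<mu> "\<bar>w' \<sigma> i - u \<sigma> i\<bar>" "1 - s" s] calculation(1,2) that by simp
      ultimately show ?thesis by simp
    qed
    have step: "\<bar>g s \<sigma> i - g s' \<sigma> i\<bar> \<le> d * \<bar>s - s'\<bar>" for s s' \<sigma> i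
    proof -
      have "g s \<sigma> i - g s' \<sigma> i = (s' - s) * (w \<sigma> i - w' \<sigma> i)" by (simp add: g_def algebra_simps)
      then have "\<bar>g s \<sigma> i - g s' \<sigma> i\<bar> = \<bar>s - s'\<bar> * \<bar>w \<sigma> i - w' \<sigma> i\<bar>" by (simp add: abs_mult abs_minus_commute)
      also have "\<dots> \<le> \<bar>s - s'\<bar> * d" by (intro mult_left_mono d) simp
      finally show ?thesis by (simp add: mult.commute)
    qed
    have "matched (d / \<mu>) (?F (g 0)) (?F (g 1))"
    proof (rule matched_path)
      show "0 \<le> d / \<mu>" using d \<mu> by simp
      fix s :: real assume s: "s \<in> {0..1}"
      obtain \<delta> where \<delta>: "0 < \<delta>" "\<And>v \<eta>. v \<in> FF N K \<Longrightarrow> 0 \<le> \<eta> \<Longrightarrow> \<eta> < \<delta> \<Longrightarrow> (\<And>\<sigma> i. \<bar>g s \<sigma> i - v \<sigma> i\<bar> \<le> \<eta>) \<Longrightarrow>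
          matched (\<eta> / \<mu>) (?F v) (?F (g s))"
        using stable_at[OF assms \<mu> gF[OF s] nd[OF gF[OF s] near[OF s]], of "TYPE('f)"] by blast
      \<comment> \<open>The denominator \<open>d + 1\<close> in the radius also covers
        \<open>d = 0\<close>.\<close>
      have "matched (d / \<mu> * \<bar>s - s'\<bar>) (?F (g s)) (?F (g s'))" if s': "s' \<in> {0..1}" "\<bar>s - s'\<bar> < \<delta> / (d + 1)" for s'
      proof -
        have "d * \<bar>s - s'\<bar> \<le> (d + 1) * \<bar>s - s'\<bar>" by (intro mult_right_mono) auto
        also have "\<dots> < \<delta>" using s'(2) d(1) by (simp add: pos_less_divide_eq mult.commute)
        finally have "matched (d * \<bar>s - s'\<bar> / \<mu>) (?F (g s')) (?F (g s))"
          using d(1) by (intro \<delta>(2)[OF gF[OF s'(1)]] step) auto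
        then have "matched (d * \<bar>s - s'\<bar> / \<mu>) (?F (g s)) (?F (g s'))" using d(1) \<mu> by (intro matched_sym[of _ "?F (g s')"]) auto
        then show ?thesis by simp
      qed
      moreover have "0 < \<delta> / (d + 1)" using \<delta>(1) d(1) by simp
      ultimately show "\<exists>\<delta>>0. \<forall>s'\<in>{0..1}. \<bar>s - s'\<bar> < \<delta> \<longrightarrow> matched (d / \<mu> * \<bar>s - s'\<bar>) (?F (g s)) (?F (g s'))" by blast
    qed
    then have "matched (d / \<mu>) (?F w) (?F w')" by (simp add: g_def)
    then have "d_B (?F w) (?F w') \<le> ereal (d / \<mu>)" by (rule d_B_le) (auto simp: PH_def)
    then show ?thesis by (simp add: d_def)
  qed
  then show "\<exists>U C::real. U \<subseteq> ?A \<and> (\<exists>\<delta>>0. {w \<in> ?A. sup_norm N K (w - u) < \<delta>} \<subseteq> U) \<and>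
     (\<forall>w\<in>U. \<forall>w'\<in>U. d_B (?F w) (?F w') \<le> ereal (C * sup_norm N K (w - w')))"
    using \<mu> by (intro exI[of _ U] exI[of _ "1 / \<mu>"]) (auto simp: U_def)
qed

end
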